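(* Let $C\subset\mathbb{R}^n$ be a pointed closed convex cone with nonempty interior. Let $p,q\in\mathbb{R}$ and let $\mu$ be a nonzero finite Borel measure defined on $\Omega_{C^\circ}$. If $p\le 0$ and $p<q$, then there exists a $(C,p,q)$-close set $\mathbb{A}$ such that $\mu=\widetilde{C}_{p,q}(\mathbb{A},\cdot)$.
   Context: A pointed closed convex cone $C\subset\mathbb{R}^n$ is a closed convex set with $C=\{\lambda x:\lambda\ge 0,\ x\in C\}$, nonempty interior, and $C\cap(-C)=\{o\}$, where $o$ is the origin. Its polar cone is $C^\circ=\{x\in\mathbb{R}^n: x\cdot y\le 0\text{ for all }y\in C\}$. Put $\Omega_C=S^{n-1}\cap\operatorname{int}C$ and $\Omega_{C^\circ}=S^{n-1}\cap\operatorname{int}C^\circ$. For $u\in S^{n-1}$, $a\in\mathbb{R}$, let $H(u,a)=\{x: x\cdot u=a\}$ and $H^-(u,a)=\{x: x\cdot u\le a\}$. An unbounded closed convex set $\mathbb{A}\subset C$ with $o\notin\mathbb{A}$ is $C$-compatible if $\mathbb{A}$ equals the intersection of $C$ with all half-spaces $H^-(u,a)$, $u\in\Omega_{C^\circ}$, $a\in\mathbb{R}$, that contain $\mathbb{A}$. For a $C$-compatible set $\mathbb{A}$: the support function is $h_C(\mathbb{A},u)=\sup\{x\cdot u:x\in\mathbb{A}\}\in(-\infty,0)$, $u\in\Omega_{C^\circ}$; the radial function is $\rho_C(\mathbb{A},v)=\sup\{r>0: rv\in C\setminus\mathbb{A}\}$, for $v\in\Omega_C$ (the same formula is used for $v\in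 C\cap S^{n-1}$). Let $\partial_e\mathbb{A}=\partial\mathbb{A}\cap\partial(C\setminus\mathbb{A})$ and $\Omega_C^e=\{x/|x|:x\in\partial_e\mathbb{A}\}\supseteq\Omega_C$ (the difference has spherical Lebesgue measure zero). For $\eta\subseteq\Omega_{C^\circ}$, the reverse radial Gauss image is $\boldsymbol{\alpha}^*_{\mathbb{A}}(\eta)=\{v\in\Omega_C^e:\rho_C(\mathbb{A},v)v\in H(u,h_C(\mathbb{A},u))\text{ for some }u\in\eta\}$. With $dv$ the spherical Lebesgue measure, the $q$-th dual curvature measure (possibly infinite) is, for Borel $\eta\subseteq\Omega_{C^\circ}$, $\widetilde{C}_q(\mathbb{A},\eta)=\frac1n\int_{\boldsymbol{\alpha}^*_{\mathbb{A}}(\eta)}\rho_C(\mathbb{A},v)^q\,dv$ if $q\ne0$, and $\widetilde{C}_0(\mathbb{A},\eta)=\int_{\boldsymbol{\alpha}^*_{\mathbb{A}}(\eta)}dv$. The $(p,q)$-th dual curvature measure is $\widetilde{C}_{p,q}(\mathbb{A},\eta)=\int_\eta(-h_C(\mathbb{A},u))^{-p}\,d\widetilde{C}_q(\mathbb{A},u)$, $\eta\subseteq\Omega_{C^\circ}$ Borel. A $C$-compatible set $\mathbb{A}$ is $(C,p,q)$-close if $\widetilde{C}_{p,q}(\mathbb{A},\Omega_{C^\circ})<\infty$. *)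

theory Defs
  imports "HOL-Analysis.Analysis"
begin

section \<open>Pointed cones, polar cones, half-spaces\<close>

definition pointed_cone :: "'a::euclidean_space set \<Rightarrow> bool" where
  "pointed_cone C \<longleftrightarrow>
     closed C \<and> convex C \<and> cone C \<and> interior C \<noteq> {} \<and> C \<inter> uminus ` C = {0}"

definition polar_cone :: "'a::euclidean_space set \<Rightarrow> 'a set" where
  "polar_cone C = {x. \<forall>y\<in>C. x \<bullet> y \<le> 0}"

definition Omega :: "'a::euclidean_space set \<Rightarrow> 'a set" where
  "Omega C = sphere 0 1 \<inter> interior C"

definition hyperplane :: "'a::euclidean_space \<Rightarrow> real \<Rightarrow> 'a set" where
  "hyperplane u a = {x. x \<bullet> u = a}"

definition halfspace_minus :: "'a::euclidean_space \<Rightarrow> real \<Rightarrow> 'a set" where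
  "halfspace_minus u a = {x. x \<bullet> u \<le> a}"


section \<open>Compatible sets\<close>

definition C_compatible :: "'a::euclidean_space set \<Rightarrow> 'a set \<Rightarrow> bool" where
  "C_compatible C A \<longleftrightarrow>
     \<not> bounded A \<and> closed A \<and> convex A \<and> A \<subseteq> C \<and> 0 \<notin> A \<and>
     A = C \<inter> \<Inter> {halfspace_minus u a | u a.
                    u \<in> Omega (polar_cone C) \<and> A \<subseteq> halfspace_minus u a}"

text \<open>The two suprema below are real-valued, hence unspecified where the supremum is infinite or the
  set is empty. For compatible \<open>A\<close> this does not happen where they are used:
  \<open>A\<close> is nonempty and \<open>x \<bullet> u \<le> 0\<close> for \<open>x \<in> C\<close> and \<open>u\<close> in the polar cone; and
  for \<open>v\<close> in \<open>Omega_e C A\<close> the ray through \<open>v\<close> starts outside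
  the closed set \<open>A\<close>, meets \<open>A\<close>, and stays in \<open>A\<close> from there on, since \<open>A + C \<subseteq> A\<close>.\<close>

definition support_fun :: "'a::euclidean_space set \<Rightarrow> 'a \<Rightarrow> real" where
  "support_fun A u = (SUP x\<in>A. x \<bullet> u)"

definition radial_fun :: "'a::euclidean_space set \<Rightarrow> 'a set \<Rightarrow> 'a \<Rightarrow> real" where
  "radial_fun C A v = Sup {r. r > 0 \<and> r *\<^sub>R v \<in> C - A}"

definition effective_boundary :: "'a::euclidean_space set \<Rightarrow> 'a set \<Rightarrow> 'a set" where
  "effective_boundary C A = frontier A \<inter> frontier (C - A)"

definition Omega_e :: "'a::euclidean_space set \<Rightarrow> 'a set \<Rightarrow> 'a set" where
  "Omega_e C A = (\<lambda>x. x /\<^sub>R norm x) ` effective_boundary C A"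

definition reverse_radial_Gauss_image ::
    "'a::euclidean_space set \<Rightarrow> 'a set \<Rightarrow> 'a set \<Rightarrow> 'a set" where
  "reverse_radial_Gauss_image C A \<eta> =
     {v \<in> Omega_e C A. \<exists>u\<in>\<eta>. radial_fun C A v *\<^sub>R v \<in> hyperplane u (support_fun A u)}"


section \<open>Spherical Lebesgue measure\<close>

text \<open>Normalised by polar coordinates: a Borel set \<open>S\<close> of unit vectors has measure \<open>n\<close> times the
  volume of the truncated cone \<open>{r v. 0 < r < 1, v \<in> S}\<close>. The measure is completed because reverse
  radial Gauss images of Borel sets are in general only Lebesgue measurable.\<close>

definition spherical_measure :: "'a::euclidean_space measure" where
  "spherical_measure =
     completion (scale_measure (of_nat DIM('a))
       (distr (restrict_space lborel (ball 0 1 - {0})) (restrict_space borel (sphere 0 1))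
          (\<lambda>x. x /\<^sub>R norm x)))"


section \<open>Dual curvature measures\<close>

definition dual_curvature :: "'a::euclidean_space set \<Rightarrow> real \<Rightarrow> 'a set \<Rightarrow> 'a set \<Rightarrow> ennreal" where
  "dual_curvature C q A \<eta> =
     (if q = 0
      then (\<integral>\<^sup>+v \<in> reverse_radial_Gauss_image C A \<eta>. 1 \<partial>spherical_measure)
      else ennreal (1 / real DIM('a)) *
        (\<integral>\<^sup>+v \<in> reverse_radial_Gauss_image C A \<eta>. ennreal (radial_fun C A v powr q)
           \<partial>spherical_measure))"

text \<open>For compatible \<open>A\<close> the set function \<open>dual_curvature C q A\<close> is countably additive on the Borel
  subsets of \<open>Omega (polar_cone C)\<close>, because reverse radial Gauss images of disjoint sets overlap in
  null sets only; so \<open>measure_of\<close> yields the measure with exactly these values.\<close>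

definition dual_curvature_measure ::
    "'a::euclidean_space set \<Rightarrow> real \<Rightarrow> 'a set \<Rightarrow> 'a measure" where
  "dual_curvature_measure C q A =
     measure_of (Omega (polar_cone C)) (sets (restrict_space borel (Omega (polar_cone C))))
       (dual_curvature C q A)"

definition pq_dual_curvature_measure ::
    "'a::euclidean_space set \<Rightarrow> real \<Rightarrow> real \<Rightarrow> 'a set \<Rightarrow> 'a measure" where
  "pq_dual_curvature_measure C p q A =
     density (dual_curvature_measure C q A) (\<lambda>u. ennreal ((- support_fun A u) powr (- p)))"

definition C_p_q_close :: "'a::euclidean_space set \<Rightarrow> real \<Rightarrow> real \<Rightarrow> 'a set \<Rightarrow> bool" where
  "C_p_q_close C p q A \<longleftrightarrow>
     C_compatible C A \<and>
     emeasure (pq_dual_curvature_measure C p q A) (Omega (polar_cone C)) < \<infinity>"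

end

(*
  On the interior of C, a C-compatible set is the region N >= 1 of a positive, concave, 1-homogeneous
  function N, which on unit vectors is the reciprocal of the radial function; a unit vector u of the polar cone is a normal of
  the set at the boundary point v / N v iff N w <= N v (u.w) / (u.v) for all w.

  If mu is concentrated on a finite set F, the set is cut out of C by half-spaces x.a <= - h a with a
  in F, and the equation prescribes for each a the number
    mass h a = (h a)^(q-p) * (integral of |a.v|^(-q) over the v whose boundary point lies on facet a).
  Raising h a increases mass h a and decreases all other masses.  Hence the subsolutions mass h <= mu
  are closed under maxima, they are bounded because p < q, and their supremum solves the equation
  (Perron's method).

  A general mu is a weak limit of discrete measures.  On compact parts of Omega C and of
  Omega (polar C) all quantities in the density |u.v|^(-p) N^(p-q) are comparable to powers of H = max h,
  which bounds H from both sides, so a subsequence of the gauges N converges.  Normals are unique almost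
  everywhere, since a concave function has at most one kink of given position and size on each line;
  therefore the normals converge almost everywhere, and dominated convergence, tested against functions
  supported away from the boundary of the polar cone, identifies the limit measure.
*)
theory Submission
  imports Defs "HOL-Complex_Analysis.Great_Picard"
begin

text \<open>The density is uncontrolled where directions approach the boundary of the cone or
  normals approach the boundary of the polar cone. Two facts compensate for this: a ball of radius r
  about v in C gives r <= -(u.v) for all unit u in the polar cone, and a ball of radius d about u in
  the polar cone gives d <= -(u.v) for all unit v in C. They fix the class of gauges: bounded above
  by the norm, below by radii of inscribed balls. For a discrete solution both bounds hold with the
  constant 1/H, so two-sided bounds for H give compactness. The inequality -(u.v)/H <= N v for the
  selected normal u is carried along because it turns a ball about u into a lower bound for N.
  Tightness does not enter: directions whose limit normal lies on the boundary of the polar cone are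
  cut off by an indicator, and equality on open sets determines a finite measure. Cones of zero
  volume are null for the measure on directions, so ties between facets and kinks of N are discarded
  by volume arguments alone.\<close>

section \<open>Cones and their polars\<close>

text \<open>From \<open>x\<close> one can move any distance \<open>s < r\<close> in direction
  \<open>u\<close> and stay in the cone, where the product with \<open>u\<close> is at most 0; this
  gives \<open>s \<le> - (u \<bullet> x)\<close>, and \<open>s\<close> tends to
  \<open>r\<close>.\<close>

lemma inner_polar_cone_ball:
  assumes r: "0 < r" and sub: "ball x r \<subseteq> C" and u: "u \<in> polar_cone C" "norm u = 1"
  shows "r \<le> - (u \<bullet> x)"
proof (rule dense_le_bounded[OF r])
  fix s assume s: "0 < s" "s < r"
  then have "x + s *\<^sub>R u \<in> C"
    using sub u(2) by (intro subsetD[OF sub]) (simp add: dist_norm)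
  then have "u \<bullet> (x + s *\<^sub>R u) \<le> 0"
    using u(1) by (auto simp: polar_cone_def)
  then show "s \<le> - (u \<bullet> x)"
    using u(2) by (simp add: inner_add_right dot_square_norm)
qed

text \<open>The previous estimate with the roles exchanged, applied to the normalised
  \<open>x\<close>, which lies in the polar of the polar cone.\<close>

lemma inner_ball_polar_cone:
  assumes r: "0 < r" and sub: "ball u r \<subseteq> polar_cone C" and x: "x \<in> C"
  shows "r * norm x \<le> - (u \<bullet> x)"
proof (cases "x = 0")
  case False
  have "r \<le> - ((x /\<^sub>R norm x) \<bullet> u)"
  proof (rule inner_polar_cone_ball[OF r])
    show "ball u r \<subseteq> polar_cone C" by fact
    show "x /\<^sub>R norm x \<in> polar_cone (polar_cone C)"
      using x False by (auto simp: polar_cone_def inner_commute divide_simps)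
    show "norm (x /\<^sub>R norm x) = 1" using False by simp
  qed
  then show ?thesis using False by (simp add: field_simps inner_commute)
qed auto

lemma closed_polar_cone: "closed (polar_cone C)"
proof -
  have "polar_cone C = (\<Inter>y\<in>C. {x. x \<bullet> y \<le> 0})" by (auto simp: polar_cone_def)
  moreover have "closed {x. x \<bullet> y \<le> 0}" for y :: 'a
    by (intro closed_Collect_le continuous_intros)
  ultimately show ?thesis by auto
qed

lemma convex_polar_cone: "convex (polar_cone C)"
proof -
  have "polar_cone C = (\<Inter>y\<in>C. {x. y \<bullet> x \<le> 0})" by (auto simp: polar_cone_def inner_commute)
  then show ?thesis by (auto intro!: convex_Inter convex_halfspace_le)
qed

lemma polar_cone_scaleR: "u \<in> polar_cone C \<Longrightarrow> 0 \<le> t \<Longrightarrow> t *\<^sub>R u \<in> polar_cone C"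
  by (auto simp: polar_cone_def mult_nonneg_nonpos)

lemma OmegaD:
  assumes "v \<in> Omega C"
  shows "norm v = 1" "v \<in> interior C" "v \<in> C"
  using assms interior_subset[of C] by (auto simp: Omega_def)

lemma neg_inner_le_1:
  fixes u v :: "'a::real_inner"
  assumes "norm u = 1" "norm v = 1" shows "- (u \<bullet> v) \<le> 1"
  using Cauchy_Schwarz_ineq2[of u v] assms by simp

locale pointed_cone_space =
  fixes C :: "'a::euclidean_space set"
  assumes pointed: "pointed_cone C"
begin

lemma closed_C: "closed C" and convex_C: "convex C" and cone_C: "cone C"
  and zero_C: "0 \<in> C"
  using pointed by (auto simp: pointed_cone_def)

lemma C_scaleR: "x \<in> C \<Longrightarrow> 0 \<le> t \<Longrightarrow> t *\<^sub>R x \<in> C"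
  using cone_C by (auto simp: cone_def)

lemma C_add: "x \<in> C \<Longrightarrow> y \<in> C \<Longrightarrow> x + y \<in> C"
  using cone_C convex_C convex_cone by blast

lemma interior_add: assumes "x \<in> interior C" "y \<in> C" shows "x + y \<in> interior C"
proof -
  obtain e where e: "e > 0" "ball x e \<subseteq> C" using assms(1) mem_interior by blast
  have "ball (x + y) e \<subseteq> C"
  proof
    fix z assume "z \<in> ball (x + y) e"
    then have "z - y \<in> ball x e" by (simp add: dist_norm algebra_simps)
    then have "(z - y) + y \<in> C" using e assms(2) by (intro C_add) auto
    then show "z \<in> C" by simp
  qed
  then show ?thesis using e(1) mem_interior by blast
qed

lemma ball_scaleR_subset: assumes "ball x e \<subseteq> C" "t > 0" shows "ball (t *\<^sub>R x) (t * e) \<subseteq> C"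
proof
  fix z assume z: "z \<in> ball (t *\<^sub>R x) (t * e)"
  have "t * norm (x - z /\<^sub>R t) = norm (t *\<^sub>R x - z)"
    using \<open>t > 0\<close> by (metis abs_of_pos divideR_right norm_scaleR order_less_irrefl scaleR_right_diff_distrib)
  also have "\<dots> < t * e" using z by (simp add: dist_norm)
  finally have "z /\<^sub>R t \<in> C" using assms by (auto simp: dist_norm)
  then have "t *\<^sub>R (z /\<^sub>R t) \<in> C" using \<open>t > 0\<close> by (simp only: C_scaleR less_imp_le)
  then show "z \<in> C" using \<open>t > 0\<close> by (metis divideR_right less_irrefl)
qed

lemma interior_scaleR: assumes "x \<in> interior C" "t > 0" shows "t *\<^sub>R x \<in> interior C"
proof -
  obtain e where e: "e > 0" "ball x e \<subseteq> C" using assms(1) mem_interior by blast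
  then show ?thesis
    using ball_scaleR_subset[OF e(2) assms(2)] assms(2) mem_interior
    by (meson mult_pos_pos)
qed

lemma interior_scaleR_iff: assumes "t > 0" shows "t *\<^sub>R x \<in> interior C \<longleftrightarrow> x \<in> interior C"
  using interior_scaleR[of "t *\<^sub>R x" "inverse t"] interior_scaleR[of x t] assms by auto

lemma zero_notin_interior: "0 \<notin> interior C"
proof
  assume "0 \<in> interior C"
  then obtain e where e: "e > 0" "ball 0 e \<subseteq> C" using mem_interior by blast
  obtain b :: 'a where b: "b \<in> Basis" by fastforce
  let ?b = "(e/2) *\<^sub>R b"
  have "norm ?b < e" using e b by simp
  then have "?b \<in> C" "- ?b \<in> C" using e(2) by (auto simp: dist_norm)
  then have "?b \<in> C \<inter> uminus ` C" by force
  then have "?b = 0" using pointed unfolding pointed_cone_def by blast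
  then show False using e b by auto
qed

lemma Omega_nonempty: "Omega C \<noteq> {}"
proof -
  obtain x where x: "x \<in> interior C" using pointed by (auto simp: pointed_cone_def)
  then have "norm x > 0" using zero_notin_interior by auto
  then have "inverse (norm x) *\<^sub>R x \<in> Omega C"
    using interior_scaleR[OF x] x by (auto simp: Omega_def)
  then show ?thesis by blast
qed

lemma inner_interior_polar_neg:
  assumes x: "x \<in> interior C" and u: "u \<in> polar_cone C" "u \<noteq> 0"
  shows "u \<bullet> x < 0"
proof -
  obtain e where e: "e > 0" "ball x e \<subseteq> C" using x mem_interior by blast
  have "u /\<^sub>R norm u \<in> polar_cone C" using u by (intro polar_cone_scaleR) auto
  then have "e \<le> - ((u /\<^sub>R norm u) \<bullet> x)" using u by (intro inner_polar_cone_ball[OF e]) auto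
  then have "(u \<bullet> x) / norm u < 0" using e by (simp add: field_simps)
  then show ?thesis using u by (simp add: divide_less_0_iff)
qed

lemma inner_neg_interior_polar:
  assumes x: "x \<in> C" "x \<noteq> 0" and u: "u \<in> interior (polar_cone C)"
  shows "u \<bullet> x < 0"
proof -
  obtain e where e: "e > 0" "ball u e \<subseteq> polar_cone C" using u mem_interior by blast
  have "0 < e * norm x" using x e by simp
  then show ?thesis using inner_ball_polar_cone[OF e x(1)] by linarith
qed

lemma zero_notin_interior_polar: "0 \<notin> interior (polar_cone C)"
proof
  assume *: "0 \<in> interior (polar_cone C)"
  obtain v where v: "v \<in> Omega C" using Omega_nonempty by blast
  show False using inner_neg_interior_polar[OF OmegaD(3)[OF v] _ *] OmegaD(1)[OF v] by fastforce
qed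

text \<open>Makes the rules for sums and multiples of interior points available for the polar cone.
  Two opposite nonzero vectors in it would both have negative product with an interior point of the
  cone.\<close>

lemma polar_pointed_cone_space:
  assumes "Omega (polar_cone C) \<noteq> {}"
  shows "pointed_cone_space (polar_cone C)"
proof
  obtain v where v: "v \<in> Omega C" using Omega_nonempty by blast
  have "u = 0" if "u \<in> polar_cone C" "- u \<in> polar_cone C" for u
    using inner_interior_polar_neg[OF OmegaD(2)[OF v] that(1)]
      inner_interior_polar_neg[OF OmegaD(2)[OF v] that(2)] by (cases "u = 0") auto
  moreover have "0 \<in> polar_cone C" by (simp add: polar_cone_def)
  ultimately have "polar_cone C \<inter> uminus ` polar_cone C = {0}" by force
  moreover have "cone (polar_cone C)" by (simp add: cone_def polar_cone_scaleR)
  moreover have "interior (polar_cone C) \<noteq> {}" using assms by (auto simp: Omega_def)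
  ultimately show "pointed_cone (polar_cone C)"
    unfolding pointed_cone_def using closed_polar_cone convex_polar_cone by blast
qed

end

section \<open>Concave gauges on the interior of the cone\<close>

context pointed_cone_space
begin

text \<open>Superadditivity and homogeneity together express concavity. A gauge may tend to 0 at the
  boundary of the cone, so the lower bound is by radii of inscribed balls. Off the interior the
  values are arbitrary apart from being Borel.\<close>

definition gauge_fun :: "real \<Rightarrow> real \<Rightarrow> ('a \<Rightarrow> real) \<Rightarrow> bool" where
  "gauge_fun b B N \<longleftrightarrow> N \<in> borel_measurable borel \<and>
     (\<forall>x\<in>interior C. \<forall>y\<in>interior C. N x + N y \<le> N (x + y)) \<and>
     (\<forall>x\<in>interior C. \<forall>t>0. N (t *\<^sub>R x) = t * N x) \<and>
     (\<forall>x\<in>interior C. N x \<le> B * norm x) \<and>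
     (\<forall>x\<in>interior C. \<forall>r>0. ball x r \<subseteq> C \<longrightarrow> b * r \<le> N x)"

lemma gauge_funD:
  assumes "gauge_fun b B N"
  shows "N \<in> borel_measurable borel"
    and "x \<in> interior C \<Longrightarrow> y \<in> interior C \<Longrightarrow> N x + N y \<le> N (x + y)"
    and "x \<in> interior C \<Longrightarrow> 0 < t \<Longrightarrow> N (t *\<^sub>R x) = t * N x"
    and "x \<in> interior C \<Longrightarrow> N x \<le> B * norm x"
    and "x \<in> interior C \<Longrightarrow> 0 < r \<Longrightarrow> ball x r \<subseteq> C \<Longrightarrow> b * r \<le> N x"
  using assms by (auto simp: gauge_fun_def)

lemma gauge_fun_pos:
  assumes N: "gauge_fun b B N" and b: "0 < b" and x: "x \<in> interior C"
  shows "0 < N x"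
proof -
  obtain e where e: "e > 0" "ball x e \<subseteq> C" using x mem_interior by blast
  have "0 < b * e" using b e by simp
  also have "\<dots> \<le> N x" by (rule gauge_funD(5)[OF N x e])
  finally show ?thesis .
qed

text \<open>A relative modulus of continuity that depends on the inscribed radius and not on the
  gauge, hence equicontinuity. The point \<open>y\<close> is \<open>(1 - e) *\<^sub>R x\<close> plus
  an interior point, and \<open>(1 + e) *\<^sub>R x\<close> is \<open>y\<close> plus an interior
  point; superadditivity and positivity do the rest.\<close>

lemma gauge_fun_near:
  assumes N: "gauge_fun b B N" and b: "0 < b" and x: "x \<in> interior C" and y: "y \<in> interior C"
    and r: "0 < r" "ball x r \<subseteq> C" and e: "0 < e" and d: "dist x y < e * r"
  shows "\<bar>N y - N x\<bar> \<le> e * N x"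
proof -
  have int: "z \<in> interior C" if "z \<in> ball (e *\<^sub>R x) (e * r)" for z
  proof -
    have "ball (e *\<^sub>R x) (e * r) \<subseteq> interior C"
      by (rule interior_maximal[OF ball_scaleR_subset[OF r(2) e] open_ball])
    with that show ?thesis by blast
  qed
  have 1: "(1 - e) * N x \<le> N y"
  proof (cases "e < 1")
    case True
    \<comment> \<open>The remainder lies in the ball of radius \<open>e * r\<close> about
      \<open>e *\<^sub>R x\<close>, which the cone contains by scaling.\<close>
    let ?z = "e *\<^sub>R x + (y - x)"
    have z: "?z \<in> interior C" using d by (intro int) (simp add: dist_norm norm_minus_commute)
    have x': "(1 - e) *\<^sub>R x \<in> interior C" using True x by (intro interior_scaleR) auto
    have eq: "(1 - e) *\<^sub>R x + ?z = y" by (simp add: algebra_simps)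
    have "N ((1 - e) *\<^sub>R x) + N ?z \<le> N y"
      using gauge_funD(2)[OF N x' z] unfolding eq .
    moreover have "N ((1 - e) *\<^sub>R x) = (1 - e) * N x"
      using gauge_funD(3)[OF N x, of "1 - e"] True by simp
    ultimately show ?thesis using gauge_fun_pos[OF N b z] by linarith
  next
    case False
    then have "(1 - e) * N x \<le> 0"
      using gauge_fun_pos[OF N b x] by (simp add: mult_nonpos_nonneg)
    then show ?thesis using gauge_fun_pos[OF N b y] by linarith
  qed
  have 2: "N y \<le> (1 + e) * N x"
  proof -
    let ?z = "e *\<^sub>R x + (x - y)"
    have z: "?z \<in> interior C" using d by (intro int) (simp add: dist_norm norm_minus_commute)
    have eq: "y + ?z = (1 + e) *\<^sub>R x" by (simp add: algebra_simps)
    have "N y + N ?z \<le> N ((1 + e) *\<^sub>R x)"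
      using gauge_funD(2)[OF N y z] unfolding eq .
    moreover have "N ((1 + e) *\<^sub>R x) = (1 + e) * N x"
      using gauge_funD(3)[OF N x, of "1 + e"] e by simp
    ultimately show ?thesis using gauge_fun_pos[OF N b z] by linarith
  qed
  show ?thesis using 1 2 by (simp add: abs_le_iff algebra_simps)
qed

lemma gauge_fun_continuous:
  assumes N: "gauge_fun b B N" and b: "0 < b"
  shows "continuous_on (interior C) N"
  unfolding continuous_on_iff
proof (intro ballI allI impI)
  fix x and e :: real assume x: "x \<in> interior C" and e: "0 < e"
  obtain r where r: "r > 0" "ball x r \<subseteq> C" using x mem_interior by blast
  have pos: "N x > 0" by (rule gauge_fun_pos[OF N b x])
  define c where "c = e / (2 * N x)"
  have c: "c > 0" using e pos by (simp add: c_def)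
  show "\<exists>d>0. \<forall>y\<in>interior C. dist y x < d \<longrightarrow> dist (N y) (N x) < e"
  proof (intro exI[of _ "c * r"] conjI ballI impI)
    show "0 < c * r" using c r by simp
    fix y assume y: "y \<in> interior C" "dist y x < c * r"
    have "\<bar>N y - N x\<bar> \<le> c * N x"
      using y by (intro gauge_fun_near[OF N b x y(1) r c]) (simp add: dist_commute)
    also have "c * N x < e" using pos e by (simp add: c_def)
    finally show "dist (N y) (N x) < e" by (simp add: dist_real_def)
  qed
qed

text \<open>The Arzela-Ascoli scheme: a diagonal sequence converges on a countable dense set, and
  \<open>gauge_fun_near\<close> carries convergence to all interior points. All conditions are
  equations or non-strict inequalities, so they survive in the limit with the same
  constants.\<close>

lemma gauge_fun_subsequence:
  assumes N: "\<And>j. gauge_fun b B (N j)" and b: "0 < b" and B: "0 < B"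
  shows "\<exists>(k::nat \<Rightarrow> nat) M. strict_mono k \<and> gauge_fun b B M \<and> (\<forall>x\<in>interior C. (\<lambda>j. N (k j) x) \<longlonglongrightarrow> M x)"
proof -
  obtain D where D: "countable D" "D \<subseteq> interior C" "interior C \<subseteq> closure D"
    using separable by blast
  \<comment> \<open>The bound \<open>B * norm x\<close> depends on the point; dividing by
    \<open>1 + norm x\<close> yields the single bound \<open>B\<close> that the selection theorem
    asks for.\<close>
  have "\<exists>k::nat\<Rightarrow>nat. strict_mono k \<and> (\<forall>x\<in>D. \<exists>l. (\<lambda>j. N (k j) x / (1 + norm x)) \<longlonglongrightarrow> l)"
  proof -
    obtain k :: "nat \<Rightarrow> nat" where k: "strict_mono k"
      "\<And>x. x \<in> D \<Longrightarrow> \<exists>l. (\<lambda>j. N (k j) x / (1 + norm x)) \<longlonglongrightarrow> l"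
    proof (rule function_convergent_subsequence[OF D(1), of "\<lambda>j x. N j x / (1 + norm x)" B])
      fix n x assume "x \<in> D"
      then have x: "x \<in> interior C" using D by auto
      have pos: "0 < N n x" by (rule gauge_fun_pos[OF N b x])
      have "N n x \<le> B * norm x" by (rule gauge_funD(4)[OF N x])
      also have "\<dots> \<le> B * (1 + norm x)" using B by simp
      finally show "norm (N n x / (1 + norm x)) \<le> B"
        using pos by (simp add: divide_le_eq add_pos_nonneg)
    qed blast
    then show ?thesis by blast
  qed
  then obtain k :: "nat \<Rightarrow> nat" where k: "strict_mono k"
    and conv0: "\<And>x. x \<in> D \<Longrightarrow> \<exists>l. (\<lambda>j. N (k j) x / (1 + norm x)) \<longlonglongrightarrow> l" by blast
  have convD: "Cauchy (\<lambda>j. N (k j) x)" if x: "x \<in> D" for x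
  proof -
    obtain l where "(\<lambda>j. N (k j) x / (1 + norm x)) \<longlonglongrightarrow> l" using conv0[OF x] by blast
    then have "(\<lambda>j. (1 + norm x) * (N (k j) x / (1 + norm x))) \<longlonglongrightarrow> (1 + norm x) * l"
      by (rule tendsto_mult_left)
    moreover have "(1 + norm x) * (N (k j) x / (1 + norm x)) = N (k j) x" for j
      using norm_ge_zero[of x] by (simp add: add_nonneg_eq_0_iff)
    ultimately show ?thesis by (auto intro!: LIMSEQ_imp_Cauchy)
  qed
  have conv: "convergent (\<lambda>j. N (k j) x)" if x: "x \<in> interior C" for x
    unfolding Cauchy_convergent_iff[symmetric] Cauchy_iff
  proof (intro allI impI)
    fix e :: real assume e: "0 < e"
    obtain r where r: "r > 0" "ball x r \<subseteq> C" using x mem_interior by blast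
    \<comment> \<open>Makes the error at most \<open>e / 4\<close> for every gauge of the sequence
      at once, as \<open>N j x \<le> B * norm x\<close>; three such errors stay below
      \<open>e\<close>.\<close>
    define c where "c = e / (4 * B * (1 + norm x))"
    have c: "c > 0" using e B by (simp add: c_def add_pos_nonneg)
    have "x \<in> closure D" using x D by blast
    then obtain y where y: "y \<in> D" "dist y x < c * r"
      using c r by (metis closure_approachable mult_pos_pos)
    have near: "\<bar>N j y - N j x\<bar> \<le> e / 4" for j
    proof -
      have "\<bar>N j y - N j x\<bar> \<le> c * N j x"
        using y D by (intro gauge_fun_near[OF N b x _ r c]) (auto simp: dist_commute)
      also have "\<dots> \<le> c * (B * norm x)"
        using gauge_funD(4)[OF N x] c by simp
      also have "\<dots> \<le> c * (B * (1 + norm x))" using c B by simp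
      also have "\<dots> = e / 4" using B norm_ge_zero[of x] by (simp add: c_def divide_simps add_nonneg_eq_0_iff)
      finally show ?thesis .
    qed
    obtain m where m: "\<And>i j. i \<ge> m \<Longrightarrow> j \<ge> m \<Longrightarrow> norm (N (k i) y - N (k j) y) < e / 4"
      using convD[OF y(1)] e unfolding Cauchy_iff by (meson divide_pos_pos zero_less_numeral)
    show "\<exists>M. \<forall>m\<ge>M. \<forall>n\<ge>M. norm (N (k m) x - N (k n) x) < e"
    proof (intro exI[of _ m] allI impI)
      fix i j assume "m \<le> i" "m \<le> j"
      then have "\<bar>N (k i) y - N (k j) y\<bar> < e / 4" using m by auto
      with near[of "k i"] near[of "k j"] e show "norm (N (k i) x - N (k j) x) < e"
        by (simp add: abs_if split: if_splits)
    qed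
  qed
  \<comment> \<open>No convergence is known off the interior; there the limit is that of the zero
    sequence.\<close>
  define M where "M x = lim (\<lambda>j. if x \<in> interior C then N (k j) x else 0)" for x
  have lim: "(\<lambda>j. N (k j) x) \<longlonglongrightarrow> M x" if "x \<in> interior C" for x
    using conv[OF that] that by (simp add: M_def convergent_LIMSEQ_iff)
  have "gauge_fun b B M"
    unfolding gauge_fun_def
  proof (intro conjI ballI allI impI)
    show "M \<in> borel_measurable borel"
      unfolding M_def using gauge_funD(1)[OF N] by measurable
    fix x assume x: "x \<in> interior C"
    show "M x + M y \<le> M (x + y)" if y: "y \<in> interior C" for y
    proof (rule LIMSEQ_le)
      show "(\<lambda>j. N (k j) x + N (k j) y) \<longlonglongrightarrow> M x + M y" by (intro tendsto_add lim x y)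
      show "(\<lambda>j. N (k j) (x + y)) \<longlonglongrightarrow> M (x + y)"
        using interior_subset[of C] y by (intro lim interior_add x) auto
      show "\<exists>m. \<forall>n\<ge>m. N (k n) x + N (k n) y \<le> N (k n) (x + y)"
        using gauge_funD(2)[OF N x y] by blast
    qed
    show "M (t *\<^sub>R x) = t * M x" if t: "0 < t" for t
    proof (rule LIMSEQ_unique)
      show "(\<lambda>j. N (k j) (t *\<^sub>R x)) \<longlonglongrightarrow> M (t *\<^sub>R x)" by (intro lim interior_scaleR x t)
      show "(\<lambda>j. N (k j) (t *\<^sub>R x)) \<longlonglongrightarrow> t * M x"
        unfolding gauge_funD(3)[OF N x t] by (intro tendsto_mult_left lim x)
    qed
    show "M x \<le> B * norm x"
      using gauge_funD(4)[OF N x] by (intro LIMSEQ_le_const2[OF lim[OF x]]) auto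
    show "b * r \<le> M x" if "0 < r" "ball x r \<subseteq> C" for r
      using gauge_funD(5)[OF N x that] by (intro LIMSEQ_le_const[OF lim[OF x]]) auto
  qed
  with k lim show ?thesis by blast
qed

text \<open>For a positive gauge this says that \<open>u\<close> attains its maximum over the points
  \<open>y / N y\<close> at \<open>x / N x\<close>, so that \<open>u\<close> supports the region
  where \<open>N\<close> is at least 1. The form without quotients passes to limits, and the closed
  polar cone is used because limits of normals may lie on its boundary.\<close>

definition normal_at :: "('a \<Rightarrow> real) \<Rightarrow> 'a \<Rightarrow> 'a \<Rightarrow> bool" where
  "normal_at N x u \<longleftrightarrow> norm u = 1 \<and> u \<in> polar_cone C \<and>
     (\<forall>y\<in>interior C. N x * (u \<bullet> y) \<le> N y * (u \<bullet> x))"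

lemma normal_at_limit:
  assumes N: "\<And>y. y \<in> interior C \<Longrightarrow> (\<lambda>j. N j y) \<longlonglongrightarrow> M y" and x: "x \<in> interior C"
    and u: "\<And>j. normal_at (N j) x (u j)" and lim: "u \<longlonglongrightarrow> w"
  shows "normal_at M x w"
  unfolding normal_at_def
proof (intro conjI ballI)
  have "(\<lambda>j. norm (u j)) \<longlonglongrightarrow> norm w" by (intro tendsto_norm lim)
  then show "norm w = 1" using u by (simp add: normal_at_def LIMSEQ_const_iff)
  show "w \<in> polar_cone C"
    using u by (intro Lim_in_closed_set[OF closed_polar_cone _ _ lim]) (auto simp: normal_at_def)
  fix y assume y: "y \<in> interior C"
  show "M x * (w \<bullet> y) \<le> M y * (w \<bullet> x)"
  proof (rule LIMSEQ_le)
    show "(\<lambda>j. N j x * (u j \<bullet> y)) \<longlonglongrightarrow> M x * (w \<bullet> y)" by (intro tendsto_intros N x lim)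
    show "(\<lambda>j. N j y * (u j \<bullet> x)) \<longlonglongrightarrow> M y * (w \<bullet> x)" by (intro tendsto_intros N y lim)
    show "\<exists>m. \<forall>j\<ge>m. N j x * (u j \<bullet> y) \<le> N j y * (u j \<bullet> x)"
      using u y by (auto simp: normal_at_def)
  qed
qed

text \<open>By compactness of the sphere every subsequence has a further subsequence tending to a
  normal of \<open>M\<close>; as that normal is unique, the whole sequence converges.\<close>

lemma normal_at_tendsto:
  assumes N: "\<And>y. y \<in> interior C \<Longrightarrow> (\<lambda>j. N j y) \<longlonglongrightarrow> M y" and x: "x \<in> interior C"
    and u: "\<And>j. normal_at (N j) x (u j)"
    and unique: "\<And>u w. normal_at M x u \<Longrightarrow> normal_at M x w \<Longrightarrow> u = w"
  shows "\<exists>w. normal_at M x w \<and> u \<longlonglongrightarrow> w"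
proof -
  have sub: "\<exists>w r. strict_mono (r :: nat \<Rightarrow> nat) \<and> (u \<circ> f \<circ> r) \<longlonglongrightarrow> w \<and> normal_at M x w"
    if f: "strict_mono f" for f :: "nat \<Rightarrow> nat"
  proof -
    have "\<forall>j. (u \<circ> f) j \<in> sphere 0 1" using u by (simp add: normal_at_def)
    then obtain w r where r: "strict_mono (r :: nat \<Rightarrow> nat)" "(u \<circ> f \<circ> r) \<longlonglongrightarrow> w"
      using compact_sphere[of "0::'a" 1] unfolding compact_def by metis
    have "normal_at M x w"
    proof (rule normal_at_limit[where N="\<lambda>j. N (f (r j))" and u="u \<circ> f \<circ> r"])
      show "(\<lambda>j. N (f (r j)) y) \<longlonglongrightarrow> M y" if "y \<in> interior C" for y
        using LIMSEQ_subseq_LIMSEQ[OF N[OF that] strict_mono_o[OF f r(1)]] by (simp add: o_def)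
    qed (use x u r in auto)
    with r show ?thesis by blast
  qed
  obtain w where w: "normal_at M x w" using sub[of id] by (auto simp: strict_mono_def)
  have "u \<longlonglongrightarrow> w"
  proof (rule ccontr)
    assume "\<not> u \<longlonglongrightarrow> w"
    then obtain e where e: "e > 0" "\<forall>m. \<exists>n\<ge>m. \<not> dist (u n) w < e"
      unfolding lim_sequentially by blast
    then have "infinite {n. e \<le> dist (u n) w}"
      unfolding infinite_nat_iff_unbounded_le by (auto simp: not_less)
    then obtain f :: "nat \<Rightarrow> nat" where f: "strict_mono f" "\<And>n. e \<le> dist (u (f n)) w"
      using infinite_enumerate by (metis (mono_tags, lifting) mem_Collect_eq)
    obtain w' r where r: "strict_mono (r :: nat \<Rightarrow> nat)" "(u \<circ> f \<circ> r) \<longlonglongrightarrow> w'" "normal_at M x w'"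
      using sub[OF f(1)] by blast
    have "w' = w" by (rule unique[OF r(3) w])
    with r(2) have "(u \<circ> f \<circ> r) \<longlonglongrightarrow> w" by simp
    then have lim: "(\<lambda>j. dist ((u \<circ> f \<circ> r) j) w) \<longlonglongrightarrow> 0"
      unfolding tendsto_dist_iff[of "u \<circ> f \<circ> r"] .
    have "e \<le> 0" by (rule LIMSEQ_le_const[OF lim]) (use f(2) in \<open>auto simp: o_def\<close>)
    then show False using e by simp
  qed
  with w show ?thesis by blast
qed

end

section \<open>Uniqueness of normals almost everywhere\<close>

text \<open>Shifts of a bounded piece along \<open>i\<close> by distinct amounts are disjoint, have
  equal measure and fit into one ball of finite volume. Arbitrarily many of them exist, so the
  measure is 0.\<close>

lemma null_if_lines_meet_once:
  fixes M :: "'a::euclidean_space set"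
  assumes M: "M \<in> sets borel" and line: "\<And>x t. x \<in> M \<Longrightarrow> x + t *\<^sub>R i \<in> M \<Longrightarrow> t = 0"
  shows "emeasure lborel M = 0"
proof -
  have bnd: "emeasure lborel (M \<inter> ball 0 R) = 0" for R
  proof -
    let ?M = "M \<inter> ball 0 R"
    \<comment> \<open>Distinct shifts in (0, 1], so every shifted piece stays in the ball of radius
      \<open>R + norm i\<close>.\<close>
    define c where "c k = inverse (real (Suc k))" for k
    define T where "T k = (+) (- (c k *\<^sub>R i)) -` ?M" for k
    have T: "T k \<in> sets borel" for k
    proof -
      have "(+) (- (c k *\<^sub>R i)) \<in> measurable borel borel" by measurable
      from measurable_sets[OF this, of ?M] M show ?thesis by (simp add: T_def)
    qed
    have eT: "emeasure lborel (T k) = emeasure lborel ?M" for k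
    proof -
      have "emeasure lborel ?M = emeasure (distr lborel borel ((+) (- (c k *\<^sub>R i)))) ?M"
        by (simp only: lborel_distr_plus)
      also have "\<dots> = emeasure lborel (T k)"
        using M by (subst emeasure_distr) (auto simp: T_def)
      finally show ?thesis by simp
    qed
    have "disjoint_family T"
      unfolding disjoint_family_on_def
    proof (intro ballI impI equals0I)
      fix k l x assume kl: "k \<noteq> l" and x: "x \<in> T k \<inter> T l"
      let ?y = "- (c k *\<^sub>R i) + x"
      have "?y \<in> M" "?y + (c k - c l) *\<^sub>R i \<in> M"
        using x by (auto simp: T_def algebra_simps)
      then have "c k - c l = 0" by (rule line)
      then show False using kl by (simp add: c_def del: of_nat_Suc)
    qed
    have sub: "T k \<subseteq> ball 0 (R + norm i)" for k
    proof
      fix x assume "x \<in> T k"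
      then have "norm (x - c k *\<^sub>R i) < R" by (simp add: T_def)
      moreover have "norm x \<le> norm (x - c k *\<^sub>R i) + norm (c k *\<^sub>R i)"
        by (metis diff_add_cancel norm_triangle_ineq)
      moreover have "norm (c k *\<^sub>R i) \<le> norm i"
        by (simp add: c_def mult_left_le_one_le inverse_le_1_iff)
      ultimately show "x \<in> ball 0 (R + norm i)" by simp
    qed
    let ?K = "emeasure lborel (ball (0::'a) (R + norm i))"
    have K: "?K < \<infinity>" by (rule emeasure_lborel_ball_finite)
    have "of_nat n * emeasure lborel ?M \<le> ?K" for n
    proof -
      have "of_nat n * emeasure lborel ?M = (\<Sum>k<n. emeasure lborel (T k))"
        by (simp add: eT)
      also have "\<dots> = emeasure lborel (\<Union>k<n. T k)"
        using T \<open>disjoint_family T\<close>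
        by (intro sum_emeasure) (auto simp: disjoint_family_on_def)
      also have "\<dots> \<le> ?K" using sub by (intro emeasure_mono) auto
      finally show ?thesis .
    qed
    note le = this
    have fin: "emeasure lborel ?M < \<infinity>" using le[of 1] K by (simp add: le_less_trans)
    show ?thesis
    proof (rule ccontr)
      assume ne: "emeasure lborel ?M \<noteq> 0"
      obtain m where m: "emeasure lborel ?M = ennreal m" "m \<ge> 0" using fin by (cases "emeasure lborel ?M") auto
      obtain K' where K': "?K = ennreal K'" "K' \<ge> 0" using K by (cases ?K) auto
      have "m > 0" using m ne by (cases "m = 0") auto
      then obtain n :: nat where n: "K' < real n * m" using reals_Archimedean3 by blast
      have "ennreal (real n * m) \<le> ennreal K'"
        using le[of n] m K' by (simp add: ennreal_mult ennreal_of_nat_eq_real_of_nat)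
      then show False using n K' by (simp add: ennreal_le_iff)
    qed
  qed
  have "M = (\<Union>n. M \<inter> ball 0 (real n))"
    using reals_Archimedean2 by auto
  moreover have "emeasure lborel (\<Union>n. M \<inter> ball 0 (real n)) = 0"
    using bnd M by (intro emeasure_UN_eq_0) auto
  ultimately show ?thesis by simp
qed

section \<open>Kinks of concave functions along coordinate lines\<close>

context pointed_cone_space
begin

text \<open>On the line through \<open>x\<close> in direction \<open>i\<close>, the graph of
  \<open>N\<close> lies below a tent with apex over \<open>x\<close>, of slope \<open>a + d\<close>
  on the left and \<open>a - d\<close> on the right.\<close>

definition kink_set :: "('a \<Rightarrow> real) \<Rightarrow> 'a \<Rightarrow> real \<Rightarrow> real \<Rightarrow> 'a set" where
  "kink_set N i a d = {x \<in> interior C.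
     \<forall>t. x + t *\<^sub>R i \<in> interior C \<longrightarrow> N (x + t *\<^sub>R i) \<le> N x + a * t - d * \<bar>t\<bar>}"

lemma kink_set_borel:
  assumes cont: "continuous_on (interior C) N"
  shows "kink_set N i a d \<in> sets borel"
proof -
  let ?U = "interior C"
  \<comment> \<open>The points violating the inequality for one \<open>t\<close> form an open set.
    The union over all real \<open>t\<close> is therefore open too, and the kink set is a difference
    of open sets.\<close>
  define W where "W t = {x \<in> {x. x \<in> ?U \<and> x + t *\<^sub>R i \<in> ?U}. N x + a * t - d * \<bar>t\<bar> - N (x + t *\<^sub>R i) < 0}" for t
  have "open (W t)" for t
  proof -
    have o: "open {x. x \<in> ?U \<and> x + t *\<^sub>R i \<in> ?U}"
    proof -
      have "open ((\<lambda>x. x + t *\<^sub>R i) -` ?U)"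
        by (intro open_vimage continuous_intros) auto
      then have "open (?U \<inter> ((\<lambda>x. x + t *\<^sub>R i) -` ?U))" by (intro open_Int) auto
      then show ?thesis by (simp add: vimage_def Int_def)
    qed
    have "continuous_on {x. x \<in> ?U \<and> x + t *\<^sub>R i \<in> ?U} (\<lambda>x. N x + a * t - d * \<bar>t\<bar> - N (x + t *\<^sub>R i))"
      by (intro continuous_intros continuous_on_subset[OF cont] continuous_on_compose2[OF cont]) auto
    from continuous_open_preimage[OF this o, of "{..<0}"] show ?thesis
      by (simp add: W_def vimage_def Int_def conj_ac)
  qed
  moreover have "kink_set N i a d = ?U - (\<Union>t. W t)"
    by (auto simp: kink_set_def W_def not_less)
  moreover have "open (\<Union>t. W t)" using calculation by blast
  ultimately show ?thesis using borel_open[OF open_interior[of C]] borel_open[of "\<Union>t. W t"] by auto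
qed

text \<open>If \<open>x\<close> and \<open>x + t *\<^sub>R i\<close> both belong to the set, the two
  tent inequalities add up to \<open>2 * d * \<bar>t\<bar> \<le> 0\<close>, since the terms with
  \<open>a\<close> cancel. Each line in direction \<open>i\<close> thus meets the set at most
  once.\<close>

lemma kink_set_null:
  assumes cont: "continuous_on (interior C) N" and d: "d > 0"
  shows "emeasure lborel (kink_set N i a d) = 0"
proof (rule null_if_lines_meet_once[OF kink_set_borel[OF cont]])
  fix x t assume x: "x \<in> kink_set N i a d" and y: "x + t *\<^sub>R i \<in> kink_set N i a d"
  have "N (x + t *\<^sub>R i) \<le> N x + a * t - d * \<bar>t\<bar>"
    using x y by (auto simp: kink_set_def)
  moreover have "N x \<le> N (x + t *\<^sub>R i) + a * (- t) - d * \<bar>- t\<bar>"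
    using x y unfolding kink_set_def
    by (auto dest!: spec[of _ "- t"] simp: algebra_simps)
  ultimately have "d * \<bar>t\<bar> \<le> 0" by simp
  then show "t = 0" using d by (simp add: mult_le_0_iff)
qed

text \<open>Slopes of a 1-homogeneous function do not change along rays, so the same
  \<open>a\<close> and \<open>d\<close> serve for \<open>s *\<^sub>R x\<close>. The exceptional set
  has to be a cone in order to be null for directions.\<close>

lemma kink_set_conic:
  assumes N: "gauge_fun b B N" and x: "x \<in> kink_set N i a d" and s: "0 < s"
  shows "s *\<^sub>R x \<in> kink_set N i a d"
proof -
  have xi: "x \<in> interior C" using x by (simp add: kink_set_def)
  have "N (s *\<^sub>R x + t *\<^sub>R i) \<le> N (s *\<^sub>R x) + a * t - d * \<bar>t\<bar>"
    if t: "s *\<^sub>R x + t *\<^sub>R i \<in> interior C" for t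
  proof -
    have eq: "s *\<^sub>R x + t *\<^sub>R i = s *\<^sub>R (x + (t / s) *\<^sub>R i)" using s by (simp add: algebra_simps)
    then have y: "x + (t / s) *\<^sub>R i \<in> interior C" using t s by (simp add: interior_scaleR_iff)
    then have "N (x + (t / s) *\<^sub>R i) \<le> N x + a * (t / s) - d * \<bar>t / s\<bar>"
      using x by (auto simp: kink_set_def simp del: times_divide_eq_right abs_divide)
    then have "s * N (x + (t / s) *\<^sub>R i) \<le> s * (N x + a * (t / s) - d * \<bar>t / s\<bar>)"
      using s by simp
    also have "\<dots> = s * N x + a * t - d * \<bar>t\<bar>" using s by (simp add: algebra_simps)
    finally show ?thesis
      unfolding eq gauge_funD(3)[OF N y s] gauge_funD(3)[OF N xi s] .
  qed
  then show ?thesis using interior_scaleR[OF xi s] by (simp add: kink_set_def)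
qed

text \<open>Each normal at \<open>x\<close> yields a supergradient of \<open>N\<close>. Distinct
  normals yield distinct supergradients, which differ in some coordinate; along that coordinate the
  two linear upper bounds together form a tent.\<close>

lemma normals_unique_outside_kinks:
  assumes N: "gauge_fun b B N" and b: "0 < b" and x: "x \<in> interior C"
    and u: "normal_at N x u" and w: "normal_at N x w" and ne: "u \<noteq> w"
  shows "\<exists>i\<in>Basis. \<exists>a\<in>\<rat>. \<exists>n. x \<in> kink_set N i a (inverse (real (Suc n)))"
proof -
  \<comment> \<open>The supergradient belonging to a normal:
    \<open>N y \<le> g u \<bullet> y\<close> for interior \<open>y\<close>, with equality at
    \<open>y = x\<close>.\<close>
  define g where "g u = (N x / (u \<bullet> x)) *\<^sub>R u" for u
  have pos: "N x > 0" by (rule gauge_fun_pos[OF N b x])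
  have neg: "u \<bullet> x < 0" if "normal_at N x u" for u
    using that by (intro inner_interior_polar_neg x) (auto simp: normal_at_def)
  have le: "N (x + t *\<^sub>R i) \<le> N x + t * (g u \<bullet> i)"
    if u: "normal_at N x u" and y: "x + t *\<^sub>R i \<in> interior C" for u t i
  proof -
    have "N x * (u \<bullet> (x + t *\<^sub>R i)) \<le> N (x + t *\<^sub>R i) * (u \<bullet> x)"
      using u y by (auto simp: normal_at_def)
    then have "N (x + t *\<^sub>R i) \<le> N x * (u \<bullet> (x + t *\<^sub>R i)) / (u \<bullet> x)"
      using neg[OF u] by (simp add: neg_le_divide_eq)
    also have "\<dots> = N x + t * (g u \<bullet> i)"
      using neg[OF u] by (simp add: g_def inner_add_right field_simps)
    finally show ?thesis .
  qed
  have "g u \<noteq> g w"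
  proof
    \<comment> \<open>Both sides are negative multiples of unit vectors; comparing lengths gives
      \<open>u \<bullet> x = w \<bullet> x\<close>, and then \<open>u = w\<close>.\<close>
    assume eq: "g u = g w"
    have n: "norm (g v) = N x / - (v \<bullet> x)" if "normal_at N x v" for v
      using neg[OF that] pos that by (simp add: g_def normal_at_def)
    have "N x / - (u \<bullet> x) = N x / - (w \<bullet> x)" using n[OF u] n[OF w] unfolding eq by (rule trans[OF sym])
    then have "u \<bullet> x = w \<bullet> x" using pos neg[OF u] neg[OF w] by (simp add: field_simps)
    then show False using eq ne pos neg[OF w] by (simp add: g_def)
  qed
  then obtain i where i: "i \<in> Basis" "g u \<bullet> i \<noteq> g w \<bullet> i" using euclidean_eqI by blast
  have main: "\<exists>a\<in>\<rat>. \<exists>n. x \<in> kink_set N i a (inverse (real (Suc n)))"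
    if u: "normal_at N x u" and w: "normal_at N x w" and lt: "g u \<bullet> i < g w \<bullet> i" for u w
  proof -
    \<comment> \<open>A rational slope strictly between the two, and a \<open>d\<close> of the form
      \<open>1 / (n + 1)\<close> below its distance from either: this leaves only countably many
      kink sets.\<close>
    obtain a where a: "a \<in> \<rat>" "g u \<bullet> i < a" "a < g w \<bullet> i" using Rats_dense_in_real[OF lt] by blast
    define m where "m = min (a - g u \<bullet> i) (g w \<bullet> i - a)"
    have "m > 0" using a by (simp add: m_def)
    then obtain n where n: "inverse (real (Suc n)) < m" using reals_Archimedean by blast
    define d where "d = inverse (real (Suc n))"
    have "N (x + t *\<^sub>R i) \<le> N x + a * t - d * \<bar>t\<bar>" if t: "x + t *\<^sub>R i \<in> interior C" for t
    proof (cases "t \<ge> 0")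
      case True
      have "t * (g u \<bullet> i) \<le> t * (a - d)"
        using True n by (intro mult_left_mono) (auto simp: m_def d_def)
      then show ?thesis using le[OF u t] True by (simp add: algebra_simps)
    next
      case False
      have "t * (g w \<bullet> i) \<le> t * (a + d)"
        using False n by (intro mult_left_mono_neg) (auto simp: m_def d_def)
      then show ?thesis using le[OF w t] False by (simp add: algebra_simps)
    qed
    then have "x \<in> kink_set N i a d" using x by (simp add: kink_set_def)
    then show ?thesis using a(1) unfolding d_def by blast
  qed
  show ?thesis using main[OF u w] main[OF w u] i by (meson linorder_neqE_linordered_idom)
qed

lemma normals_unique_AE:
  assumes N: "gauge_fun b B N" and b: "0 < b"
  shows "\<exists>E\<in>sets borel. emeasure lborel E = 0 \<and> (\<forall>x\<in>E. \<forall>t>0. t *\<^sub>R x \<in> E) \<and>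
    (\<forall>x\<in>interior C - E. \<forall>u w. normal_at N x u \<longrightarrow> normal_at N x w \<longrightarrow> u = w)"
proof -
  let ?K = "\<lambda>i a n. kink_set N i a (inverse (real (Suc n)))"
  define E where "E = (\<Union>i\<in>Basis. \<Union>a\<in>\<rat>. \<Union>n. ?K i a n)"
  have E_iff: "x \<in> E \<longleftrightarrow> (\<exists>i\<in>Basis. \<exists>a\<in>\<rat>. \<exists>n. x \<in> ?K i a n)" for x
    by (simp add: E_def)
  note cont = gauge_fun_continuous[OF N b]
  have K: "?K i a n \<in> null_sets lborel" for i a n
    using kink_set_borel[OF cont] kink_set_null[OF cont] by (auto simp: null_sets_def)
  have "E \<in> null_sets lborel"
    unfolding E_def
    by (rule null_sets_UN'[OF countable_finite[OF finite_Basis]], rule null_sets_UN'[OF countable_rat],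
        rule null_sets_UN, rule K)
  then have "E \<in> sets borel" "emeasure lborel E = 0" by (auto simp: null_sets_def)
  moreover have "\<forall>x\<in>E. \<forall>t>0. t *\<^sub>R x \<in> E"
  proof (intro ballI allI impI)
    fix x t assume "x \<in> E" and t: "0 < (t::real)"
    then obtain i a n where i: "i \<in> Basis" "a \<in> \<rat>" and "x \<in> ?K i a n" unfolding E_iff by blast
    then have "t *\<^sub>R x \<in> ?K i a n" by (intro kink_set_conic[OF N _ t])
    with i show "t *\<^sub>R x \<in> E" unfolding E_iff by blast
  qed
  moreover have "\<forall>x\<in>interior C - E. \<forall>u w. normal_at N x u \<longrightarrow> normal_at N x w \<longrightarrow> u = w"
  proof (intro ballI allI impI; rule ccontr)
    fix x u w assume x: "x \<in> interior C - E" and "normal_at N x u" "normal_at N x w" "u \<noteq> w"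
    then have "x \<in> E" unfolding E_iff by (intro normals_unique_outside_kinks[OF N b]) auto
    then show False using x by blast
  qed
  ultimately show ?thesis by blast
qed

end

section \<open>Discrete measures\<close>

lemma eventually_less_of_tendsto:
  fixes f g :: "'b \<Rightarrow> real"
  assumes "x < y" "(f \<longlongrightarrow> x) F" "(g \<longlongrightarrow> y) F"
  shows "\<forall>\<^sub>F k in F. f k < g k"
proof -
  have "((\<lambda>k. g k - f k) \<longlongrightarrow> y - x) F" by (intro tendsto_diff assms)
  from order_tendstoD(1)[OF this, of 0] assms(1) show ?thesis by simp
qed

text \<open>Treats exponents of either sign at once: for a base in \<open>(0, 1]\<close>, replacing
  \<open>s\<close> by \<open>r\<close> or by \<open>- r\<close> changes the power in a known
  direction.\<close>

lemma powr_bounds: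
  fixes c x s r :: real
  assumes "0 < c" "c \<le> x" "x \<le> 1" "\<bar>s\<bar> \<le> r"
  shows "c powr r \<le> x powr s" "x powr s \<le> c powr (- r)"
proof -
  have r: "0 \<le> r" "s \<le> r" "- r \<le> s" using assms(4) by linarith+
  have "c powr r \<le> x powr r" using assms r by (intro powr_mono2) auto
  also have "\<dots> \<le> x powr s" using assms r by (intro powr_mono') auto
  finally show "c powr r \<le> x powr s" .
  have "x powr s \<le> x powr (- r)" using assms r by (intro powr_mono') auto
  also have "\<dots> \<le> c powr (- r)" using assms r by (intro powr_mono2') auto
  finally show "x powr s \<le> c powr (- r)" .
qed

text \<open>What is used of the spherical measure. The condition on conic null sets plays the part
  of absolute continuity, transferring volume facts to directions. The normalisations for
  \<open>q = 0\<close> and for other \<open>q\<close> are both instances.\<close>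

locale cone_measure = pointed_cone_space C + finite_measure \<sigma>
  for C :: "'a::euclidean_space set" and \<sigma> :: "'a measure" +
  assumes sets_sigma [measurable_cong]: "sets \<sigma> = sets borel"
    and AE_Omega: "AE v in \<sigma>. v \<in> Omega C"
    and sigma_nonzero: "measure \<sigma> (space \<sigma>) \<noteq> 0"
    and conic_null: "\<And>E. E \<in> sets borel \<Longrightarrow> emeasure lborel E = 0 \<Longrightarrow>
      (\<And>x t. x \<in> E \<Longrightarrow> 0 < t \<Longrightarrow> t *\<^sub>R x \<in> E) \<Longrightarrow> emeasure \<sigma> E = 0"
begin

lemma AE_notin_conic_null:
  assumes "E \<in> sets borel" "emeasure lborel E = 0" "\<And>x t. x \<in> E \<Longrightarrow> 0 < t \<Longrightarrow> t *\<^sub>R x \<in> E"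
  shows "AE v in \<sigma>. v \<notin> E"
  using conic_null[OF assms] assms(1) sets_sigma by (intro AE_not_in) (auto simp: null_sets_def)

lemma AE_notin_hyperplane:
  assumes "w \<noteq> 0" shows "AE v in \<sigma>. w \<bullet> v \<noteq> 0"
proof -
  let ?E = "{v. w \<bullet> v = 0}"
  have E: "?E \<in> sets borel" by (intro borel_closed closed_hyperplane)
  have "?E \<in> null_sets lebesgue"
    using negligible_hyperplane[of w 0] assms by (simp add: negligible_iff_null_sets)
  then have "emeasure lborel ?E = 0"
    using E by (simp add: null_sets_def)
  from AE_notin_conic_null[OF E this] show ?thesis by auto
qed

end

section \<open>Perron's method for finitely many normals\<close>

locale discrete_problem = cone_measure C \<sigma> for C :: "'a::euclidean_space set" and \<sigma> +
  fixes F :: "'a set" and m :: "'a \<Rightarrow> real" and q e :: real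
  assumes finite_F: "finite F" and F_nonempty: "F \<noteq> {}"
    and F_sub: "F \<subseteq> Omega (polar_cone C)"
    and m_pos: "\<And>a. a \<in> F \<Longrightarrow> 0 < m a" and e_pos: "0 < e"
begin

text \<open>The ray through \<open>v\<close> enters the half-space
  \<open>x \<bullet> a \<le> - h a\<close> at the parameter \<open>h a / - (a \<bullet> v)\<close>.
  The cell collects the \<open>v\<close> for which no half-space is entered later than that of
  \<open>a\<close>; denominators are multiplied out.\<close>

definition cell :: "('a \<Rightarrow> real) \<Rightarrow> 'a \<Rightarrow> 'a set" where
  "cell h a = {v. \<forall>b\<in>F. h b * - (a \<bullet> v) \<le> h a * - (b \<bullet> v)}"

definition weight :: "'a \<Rightarrow> 'a \<Rightarrow> real" where
  "weight a v = (- (a \<bullet> v)) powr (- q)"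

text \<open>On the cell of \<open>a\<close> the radial function is
  \<open>h a / - (a \<bullet> v)\<close>. Its power \<open>q - p\<close> times
  \<open>(- (a \<bullet> v)) powr (- p)\<close> splits into \<open>h a powr (q - p)\<close> and
  \<open>weight a v\<close>; the parameter \<open>e\<close> stands for \<open>q - p\<close>.\<close>

definition mass :: "('a \<Rightarrow> real) \<Rightarrow> 'a \<Rightarrow> real" where
  "mass h a = h a powr e * (\<integral>v. indicator (cell h a) v * weight a v \<partial>\<sigma>)"

definition subsolutions :: "('a \<Rightarrow> real) set" where
  "subsolutions = {h. \<forall>a\<in>F. 0 < h a \<and> mass h a \<le> m a}"

lemma F_lower: "\<exists>c>0. c \<le> 1 \<and> (\<forall>a\<in>F. \<forall>v\<in>Omega C. c \<le> - (a \<bullet> v))"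
proof -
  have "\<forall>a\<in>F. \<exists>r>0. \<forall>v\<in>Omega C. r \<le> - (a \<bullet> v)"
  proof
    fix a assume "a \<in> F"
    then have "a \<in> interior (polar_cone C)" using F_sub OmegaD(2) by blast
    then obtain r where r: "r > 0" "ball a r \<subseteq> polar_cone C" using mem_interior by blast
    have "r \<le> - (a \<bullet> v)" if "v \<in> Omega C" for v
      using inner_ball_polar_cone[OF r OmegaD(3)[OF that]] OmegaD(1)[OF that] by simp
    with r show "\<exists>r>0. \<forall>v\<in>Omega C. r \<le> - (a \<bullet> v)" by blast
  qed
  then obtain r where r: "\<And>a. a \<in> F \<Longrightarrow> 0 < r a \<and> (\<forall>v\<in>Omega C. r a \<le> - (a \<bullet> v))"
    by (metis (no_types, lifting) bchoice)
  let ?c = "Min (insert 1 (r ` F))"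
  have "0 < ?c" using r finite_F by (subst Min_gr_iff) auto
  moreover have "?c \<le> r a" if "a \<in> F" for a using that finite_F by (intro Min_le) auto
  moreover have "?c \<le> 1" using finite_F by (intro Min_le) auto
  ultimately show ?thesis using r by (meson order_trans)
qed

lemma F_norm: "a \<in> F \<Longrightarrow> norm a = 1"
  using F_sub OmegaD(1) by blast

lemma F_neg: "a \<in> F \<Longrightarrow> v \<in> Omega C \<Longrightarrow> 0 < - (a \<bullet> v)"
  using F_lower by (meson less_le_trans)

lemma F_le_1: "a \<in> F \<Longrightarrow> v \<in> Omega C \<Longrightarrow> - (a \<bullet> v) \<le> 1"
  using F_norm OmegaD(1) by (intro neg_inner_le_1) auto

lemma weight_bounds: "\<exists>w>0. \<exists>W. \<forall>a\<in>F. \<forall>v\<in>Omega C. w \<le> weight a v \<and> weight a v \<le> W"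
proof -
  obtain c where c: "0 < c" "c \<le> 1" "\<And>a v. a \<in> F \<Longrightarrow> v \<in> Omega C \<Longrightarrow> c \<le> - (a \<bullet> v)"
    using F_lower by blast
  have "c powr \<bar>q\<bar> \<le> weight a v \<and> weight a v \<le> c powr (- \<bar>q\<bar>)" if "a \<in> F" "v \<in> Omega C" for a v
    unfolding weight_def using powr_bounds[OF c(1) c(3)[OF that] F_le_1[OF that], of "-q" "\<bar>q\<bar>"] by simp
  moreover have "0 < c powr \<bar>q\<bar>" using c by simp
  ultimately show ?thesis by blast
qed

lemma cell_borel [measurable]: "cell h a \<in> sets borel"
proof -
  have "cell h a = (\<Inter>b\<in>F. {v. h b * - (a \<bullet> v) \<le> h a * - (b \<bullet> v)})" by (auto simp: cell_def)
  moreover have "closed {v. h b * - (a \<bullet> v) \<le> h a * - (b \<bullet> v)}" for b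
    by (intro closed_Collect_le continuous_intros)
  ultimately show ?thesis by (auto intro!: borel_closed closed_INT)
qed

lemma weight_measurable [measurable]: "weight a \<in> borel_measurable borel"
  unfolding weight_def by measurable

lemma AE_weight_bound: 
  "\<exists>W\<ge>0. \<forall>a\<in>F. \<forall>h. AE v in \<sigma>. norm (indicator (cell h a) v * weight a v) \<le> W"
proof -
  obtain w W where W: "0 < w" "\<And>a v. a \<in> F \<Longrightarrow> v \<in> Omega C \<Longrightarrow> w \<le> weight a v \<and> weight a v \<le> W"
    using weight_bounds by blast
  have "AE v in \<sigma>. norm (indicator (cell h a) v * weight a v) \<le> \<bar>W\<bar>" if "a \<in> F" for a h
    using AE_Omega
  proof eventually_elim
    case (elim v)
    then have "w \<le> weight a v" "weight a v \<le> W" using W(2)[OF that] by auto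
    then show ?case using W(1) by (auto simp: indicator_def)
  qed
  then show ?thesis by (meson abs_ge_zero)
qed

lemma integrable_cell:
  assumes "a \<in> F"
  shows "integrable \<sigma> (\<lambda>v. indicator (cell h a) v * weight a v)"
proof -
  obtain W where "AE v in \<sigma>. norm (indicator (cell h a) v * weight a v) \<le> W"
    using AE_weight_bound assms by blast
  then show ?thesis by (rule integrable_const_bound) measurable
qed

text \<open>A tie places \<open>v\<close> on the hyperplane orthogonal to
  \<open>h b *\<^sub>R a - h a *\<^sub>R b\<close>. This vector is nonzero because positive
  multiples of distinct unit vectors never coincide.\<close>

lemma AE_no_ties:
  assumes a: "a \<in> F" and pos: "\<And>b. b \<in> F \<Longrightarrow> 0 < h b"
  shows "AE v in \<sigma>. \<forall>b\<in>F - {a}. h b * - (a \<bullet> v) \<noteq> h a * - (b \<bullet> v)"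
proof (rule AE_finite_allI)
  show "finite (F - {a})" using finite_F by simp
  fix b assume b: "b \<in> F - {a}"
  have "h b *\<^sub>R a - h a *\<^sub>R b \<noteq> 0"
  proof
    assume "h b *\<^sub>R a - h a *\<^sub>R b = 0"
    then have eq: "h b *\<^sub>R a = h a *\<^sub>R b" by simp
    then have "norm (h b *\<^sub>R a) = norm (h a *\<^sub>R b)" by simp
    then have hb: "h b = h a" using pos[of a] pos[of b] a b F_norm by auto
    have "a = b" using eq pos[OF a] unfolding hb by simp
    then show False using b by simp
  qed
  from AE_notin_hyperplane[OF this] show "AE v in \<sigma>. h b * - (a \<bullet> v) \<noteq> h a * - (b \<bullet> v)"
    by eventually_elim (simp add: inner_diff_left)
qed

text \<open>Off the null set of ties, membership in a cell is decided by strict inequalities and so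
  is eventually constant along the sequence; dominated convergence applies.\<close>

lemma mass_tendsto:
  assumes a: "a \<in> F" and pos: "\<And>b. b \<in> F \<Longrightarrow> 0 < h b"
    and lim: "\<And>b. b \<in> F \<Longrightarrow> (\<lambda>k. H k b) \<longlonglongrightarrow> h b"
  shows "(\<lambda>k. mass (H k) a) \<longlonglongrightarrow> mass h a"
  unfolding mass_def
proof (rule tendsto_mult)
  show "(\<lambda>k. H k a powr e) \<longlonglongrightarrow> h a powr e"
    using pos[OF a] by (intro tendsto_powr lim a tendsto_const) auto
  obtain W where W: "\<And>h. AE v in \<sigma>. norm (indicator (cell h a) v * weight a v) \<le> W"
    using AE_weight_bound a by blast
  show "(\<lambda>k. \<integral>v. indicator (cell (H k) a) v * weight a v \<partial>\<sigma>)
      \<longlonglongrightarrow> (\<integral>v. indicator (cell h a) v * weight a v \<partial>\<sigma>)"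
  proof (rule integral_dominated_convergence[where w="\<lambda>_. W"])
    have ties: "AE v in \<sigma>. \<forall>b\<in>F - {a}. h b * - (a \<bullet> v) \<noteq> h a * - (b \<bullet> v)"
      by (rule AE_no_ties[OF a pos])
    show "AE v in \<sigma>. (\<lambda>k. indicator (cell (H k) a) v * weight a v) \<longlonglongrightarrow> indicator (cell h a) v * weight a v"
      using ties
    proof eventually_elim
      case (elim v)
      have "\<forall>\<^sub>F k in sequentially. (v \<in> cell (H k) a) = (v \<in> cell h a)"
      proof (cases "v \<in> cell h a")
        case True
        have "\<forall>\<^sub>F k in sequentially. \<forall>b\<in>F. H k b * - (a \<bullet> v) \<le> H k a * - (b \<bullet> v)"
        proof (rule eventually_ball_finite[OF finite_F], rule ballI)
          fix b assume b: "b \<in> F"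
          show "\<forall>\<^sub>F k in sequentially. H k b * - (a \<bullet> v) \<le> H k a * - (b \<bullet> v)"
          proof (cases "b = a")
            case False
            have "h b * - (a \<bullet> v) < h a * - (b \<bullet> v)"
              unfolding less_le using True elim b False unfolding cell_def by blast
            then have "\<forall>\<^sub>F k in sequentially. H k b * - (a \<bullet> v) < H k a * - (b \<bullet> v)"
              by (rule eventually_less_of_tendsto; intro tendsto_intros lim a b)
            then show ?thesis by (rule eventually_mono) simp
          qed simp
        qed
        then show ?thesis using True by (simp add: cell_def)
      next
        case False
        then obtain b where b: "b \<in> F" "h a * - (b \<bullet> v) < h b * - (a \<bullet> v)"
          by (auto simp: cell_def not_le)
        then have "\<forall>\<^sub>F k in sequentially. H k a * - (b \<bullet> v) < H k b * - (a \<bullet> v)"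
          by (intro eventually_less_of_tendsto[OF b(2)] tendsto_intros lim a b(1))
        then show ?thesis
          by (rule eventually_mono) (use False b(1) in \<open>auto simp: cell_def not_le\<close>)
      qed
      then have "\<forall>\<^sub>F k in sequentially.
          indicator (cell h a) v * weight a v = indicator (cell (H k) a) v * weight a v"
        by (rule eventually_mono) (simp add: indicator_def)
      then show ?case by (rule Lim_transform_eventually[OF tendsto_const])
    qed
  qed (use W in auto)
qed

text \<open>With the value at \<open>a\<close> kept, larger values elsewhere shrink the cell of
  \<open>a\<close> and leave the factor \<open>h a powr e\<close> unchanged.\<close>

lemma mass_mono:
  assumes a: "a \<in> F" and eq: "h a = k a" and le: "\<And>b. b \<in> F \<Longrightarrow> k b \<le> h b"
  shows "mass h a \<le> mass k a"
  unfolding mass_def eq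
proof (rule mult_left_mono)
  show "(\<integral>v. indicator (cell h a) v * weight a v \<partial>\<sigma>) \<le> (\<integral>v. indicator (cell k a) v * weight a v \<partial>\<sigma>)"
  proof (rule integral_mono_AE[OF integrable_cell[OF a] integrable_cell[OF a]])
    show "AE v in \<sigma>. indicator (cell h a) v * weight a v \<le> indicator (cell k a) v * weight a v"
      using AE_Omega
    proof eventually_elim
      case (elim v)
      have "v \<in> cell k a" if v: "v \<in> cell h a"
        unfolding cell_def
      proof (intro CollectI ballI)
        fix b assume b: "b \<in> F"
        have "k b * - (a \<bullet> v) \<le> h b * - (a \<bullet> v)"
          using le[OF b] F_neg[OF a elim] by (intro mult_right_mono) auto
        also have "\<dots> \<le> h a * - (b \<bullet> v)" using v b by (simp add: cell_def)
        finally show "k b * - (a \<bullet> v) \<le> k a * - (b \<bullet> v)" by (simp add: eq)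
      qed
      moreover have "0 \<le> weight a v" by (simp add: weight_def)
      ultimately show ?case by (auto simp: indicator_def)
    qed
  qed
qed simp

text \<open>At each \<open>a\<close> the maximum agrees with one of the two functions and dominates
  that function elsewhere, so \<open>mass_mono\<close> applies.\<close>

lemma subsolutions_max:
  assumes h: "h \<in> subsolutions" and k: "k \<in> subsolutions"
  shows "(\<lambda>a. max (h a) (k a)) \<in> subsolutions"
  unfolding subsolutions_def
proof (intro CollectI ballI conjI)
  fix a assume a: "a \<in> F"
  show "0 < max (h a) (k a)" using h a by (auto simp: subsolutions_def)
  show "mass (\<lambda>a. max (h a) (k a)) a \<le> m a"
  proof (cases "k a \<le> h a")
    case True
    then have "mass (\<lambda>a. max (h a) (k a)) a \<le> mass h a" by (intro mass_mono[OF a]) auto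
    also have "\<dots> \<le> m a" using h a by (auto simp: subsolutions_def)
    finally show ?thesis .
  next
    case False
    then have "mass (\<lambda>a. max (h a) (k a)) a \<le> mass k a" by (intro mass_mono[OF a]) auto
    also have "\<dots> \<le> m a" using k a by (auto simp: subsolutions_def)
    finally show ?thesis .
  qed
qed

lemma subsolutions_nonempty: "subsolutions \<noteq> {}"
proof -
  obtain W where W: "W \<ge> 0"
    "\<And>a h. a \<in> F \<Longrightarrow> AE v in \<sigma>. norm (indicator (cell h a) v * weight a v) \<le> W"
    using AE_weight_bound by blast
  define I where "I = W * measure \<sigma> (space \<sigma>) + 1"
  have I: "I > 0" using W(1) by (simp add: I_def add_nonneg_pos)
  have int: "(\<integral>v. indicator (cell h a) v * weight a v \<partial>\<sigma>) \<le> I" if a: "a \<in> F" for a h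
  proof -
    have "(\<integral>v. indicator (cell h a) v * weight a v \<partial>\<sigma>) \<le> (\<integral>v. W \<partial>\<sigma>)"
    proof (rule integral_mono_AE[OF integrable_cell[OF a]])
      show "AE v in \<sigma>. indicator (cell h a) v * weight a v \<le> W"
        using W(2)[OF a, of h] by eventually_elim (simp add: abs_le_iff)
    qed simp
    then show ?thesis by (simp add: I_def mult.commute)
  qed
  define mm where "mm = Min (m ` F)"
  have mm: "0 < mm" "\<And>a. a \<in> F \<Longrightarrow> mm \<le> m a"
    using m_pos finite_F F_nonempty by (auto simp: mm_def)
  \<comment> \<open>Chosen so that \<open>s powr e * I\<close>, an upper bound for every mass of the
    constant function \<open>s\<close>, is the least prescribed mass.\<close>
  define s where "s = (mm / I) powr (1 / e)"
  have s: "0 < s" "s powr e = mm / I"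
    using mm(1) I e_pos by (auto simp: s_def powr_powr)
  have "(\<lambda>_. s) \<in> subsolutions"
    unfolding subsolutions_def
  proof (intro CollectI ballI conjI)
    fix a assume a: "a \<in> F"
    have "mass (\<lambda>_. s) a \<le> s powr e * I"
      unfolding mass_def using int[OF a] by (intro mult_left_mono) auto
    also have "\<dots> \<le> m a" using s I mm(2)[OF a] by simp
    finally show "mass (\<lambda>_. s) a \<le> m a" .
  qed (rule s)
  then show ?thesis by blast
qed

text \<open>A maximiser of \<open>h a / - (a \<bullet> v)\<close> over \<open>F\<close>, that is, a
  half-space the ray enters last.\<close>

lemma cell_exists:
  assumes pos: "\<And>b. b \<in> F \<Longrightarrow> 0 < h b" and v: "v \<in> Omega C"
  shows "\<exists>a\<in>F. v \<in> cell h a"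
proof -
  define r where "r a = h a / - (a \<bullet> v)" for a
  have "Max (r ` F) \<in> r ` F" using finite_F F_nonempty by (intro Max_in) auto
  then obtain a where a: "a \<in> F" "Max (r ` F) = r a" by blast
  have "h b * - (a \<bullet> v) \<le> h a * - (b \<bullet> v)" if b: "b \<in> F" for b
  proof -
    have "r b \<le> Max (r ` F)" using b finite_F by (intro Max_ge) auto
    then have "h b / - (b \<bullet> v) \<le> h a / - (a \<bullet> v)" unfolding a(2) r_def .
    then have "h b / - (b \<bullet> v) * (- (b \<bullet> v) * - (a \<bullet> v)) \<le> h a / - (a \<bullet> v) * (- (b \<bullet> v) * - (a \<bullet> v))"
      using F_neg[OF a(1) v] F_neg[OF b v] by (intro mult_right_mono mult_nonneg_nonneg) auto
    moreover have "b \<bullet> v \<noteq> 0" "a \<bullet> v \<noteq> 0" using F_neg[OF a(1) v] F_neg[OF b v] by auto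
    ultimately show ?thesis by (simp add: mult.commute)
  qed
  then show ?thesis using a(1) by (auto simp: cell_def)
qed

text \<open>Whatever the direction, the normal \<open>a\<close> of its cell satisfies
  \<open>c * h a0 \<le> h a\<close>. The total mass is therefore at least a constant times
  \<open>(c * h a0) powr e\<close>, while it is at most the sum of the prescribed masses.\<close>

lemma subsolutions_bounded: "\<exists>B. \<forall>h\<in>subsolutions. \<forall>a\<in>F. h a \<le> B"
proof -
  obtain c where c: "0 < c" "c \<le> 1" "\<And>a v. a \<in> F \<Longrightarrow> v \<in> Omega C \<Longrightarrow> c \<le> - (a \<bullet> v)"
    using F_lower by blast
  obtain w W where w: "0 < w" "\<And>a v. a \<in> F \<Longrightarrow> v \<in> Omega C \<Longrightarrow> w \<le> weight a v \<and> weight a v \<le> W"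
    using weight_bounds by blast
  let ?s = "measure \<sigma> (space \<sigma>)"
  have s: "?s > 0" using sigma_nonzero by (simp add: zero_less_measure_iff)
  define B where "B = ((\<Sum>a\<in>F. m a) / (w * ?s)) powr (1 / e) / c"
  have "h a0 \<le> B" if h: "h \<in> subsolutions" and a0: "a0 \<in> F" for h a0
  proof -
    have pos: "0 < h a" if "a \<in> F" for a using h that by (auto simp: subsolutions_def)
    let ?f = "\<lambda>a v. h a powr e * (indicator (cell h a) v * weight a v)"
    have intf: "integrable \<sigma> (?f a)" if "a \<in> F" for a
      by (intro integrable_mult_right integrable_cell that)
    have "(c * h a0) powr e * w * ?s = (\<integral>v. (c * h a0) powr e * w \<partial>\<sigma>)" by simp
    also have "\<dots> \<le> (\<integral>v. (\<Sum>a\<in>F. ?f a v) \<partial>\<sigma>)"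
    proof (rule integral_mono_AE)
      show "AE v in \<sigma>. (c * h a0) powr e * w \<le> (\<Sum>a\<in>F. ?f a v)"
        using AE_Omega
      proof eventually_elim
        case (elim v)
        have "\<exists>a\<in>F. v \<in> cell h a" by (rule cell_exists[OF pos elim])
        then obtain a where a: "a \<in> F" "v \<in> cell h a" by blast
        have "c * h a0 \<le> h a0 * - (a \<bullet> v)"
          using mult_right_mono[OF c(3)[OF a(1) elim], of "h a0"] pos[OF a0] by (simp add: mult.commute)
        also have "\<dots> \<le> h a * - (a0 \<bullet> v)" using a a0 by (simp add: cell_def)
        also have "\<dots> \<le> h a" using F_le_1[OF a0 elim] pos[OF a(1)] by (intro mult_left_le) auto
        finally have "(c * h a0) powr e \<le> h a powr e"
          using c pos[OF a0] e_pos by (intro powr_mono2) auto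
        then have "(c * h a0) powr e * w \<le> h a powr e * weight a v"
          using w(1) w(2)[OF a(1) elim] by (intro mult_mono) auto
        also have "\<dots> = ?f a v" using a by simp
        also have "\<dots> \<le> (\<Sum>a\<in>F. ?f a v)"
          using finite_F a(1) by (intro member_le_sum) (auto simp: weight_def)
        finally show ?case .
      qed
    qed (use intf in \<open>auto intro!: Bochner_Integration.integrable_sum\<close>)
    also have "\<dots> = (\<Sum>a\<in>F. mass h a)"
      using intf by (subst Bochner_Integration.integral_sum) (auto simp: mass_def)
    also have "\<dots> \<le> (\<Sum>a\<in>F. m a)" using h by (intro sum_mono) (auto simp: subsolutions_def)
    finally have le: "(c * h a0) powr e \<le> (\<Sum>a\<in>F. m a) / (w * ?s)"
      using w(1) s by (simp add: le_divide_eq mult.assoc)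
    have "c * h a0 = ((c * h a0) powr e) powr (1 / e)"
      using c pos[OF a0] e_pos by (simp add: powr_powr)
    also have "\<dots> \<le> ((\<Sum>a\<in>F. m a) / (w * ?s)) powr (1 / e)"
      using le e_pos by (intro powr_mono2) auto
    finally show ?thesis using c(1) by (simp add: B_def le_divide_eq mult.commute)
  qed
  then show ?thesis by blast
qed

lemma subsolutions_bdd_above:
  assumes "a \<in> F" shows "bdd_above ((\<lambda>k. k a) ` subsolutions)"
proof -
  obtain B where "\<And>h. h \<in> subsolutions \<Longrightarrow> h a \<le> B" using subsolutions_bounded assms by blast
  then show ?thesis by (rule bdd_aboveI2)
qed

text \<open>The suprema at different \<open>a\<close> are approached by different subsolutions;
  finitely many of them are merged by taking maxima.\<close>

lemma subsolution_near_sup: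
  assumes eps: "0 < \<epsilon>"
  shows "\<exists>h\<in>subsolutions. \<forall>a\<in>F. (SUP k\<in>subsolutions. k a) - \<epsilon> < h a"
proof -
  have "\<exists>h\<in>subsolutions. \<forall>a\<in>F'. (SUP k\<in>subsolutions. k a) - \<epsilon> < h a" if "finite F'" "F' \<subseteq> F" for F'
    using that
  proof (induction F')
    case empty
    then show ?case using subsolutions_nonempty by auto
  next
    case (insert a F')
    then obtain h where h: "h \<in> subsolutions" "\<And>b. b \<in> F' \<Longrightarrow> (SUP k\<in>subsolutions. k b) - \<epsilon> < h b"
      by auto
    have "(SUP k\<in>subsolutions. k a) - \<epsilon> < (SUP k\<in>subsolutions. k a)" using eps by simp
    then obtain k where k: "k \<in> subsolutions" "(SUP k\<in>subsolutions. k a) - \<epsilon> < k a"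
      using less_cSUP_iff[OF subsolutions_nonempty subsolutions_bdd_above[of a], of "(SUP k\<in>subsolutions. k a) - \<epsilon>"]
        insert.prems by blast
    show ?case
    proof (intro bexI[OF _ subsolutions_max[OF h(1) k(1)]] ballI)
      fix b assume "b \<in> insert a F'"
      then show "(SUP k\<in>subsolutions. k b) - \<epsilon> < max (h b) (k b)"
        using h(2) k(2) by (auto simp: less_max_iff_disj)
    qed
  qed
  from this[OF finite_F order_refl] show ?thesis .
qed

lemma mass_solution: "\<exists>h. \<forall>a\<in>F. 0 < h a \<and> mass h a = m a"
proof -
  define s where "s a = (SUP k\<in>subsolutions. k a)" for a
  have upper: "h a \<le> s a" if "h \<in> subsolutions" "a \<in> F" for h a
    unfolding s_def using that by (intro cSUP_upper subsolutions_bdd_above)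
  have "\<exists>h\<in>subsolutions. \<forall>a\<in>F. s a - inverse (real (Suc n)) < h a" for n
    unfolding s_def by (rule subsolution_near_sup) simp
  then obtain H where H: "\<And>n. H n \<in> subsolutions" "\<And>n a. a \<in> F \<Longrightarrow> s a - inverse (real (Suc n)) < H n a"
    by metis
  have lim: "(\<lambda>n. H n a) \<longlonglongrightarrow> s a" if a: "a \<in> F" for a
  proof (rule tendsto_sandwich)
    show "(\<lambda>n. s a - inverse (real (Suc n))) \<longlonglongrightarrow> s a"
      using tendsto_diff[OF tendsto_const LIMSEQ_inverse_real_of_nat, of "s a"] by simp
    show "\<forall>\<^sub>F n in sequentially. s a - inverse (real (Suc n)) \<le> H n a"
      using H(2)[OF a] by (intro always_eventually allI less_imp_le)
    show "\<forall>\<^sub>F n in sequentially. H n a \<le> s a"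
      using upper[OF H(1) a] by (intro always_eventually allI)
  qed simp
  have s_pos: "0 < s a" if "a \<in> F" for a
    using upper[OF H(1)[of 0] that] H(1)[of 0] that by (fastforce simp: subsolutions_def)
  have s: "s \<in> subsolutions"
    unfolding subsolutions_def
  proof (intro CollectI ballI conjI)
    fix a assume a: "a \<in> F"
    show "0 < s a" by (rule s_pos[OF a])
    have "(\<lambda>n. mass (H n) a) \<longlonglongrightarrow> mass s a" by (rule mass_tendsto[OF a s_pos lim])
    then show "mass s a \<le> m a"
      by (rule LIMSEQ_le_const2) (use H(1) a in \<open>auto simp: subsolutions_def\<close>)
  qed
  have "mass s a = m a" if a: "a \<in> F" for a
  proof (rule ccontr)
    assume "mass s a \<noteq> m a"
    then have lt: "mass s a < m a" using s a by (force simp: subsolutions_def)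
    \<comment> \<open>Raising the supremum at \<open>a\<close> alone by a small amount keeps the
      mass there below \<open>m a\<close> by continuity and does not increase the others. The result
      would be a subsolution exceeding the supremum.\<close>
    define K where "K n = s(a := s a + inverse (real (Suc n)))" for n
    have limK: "(\<lambda>n. K n b) \<longlonglongrightarrow> s b" for b
    proof (cases "b = a")
      case True
      then show ?thesis
        using tendsto_add[OF tendsto_const LIMSEQ_inverse_real_of_nat, of "s a"] by (simp add: K_def)
    qed (simp add: K_def)
    have "(\<lambda>n. mass (K n) a) \<longlonglongrightarrow> mass s a" by (rule mass_tendsto[OF a s_pos limK])
    from order_tendstoD(2)[OF this lt] obtain n where n: "mass (K n) a < m a"
      by (auto simp: eventually_sequentially)
    have "K n \<in> subsolutions"
      unfolding subsolutions_def
    proof (intro CollectI ballI conjI)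
      fix b assume b: "b \<in> F"
      show "0 < K n b" using s_pos[OF b] by (auto simp: K_def add_pos_pos)
      show "mass (K n) b \<le> m b"
      proof (cases "b = a")
        case False
        have "mass (K n) b \<le> mass s b" using False by (intro mass_mono[OF b]) (auto simp: K_def)
        also have "\<dots> \<le> m b" using s b by (auto simp: subsolutions_def)
        finally show ?thesis .
      qed (use n in simp)
    qed
    from upper[OF this a] have "inverse (real (Suc n)) \<le> 0" by (simp add: K_def del: of_nat_Suc)
    moreover have "0 < inverse (real (Suc n))" by simp
    ultimately show False by linarith
  qed
  with s_pos show ?thesis by blast
qed

end

text \<open>With radial function \<open>1 / N v\<close> and support function
  \<open>(\<alpha> v \<bullet> v) / N v\<close> at the normal \<open>\<alpha> v\<close>, this is the
  minus \<open>p\<close>-th power of the negated support function times the \<open>q\<close>-th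
  power of the radial function.\<close>

definition pq_density :: "real \<Rightarrow> real \<Rightarrow> ('a::real_inner \<Rightarrow> real) \<Rightarrow> ('a \<Rightarrow> 'a) \<Rightarrow> 'a \<Rightarrow> real" where
  "pq_density p q N \<alpha> v = (- (\<alpha> v \<bullet> v)) powr (- p) * N v powr (p - q)"

text \<open>Measurable choice among finitely many candidates: the first list entry with the
  property. It serves both for the discretising maps and for the choice of a cell.\<close>

lemma measurable_list_select:
  assumes "\<And>i. i < length xs \<Longrightarrow> {v. P (xs ! i) v} \<in> sets borel"
  shows "(\<lambda>v. xs ! (LEAST i. i < length xs \<and> P (xs ! i) v)) \<in> borel_measurable borel"
proof -
  have "(\<lambda>v. i < length xs \<and> P (xs ! i) v) \<in> measurable borel (count_space UNIV)" for i
    using assms[of i] by (cases "i < length xs") (auto simp: pred_def)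
  then have "(\<lambda>v. LEAST i. i < length xs \<and> P (xs ! i) v) \<in> measurable borel (count_space UNIV)"
    by (rule measurable_Least[where P="\<lambda>i v. i < length xs \<and> P (xs ! i) v"])
  moreover have "(\<lambda>i. xs ! i) \<in> measurable (count_space UNIV) borel" by simp
  ultimately show ?thesis by (rule measurable_compose)
qed

lemma list_select:
  assumes "\<exists>a\<in>set xs. P a"
  shows "xs ! (LEAST i. i < length xs \<and> P (xs ! i)) \<in> set xs" "P (xs ! (LEAST i. i < length xs \<and> P (xs ! i)))"
proof -
  have "\<exists>i. i < length xs \<and> P (xs ! i)" using assms by (metis in_set_conv_nth)
  from LeastI_ex[OF this] show "xs ! (LEAST i. i < length xs \<and> P (xs ! i)) \<in> set xs"
    "P (xs ! (LEAST i. i < length xs \<and> P (xs ! i)))" by (simp_all add: nth_mem)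
qed

text \<open>Total boundedness with centres taken from \<open>S\<close> itself, so that discretised
  normals remain interior to the polar cone.\<close>

lemma finite_range_approximation:
  fixes S :: "'a::euclidean_space set"
  assumes S: "bounded S" and e: "0 < e"
  shows "\<exists>T\<in>borel_measurable borel. finite (T ` S) \<and> T ` S \<subseteq> S \<and> (\<forall>u\<in>S. dist u (T u) < e)"
proof -
  have "closure S \<subseteq> (\<Union>a\<in>S. ball a e)"
    using e by (force simp: closure_approachable)
  moreover have "compact (closure S)" using S by simp
  ultimately obtain K where K: "K \<subseteq> S" "finite K" "closure S \<subseteq> (\<Union>a\<in>K. ball a e)"
    by (metis compactE_image open_ball)
  obtain xs where xs: "set xs = K" using finite_list[OF K(2)] by blast
  define T where "T u = xs ! (LEAST i. i < length xs \<and> dist u (xs ! i) < e)" for u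
  have "T \<in> borel_measurable borel"
    unfolding T_def
  proof (rule measurable_list_select)
    fix i
    have "{v. dist v (xs ! i) < e} = ball (xs ! i) e" by (auto simp: dist_commute)
    then show "{v. dist v (xs ! i) < e} \<in> sets borel" by simp
  qed
  moreover have T: "T u \<in> K \<and> dist u (T u) < e" if u: "u \<in> S" for u
  proof -
    have "\<exists>a\<in>set xs. dist u a < e" using K(3) u closure_subset xs by (fastforce simp: dist_commute)
    from list_select[of xs "\<lambda>a. dist u a < e", OF this] show ?thesis by (simp add: T_def xs)
  qed
  moreover have "finite (T ` S)" using T K(2) by (meson finite_subset image_subsetI)
  ultimately show ?thesis using K(1) by blast
qed

section \<open>The polyhedral gauge of a finite problem\<close>

context discrete_problem
begin

text \<open>\<open>N\<close> is the least of the functions \<open>- (a \<bullet> x) / h a\<close>.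
  With \<open>H\<close> the largest \<open>h a\<close>, attained at a unit normal,
  \<open>N x \<le> norm x / H\<close>, and an inscribed ball of radius \<open>r\<close> gives
  \<open>r / H \<le> N x\<close>; hence the common constant \<open>1 / H\<close>.\<close>

lemma gauge_solution:
  fixes p :: real
  assumes e: "e = q - p"
  shows "\<exists>H N \<alpha>. 0 < H \<and> gauge_fun (1 / H) (1 / H) N \<and> \<alpha> \<in> borel_measurable borel \<and>
    (\<forall>v\<in>Omega C. \<alpha> v \<in> F \<and> normal_at N v (\<alpha> v) \<and> - (\<alpha> v \<bullet> v) / H \<le> N v) \<and>
    (\<forall>a\<in>F. (\<integral>\<^sup>+v. indicator {a} (\<alpha> v) * ennreal (pq_density p q N \<alpha> v) \<partial>\<sigma>) = ennreal (m a))"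
proof -
  obtain h where h: "\<And>a. a \<in> F \<Longrightarrow> 0 < h a" and mass_h: "\<And>a. a \<in> F \<Longrightarrow> mass h a = m a"
    using mass_solution by blast
  define H where "H = Max (h ` F)"
  have "H \<in> h ` F" unfolding H_def using finite_F F_nonempty by (intro Max_in) auto
  then obtain a0 where a0: "a0 \<in> F" "H = h a0" by blast
  have H: "0 < H" using h a0 by simp
  have hH: "h a \<le> H" if "a \<in> F" for a unfolding H_def using that finite_F by (intro Max_ge) auto
  define N where "N x = Min ((\<lambda>a. - (a \<bullet> x) / h a) ` F)" for x
  have N_le: "N x \<le> - (a \<bullet> x) / h a" if "a \<in> F" for a x
    unfolding N_def using that finite_F by (intro Min_le) auto
  have N_ge: "c \<le> N x" if "\<And>a. a \<in> F \<Longrightarrow> c \<le> - (a \<bullet> x) / h a" for c x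
    unfolding N_def using that finite_F F_nonempty by (subst Min_ge_iff) auto
  have gauge: "gauge_fun (1 / H) (1 / H) N"
    unfolding gauge_fun_def
  proof (intro conjI ballI allI impI)
    show "N \<in> borel_measurable borel"
      unfolding N_def using finite_F by measurable
    fix x
    show "N x + N y \<le> N (x + y)" for y
    proof (rule N_ge)
      fix a assume a: "a \<in> F"
      show "N x + N y \<le> - (a \<bullet> (x + y)) / h a"
        using N_le[OF a, of x] N_le[OF a, of y] by (simp add: inner_add_right add_divide_distrib diff_divide_distrib)
    qed
    show "N (t *\<^sub>R x) = t * N x" if t: "0 < t" for t
    proof -
      have "t * N x = Min ((\<lambda>y. t * y) ` (\<lambda>a. - (a \<bullet> x) / h a) ` F)"
        unfolding N_def using t finite_F F_nonempty by (intro mono_Min_commute) (auto intro!: monoI)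
      also have "\<dots> = N (t *\<^sub>R x)" by (simp add: N_def image_image)
      finally show ?thesis by simp
    qed
    have "N x \<le> - (a0 \<bullet> x) / H" using N_le[OF a0(1)] a0(2) by simp
    also have "\<dots> \<le> norm x / H"
      using Cauchy_Schwarz_ineq2[of a0 x] F_norm[OF a0(1)] H by (intro divide_right_mono) auto
    finally show "N x \<le> 1 / H * norm x" by simp
    show "1 / H * r \<le> N x" if r: "0 < r" "ball x r \<subseteq> C" for r
    proof (rule N_ge)
      fix a assume a: "a \<in> F"
      have "r \<le> - (a \<bullet> x)"
        using F_sub a OmegaD(3) F_norm[OF a] by (intro inner_polar_cone_ball[OF r]) auto
      then have "r / H \<le> - (a \<bullet> x) / h a"
        using r(1) hH[OF a] h[OF a] by (intro frac_le) auto
      then show "1 / H * r \<le> - (a \<bullet> x) / h a" by simp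
    qed
  qed
  obtain xs where xs: "set xs = F" using finite_list[OF finite_F] by blast
  \<comment> \<open>Any cell containing \<open>v\<close> would do: choices differ only at ties.
    Taking the least index makes the choice measurable.\<close>
  define \<alpha> where "\<alpha> v = xs ! (LEAST i. i < length xs \<and> v \<in> cell h (xs ! i))" for v
  have meas: "\<alpha> \<in> borel_measurable borel"
    unfolding \<alpha>_def using cell_borel by (intro measurable_list_select) simp
  have \<alpha>: "\<alpha> v \<in> F" "v \<in> cell h (\<alpha> v)" if "v \<in> Omega C" for v
  proof -
    have "\<exists>a\<in>set xs. v \<in> cell h a" unfolding xs by (rule cell_exists[OF h that])
    from list_select[of xs "\<lambda>a. v \<in> cell h a", OF this] show "\<alpha> v \<in> F" "v \<in> cell h (\<alpha> v)"
      by (simp_all add: \<alpha>_def xs)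
  qed
  have N_cell: "N v = - (a \<bullet> v) / h a" if a: "a \<in> F" and v: "v \<in> cell h a" for a v
  proof (rule antisym[OF N_le[OF a] N_ge])
    fix b assume b: "b \<in> F"
    have "h b * - (a \<bullet> v) \<le> h a * - (b \<bullet> v)" using v b by (simp add: cell_def)
    then show "- (a \<bullet> v) / h a \<le> - (b \<bullet> v) / h b"
      using h[OF a] h[OF b] by (simp add: divide_le_eq le_divide_eq mult.commute)
  qed
  have norm: "normal_at N v a" if a: "a \<in> F" and v: "v \<in> cell h a" "v \<in> Omega C" for a v
    unfolding normal_at_def
  proof (intro conjI ballI)
    show "norm a = 1" by (rule F_norm[OF a])
    show "a \<in> polar_cone C" using F_sub a OmegaD(3) by auto
    fix y
    have "N y * - (a \<bullet> v) \<le> (- (a \<bullet> y) / h a) * - (a \<bullet> v)"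
      using F_neg[OF a v(2)] by (intro mult_right_mono N_le[OF a]) auto
    then show "N v * (a \<bullet> y) \<le> N y * (a \<bullet> v)"
      unfolding N_cell[OF a v(1)] using h[OF a] by (simp add: field_simps)
  qed
  have low: "- (a \<bullet> v) / H \<le> N v" if a: "a \<in> F" and v: "v \<in> cell h a" "v \<in> Omega C" for a v
    unfolding N_cell[OF a v(1)] using F_neg[OF a v(2)] hH[OF a] h[OF a] by (intro divide_left_mono) auto
  have "(\<integral>\<^sup>+v. indicator {a} (\<alpha> v) * ennreal (pq_density p q N \<alpha> v) \<partial>\<sigma>) = ennreal (m a)"
    if a: "a \<in> F" for a
  proof -
    let ?f = "\<lambda>v. h a powr e * (indicator (cell h a) v * weight a v)"
    have ties: "AE v in \<sigma>. \<forall>b\<in>F - {a}. h b * - (a \<bullet> v) \<noteq> h a * - (b \<bullet> v)"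
      by (rule AE_no_ties[OF a h])
    have "(\<integral>\<^sup>+v. indicator {a} (\<alpha> v) * ennreal (pq_density p q N \<alpha> v) \<partial>\<sigma>) = (\<integral>\<^sup>+v. ennreal (?f v) \<partial>\<sigma>)"
    proof (rule nn_integral_cong_AE)
      show "AE v in \<sigma>. indicator {a} (\<alpha> v) * ennreal (pq_density p q N \<alpha> v) = ennreal (?f v)"
        using ties AE_Omega
      proof eventually_elim
        case (elim v)
        have iff: "\<alpha> v = a \<longleftrightarrow> v \<in> cell h a"
        proof
          assume v: "v \<in> cell h a"
          show "\<alpha> v = a"
          proof (rule ccontr)
            assume ne: "\<alpha> v \<noteq> a"
            let ?b = "\<alpha> v"
            have "h ?b * - (a \<bullet> v) \<le> h a * - (?b \<bullet> v)"
              using v \<alpha>(1)[OF elim(2)] unfolding cell_def by blast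
            moreover have "h a * - (?b \<bullet> v) \<le> h ?b * - (a \<bullet> v)"
              using \<alpha>(2)[OF elim(2)] a unfolding cell_def by blast
            ultimately have "h ?b * - (a \<bullet> v) = h a * - (?b \<bullet> v)" by (rule antisym)
            then show False using elim(1) ne \<alpha>(1)[OF elim(2)] by blast
          qed
        qed (use \<alpha>(2)[OF elim(2)] in blast)
        show ?case
        proof (cases "\<alpha> v = a")
          case True
          then have v: "v \<in> cell h a" using iff by simp
          define t where "t = - (a \<bullet> v)"
          have t: "0 < t" using F_neg[OF a elim(2)] by (simp add: t_def)
          \<comment> \<open>Here \<open>N v = t / h a\<close>, and the exponents of \<open>t\<close>
            add up to \<open>- q\<close>.\<close>
          have "pq_density p q N \<alpha> v = t powr (- p) * (t / h a) powr (p - q)"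
            unfolding pq_density_def True N_cell[OF a v] t_def ..
          also have "\<dots> = h a powr e * t powr (- q)"
            using t h[OF a] by (simp add: e powr_divide powr_diff powr_minus field_simps)
          finally show ?thesis using True v by (simp add: weight_def t_def)
        qed (use iff in simp)
      qed
    qed
    also have "\<dots> = ennreal (\<integral>v. ?f v \<partial>\<sigma>)"
      by (intro nn_integral_eq_integral integrable_mult_right integrable_cell a)
        (auto simp: weight_def)
    also have "(\<integral>v. ?f v \<partial>\<sigma>) = mass h a" unfolding mass_def by simp
    finally show ?thesis using mass_h[OF a] by simp
  qed
  with H gauge meas \<alpha> norm low show ?thesis
    by (intro exI[of _ H] exI[of _ N] exI[of _ \<alpha>]) auto
qed

end

section \<open>Measures pushed forward to finitely many normals\<close>

context cone_measure
begin

text \<open>The image of \<open>\<mu>\<close> under \<open>T\<close> has finitely many atoms, for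
  which the discrete problem is solved. The function \<open>f\<close> can be arbitrary, since both
  sides reduce to finite sums over the atoms.\<close>

lemma finite_range_solution:
  fixes \<mu> :: "'a measure" and p q :: real and T :: "'a \<Rightarrow> 'a"
  assumes fin: "finite_measure \<mu>" and nz: "emeasure \<mu> (space \<mu>) \<noteq> 0" and pq: "p < q"
    and T [measurable]: "T \<in> borel_measurable \<mu>" and T_fin: "finite (T ` space \<mu>)"
    and T_sub: "T ` space \<mu> \<subseteq> Omega (polar_cone C)"
  shows "\<exists>H N \<alpha>. 0 < H \<and> gauge_fun (1 / H) (1 / H) N \<and> \<alpha> \<in> borel_measurable borel \<and>
    (\<forall>v\<in>Omega C. \<alpha> v \<in> Omega (polar_cone C) \<and> normal_at N v (\<alpha> v) \<and> - (\<alpha> v \<bullet> v) / H \<le> N v) \<and>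
    (\<forall>f :: 'a \<Rightarrow> ennreal.
       (\<integral>\<^sup>+v. f (\<alpha> v) * ennreal (pq_density p q N \<alpha> v) \<partial>\<sigma>) = (\<integral>\<^sup>+u. f (T u) \<partial>\<mu>))"
proof -
  interpret mu: finite_measure \<mu> by fact
  define m where "m a = measure \<mu> (T -` {a} \<inter> space \<mu>)" for a
  \<comment> \<open>Values of mass 0 are dropped because the discrete problem prescribes positive
    masses; almost every \<open>T u\<close> is kept.\<close>
  define F where "F = {a \<in> T ` space \<mu>. 0 < m a}"
  have fin_F: "finite F" using T_fin by (simp add: F_def)
  have AE_F: "AE u in \<mu>. T u \<in> F"
  proof -
    have "AE u in \<mu>. \<forall>a\<in>T ` space \<mu> - F. u \<notin> T -` {a} \<inter> space \<mu>"
    proof (rule AE_finite_allI)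
      fix a assume a: "a \<in> T ` space \<mu> - F"
      then have "\<not> 0 < m a" by (simp add: F_def)
      then have "m a = 0" by (simp add: m_def zero_less_measure_iff)
      then have "T -` {a} \<inter> space \<mu> \<in> null_sets \<mu>"
        by (simp add: m_def null_sets_def mu.emeasure_eq_measure)
      then show "AE u in \<mu>. u \<notin> T -` {a} \<inter> space \<mu>" by (rule AE_not_in)
    qed (use T_fin in auto)
    then show ?thesis using AE_space by eventually_elim auto
  qed
  have F_ne: "F \<noteq> {}"
  proof
    assume "F = {}"
    then have "AE u in \<mu>. u \<notin> space \<mu>" using AE_F by simp
    then have "space \<mu> \<in> null_sets \<mu>" by (subst AE_iff_null_sets) auto
    then show False using nz by (simp add: null_sets_def)
  qed
  interpret dp: discrete_problem C \<sigma> F m q "q - p"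
    by unfold_locales (use fin_F F_ne T_sub pq in \<open>auto simp: F_def\<close>)
  obtain H N \<alpha> where H: "0 < H" "gauge_fun (1 / H) (1 / H) N" and \<alpha> [measurable]: "\<alpha> \<in> borel_measurable borel"
    and \<alpha>F: "\<And>v. v \<in> Omega C \<Longrightarrow> \<alpha> v \<in> F \<and> normal_at N v (\<alpha> v) \<and> - (\<alpha> v \<bullet> v) / H \<le> N v"
    and mass: "\<And>a. a \<in> F \<Longrightarrow>
      (\<integral>\<^sup>+v. indicator {a} (\<alpha> v) * ennreal (pq_density p q N \<alpha> v) \<partial>\<sigma>) = ennreal (m a)"
    using dp.gauge_solution[of p] by blast
  have N [measurable]: "N \<in> borel_measurable borel" by (rule gauge_funD(1)[OF H(2)])
  have dens [measurable]: "pq_density p q N \<alpha> \<in> borel_measurable borel"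
    unfolding pq_density_def by measurable
  have "(\<integral>\<^sup>+v. f (\<alpha> v) * ennreal (pq_density p q N \<alpha> v) \<partial>\<sigma>) = (\<integral>\<^sup>+u. f (T u) \<partial>\<mu>)"
    for f :: "'a \<Rightarrow> ennreal"
  proof -
    have sum: "(\<Sum>a\<in>F. f a * indicator {a} b) = f b" if "b \<in> F" for b
      using that fin_F by (simp add: indicator_def if_distrib cong: if_cong)
    have "(\<integral>\<^sup>+v. f (\<alpha> v) * ennreal (pq_density p q N \<alpha> v) \<partial>\<sigma>)
        = (\<integral>\<^sup>+v. (\<Sum>a\<in>F. f a * (indicator {a} (\<alpha> v) * ennreal (pq_density p q N \<alpha> v))) \<partial>\<sigma>)"
    proof (rule nn_integral_cong_AE)
      show "AE v in \<sigma>. f (\<alpha> v) * ennreal (pq_density p q N \<alpha> v) =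
          (\<Sum>a\<in>F. f a * (indicator {a} (\<alpha> v) * ennreal (pq_density p q N \<alpha> v)))"
        using AE_Omega
      proof eventually_elim
        case (elim v)
        then show ?case using sum[of "\<alpha> v"] \<alpha>F[OF elim]
          by (simp add: sum_distrib_right[symmetric] mult.assoc[symmetric])
      qed
    qed
    also have "\<dots> = (\<Sum>a\<in>F. f a * (\<integral>\<^sup>+v. indicator {a} (\<alpha> v) * ennreal (pq_density p q N \<alpha> v) \<partial>\<sigma>))"
      by (subst nn_integral_sum) (auto intro!: sum.cong nn_integral_cmult)
    also have "\<dots> = (\<Sum>a\<in>F. f a * (\<integral>\<^sup>+u. indicator {a} (T u) \<partial>\<mu>))"
    proof (rule sum.cong[OF refl])
      fix a assume a: "a \<in> F"
      have "(\<integral>\<^sup>+u. indicator {a} (T u) \<partial>\<mu>) = (\<integral>\<^sup>+u. indicator (T -` {a} \<inter> space \<mu>) u \<partial>\<mu>)"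
        by (intro nn_integral_cong) (auto simp: indicator_def)
      also have "\<dots> = ennreal (m a)" by (simp add: m_def mu.emeasure_eq_measure)
      finally show "f a * (\<integral>\<^sup>+v. indicator {a} (\<alpha> v) * ennreal (pq_density p q N \<alpha> v) \<partial>\<sigma>) =
          f a * (\<integral>\<^sup>+u. indicator {a} (T u) \<partial>\<mu>)" using mass[OF a] by simp
    qed
    also have "\<dots> = (\<integral>\<^sup>+u. (\<Sum>a\<in>F. f a * indicator {a} (T u)) \<partial>\<mu>)"
      by (subst nn_integral_sum) (auto intro!: sum.cong nn_integral_cmult[symmetric])
    also have "\<dots> = (\<integral>\<^sup>+u. f (T u) \<partial>\<mu>)"
    proof (rule nn_integral_cong_AE)
      show "AE u in \<mu>. (\<Sum>a\<in>F. f a * indicator {a} (T u)) = f (T u)"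
        using AE_F by eventually_elim (rule sum)
    qed
    finally show ?thesis .
  qed
  moreover have "F \<subseteq> Omega (polar_cone C)" using T_sub by (auto simp: F_def)
  ultimately show ?thesis using H \<alpha> \<alpha>F
    by (intro exI[of _ H] exI[of _ N] exI[of _ \<alpha>]) auto
qed

end

section \<open>Passage to the limit\<close>

context pointed_cone_space
begin

lemma gauge_fun_weaken:
  assumes "gauge_fun b B N" "b' \<le> b" "B \<le> B'"
  shows "gauge_fun b' B' N"
proof -
  have "N x \<le> B' * norm x" if "x \<in> interior C" for x
    using gauge_funD(4)[OF assms(1) that] mult_right_mono[OF assms(3), of "norm x"] by simp
  moreover have "b' * r \<le> N x" if "x \<in> interior C" "0 < r" "ball x r \<subseteq> C" for x r
    using order_trans[OF mult_right_mono[OF assms(2), of r] gauge_funD(5)[OF assms(1) that]] that(2) by simp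
  ultimately show ?thesis using assms(1) unfolding gauge_fun_def by blast
qed

text \<open>Test functions that vanish near the boundary of the polar cone: on their support the products
  \<open>u \<bullet> v\<close> with unit vectors \<open>v\<close> of the cone stay away from 0.\<close>

definition polar_test :: "real \<Rightarrow> ('a \<Rightarrow> real) \<Rightarrow> bool" where
  "polar_test d \<phi> \<longleftrightarrow> 0 < d \<and> continuous_on UNIV \<phi> \<and>
     (\<forall>u. 0 \<le> \<phi> u \<and> \<phi> u \<le> 1 \<and> (\<phi> u \<noteq> 0 \<longrightarrow> ball u d \<subseteq> polar_cone C))"

lemma polar_testD:
  assumes "polar_test d \<phi>"
  shows "0 < d" "isCont \<phi> u" "0 \<le> \<phi> u" "\<phi> u \<le> 1" "\<phi> u \<noteq> 0 \<Longrightarrow> ball u d \<subseteq> polar_cone C"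
  using assms unfolding polar_test_def continuous_on_eq_continuous_at[OF open_UNIV] by blast+

lemma polar_test_sequence:
  assumes X: "open X"
  shows "\<exists>\<phi>. (\<forall>k. polar_test (inverse (real (Suc k))) (\<phi> k)) \<and> (\<forall>u. incseq (\<lambda>k. \<phi> k u)) \<and>
    (\<forall>u. (\<lambda>k. \<phi> k u) \<longlonglongrightarrow> indicator (X \<inter> interior (polar_cone C)) u)"
proof -
  let ?Y = "- (X \<inter> interior (polar_cone C))"
  \<comment> \<open>The shift by 1 makes \<open>\<phi> k\<close> vanish within distance
    \<open>1 / (k + 1)\<close> of the complement, so balls of that radius about points where it is
    nonzero lie in the polar cone. From distance \<open>2 / (k + 1)\<close> on the value is
    1.\<close>
  define \<phi> where "\<phi> k u = max 0 (min 1 (real (Suc k) * infdist u ?Y - 1))" for k u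
  \<comment> \<open>The origin belongs to \<open>?Y\<close>; to an empty set \<open>infdist\<close>
    would be 0 by convention.\<close>
  have Y: "closed ?Y" "?Y \<noteq> {}"
    using X zero_notin_interior_polar by (auto simp: closed_def intro!: open_Int)
  have "polar_test (inverse (real (Suc k))) (\<phi> k)" for k
    unfolding polar_test_def
  proof (intro conjI allI impI)
    show "continuous_on UNIV (\<phi> k)" unfolding \<phi>_def by (intro continuous_intros)
    fix u assume "\<phi> k u \<noteq> 0"
    then have "1 < real (Suc k) * infdist u ?Y" by (auto simp: \<phi>_def max_def min_def split: if_splits)
    then have inf: "inverse (real (Suc k)) < infdist u ?Y"
      by (simp add: field_simps)
    show "ball u (inverse (real (Suc k))) \<subseteq> polar_cone C"
    proof
      fix y assume y: "y \<in> ball u (inverse (real (Suc k)))"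
      have "y \<notin> ?Y"
      proof
        assume "y \<in> ?Y"
        then have "infdist u ?Y \<le> dist u y" by (rule infdist_le)
        then show False using y inf by simp
      qed
      then show "y \<in> polar_cone C" using interior_subset by blast
    qed
  qed (auto simp: \<phi>_def)
  moreover have "incseq (\<lambda>k. \<phi> k u)" for u
    unfolding \<phi>_def by (intro incseq_SucI max.mono min.mono diff_right_mono mult_right_mono) (auto simp: infdist_nonneg)
  moreover have "(\<lambda>k. \<phi> k u) \<longlonglongrightarrow> indicator (X \<inter> interior (polar_cone C)) u" for u
  proof (cases "u \<in> ?Y")
    case True
    then show ?thesis by (auto simp: \<phi>_def indicator_def)
  next
    case False
    then have pos: "0 < infdist u ?Y" using Y by (simp add: infdist_pos_not_in_closed)
    obtain n :: nat where n: "2 < real n * infdist u ?Y" using reals_Archimedean3[OF pos] by blast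
    have "\<forall>\<^sub>F k in sequentially. indicator (X \<inter> interior (polar_cone C)) u = \<phi> k u"
      using eventually_ge_at_top[of n]
    proof eventually_elim
      case (elim k)
      have "real n * infdist u ?Y \<le> real (Suc k) * infdist u ?Y"
        using elim pos by (intro mult_right_mono) auto
      then show ?case using n False by (auto simp: \<phi>_def indicator_def)
    qed
    then show ?thesis by (rule Lim_transform_eventually[OF tendsto_const])
  qed
  ultimately show ?thesis by blast
qed

end

section \<open>Density estimates and convergence of the approximate solutions\<close>

context cone_measure
begin

text \<open>The sets at distance at least \<open>1 / (n + 1)\<close> from the complement exhaust the
  interior of the cone; if all were null, so would be the whole measure.\<close>

lemma mass_on_inner_part:
  "\<exists>r>0. \<exists>K\<in>sets borel. 0 < measure \<sigma> K \<and> (\<forall>v\<in>K. ball v r \<subseteq> C)"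
proof (rule ccontr)
  assume contra: "\<not> ?thesis"
  let ?Y = "- interior C"
  define K where "K n = {v. inverse (real (Suc n)) \<le> infdist v ?Y}" for n
  have K: "K n \<in> sets borel" for n
    unfolding K_def by (intro borel_closed closed_Collect_le continuous_intros)
  have ball: "ball v (inverse (real (Suc n))) \<subseteq> C" if "v \<in> K n" for v n
  proof
    fix y assume y: "y \<in> ball v (inverse (real (Suc n)))"
    have "y \<notin> ?Y"
    proof
      assume "y \<in> ?Y"
      then have "infdist v ?Y \<le> dist v y" by (rule infdist_le)
      then show False using y that by (simp add: K_def)
    qed
    then show "y \<in> C" using interior_subset by blast
  qed
  have "K n \<in> null_sets \<sigma>" for n
  proof -
    have "\<not> 0 < measure \<sigma> (K n)" using contra K ball by (metis inverse_positive_iff_positive of_nat_0_less_iff zero_less_Suc)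
    then have "measure \<sigma> (K n) = 0" by (simp add: zero_less_measure_iff)
    then show ?thesis using K sets_sigma by (simp add: null_sets_def emeasure_eq_measure)
  qed
  then have "AE v in \<sigma>. \<forall>n. v \<notin> K n" by (simp add: AE_all_countable AE_not_in)
  then have "AE v in \<sigma>. v \<notin> space \<sigma>"
    using AE_Omega
  proof eventually_elim
    case (elim v)
    have "0 < infdist v ?Y"
      using OmegaD(2)[OF elim(2)] zero_notin_interior
      by (intro infdist_pos_not_in_closed) auto
    then obtain n where "inverse (real (Suc n)) < infdist v ?Y" using reals_Archimedean by blast
    then have "v \<in> K n" by (simp add: K_def)
    then show ?case using elim(1) by blast
  qed
  then have "space \<sigma> \<in> null_sets \<sigma>" by (subst AE_iff_null_sets) auto
  then show False using sigma_nonzero by (simp add: null_sets_def measure_def)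
qed

text \<open>The ball about the direction bounds the inner product from below, and
  \<open>N v \<le> 1 / H\<close> bounds the power of \<open>N v\<close>, whose exponent
  \<open>p - q\<close> is negative.\<close>

lemma pq_density_lower:
  assumes pq: "p < q" and H: "0 < H" and N: "gauge_fun (1 / H) (1 / H) N" and v: "v \<in> Omega C"
    and normal: "normal_at N v (\<alpha> v)" and r: "0 < r" "ball v r \<subseteq> C"
  shows "r powr \<bar>p\<bar> * H powr (q - p) \<le> pq_density p q N \<alpha> v"
proof -
  have v': "norm v = 1" "v \<in> interior C" using OmegaD[OF v] by auto
  have u: "norm (\<alpha> v) = 1" "\<alpha> v \<in> polar_cone C" using normal by (auto simp: normal_at_def)
  have "r \<le> - (\<alpha> v \<bullet> v)" using inner_polar_cone_ball[OF r u(2,1)] .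
  then have 1: "r powr \<bar>p\<bar> \<le> (- (\<alpha> v \<bullet> v)) powr (- p)"
    using powr_bounds(1)[OF r(1), of _ "- p" "\<bar>p\<bar>"] neg_inner_le_1[OF u(1) v'(1)] by simp
  have "0 < N v" using gauge_fun_pos[OF N _ v'(2)] H by simp
  moreover have "N v \<le> 1 / H" using gauge_funD(4)[OF N v'(2)] v' by simp
  ultimately have "(1 / H) powr (p - q) \<le> N v powr (p - q)"
    using pq by (intro powr_mono2') auto
  moreover have "(1 / H) powr (p - q) = H powr (q - p)"
    using H by (simp add: powr_divide powr_minus[symmetric] powr_diff field_simps)
  ultimately show ?thesis unfolding pq_density_def using 1 by (intro mult_mono) auto
qed

text \<open>Here the ball lies about the normal, inside the polar cone. It gives
  \<open>d \<le> - (\<alpha> v \<bullet> v)\<close> and, through \<open>low\<close>, also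
  \<open>d / H \<le> N v\<close>.\<close>

lemma pq_density_upper:
  assumes pq: "p < q" and H: "0 < H" and v: "v \<in> Omega C" and normal: "normal_at N v (\<alpha> v)"
    and low: "- (\<alpha> v \<bullet> v) / H \<le> N v" and d: "0 < d" "ball (\<alpha> v) d \<subseteq> polar_cone C"
  shows "pq_density p q N \<alpha> v \<le> d powr (- \<bar>p\<bar>) * (d / H) powr (p - q)"
proof -
  have v': "norm v = 1" "v \<in> C" using OmegaD[OF v] by auto
  have u: "norm (\<alpha> v) = 1" using normal by (auto simp: normal_at_def)
  have d': "d \<le> - (\<alpha> v \<bullet> v)" using inner_ball_polar_cone[OF d v'(2)] v' by simp
  then have 1: "(- (\<alpha> v \<bullet> v)) powr (- p) \<le> d powr (- \<bar>p\<bar>)"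
    using powr_bounds(2)[OF d(1), of _ "- p" "\<bar>p\<bar>"] neg_inner_le_1[OF u v'(1)] by simp
  have "d / H \<le> - (\<alpha> v \<bullet> v) / H" using d' H by (intro divide_right_mono) auto
  then have "d / H \<le> N v" using low by linarith
  then have "N v powr (p - q) \<le> (d / H) powr (p - q)"
    using pq d H by (intro powr_mono2') auto
  then show ?thesis unfolding pq_density_def using 1 by (intro mult_mono) auto
qed

lemma test_integrand_upper:
  assumes pq: "p < q" and H: "0 < H" and \<phi>: "polar_test d \<phi>"
    and \<alpha>: "\<forall>v\<in>Omega C. \<alpha> v \<in> Omega (polar_cone C) \<and> normal_at N v (\<alpha> v) \<and> - (\<alpha> v \<bullet> v) / H \<le> N v"
  shows "AE v in \<sigma>. ennreal (\<phi> (\<alpha> v)) * ennreal (pq_density p q N \<alpha> v)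
    \<le> ennreal (d powr (- \<bar>p\<bar>) * (d / H) powr (p - q))"
  using AE_Omega
proof eventually_elim
  case (elim v)
  note d = polar_testD(1)[OF \<phi>] and \<phi>' = polar_testD(3,4)[OF \<phi>, of "\<alpha> v"]
  show ?case
  proof (cases "\<phi> (\<alpha> v) = 0")
    case False
    then have "ball (\<alpha> v) d \<subseteq> polar_cone C" by (rule polar_testD(5)[OF \<phi>])
    then have "pq_density p q N \<alpha> v \<le> d powr (- \<bar>p\<bar>) * (d / H) powr (p - q)"
      using \<alpha> elim d by (intro pq_density_upper[OF pq H elim]) auto
    moreover have "0 \<le> pq_density p q N \<alpha> v" by (simp add: pq_density_def)
    ultimately have "\<phi> (\<alpha> v) * pq_density p q N \<alpha> v \<le> 1 * (d powr (- \<bar>p\<bar>) * (d / H) powr (p - q))"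
      using \<phi>' by (intro mult_mono) auto
    then show ?thesis using \<phi>' by (simp add: ennreal_mult'[symmetric] ennreal_leI)
  qed simp
qed

text \<open>Off the null cone \<open>E\<close> the map \<open>\<alpha>\<close> gives the only
  normal; from these data the reverse radial Gauss image can be read off up to null sets.\<close>

theorem limit_solution:
  fixes \<mu> :: "'a measure" and p q :: real
  assumes fin: "finite_measure \<mu>" and sets_mu: "sets \<mu> = sets (restrict_space borel (Omega (polar_cone C)))"
    and nz: "emeasure \<mu> (Omega (polar_cone C)) \<noteq> 0" and pq: "p < q"
  shows "\<exists>b B N \<alpha> E. 0 < b \<and> gauge_fun b B N \<and> \<alpha> \<in> borel_measurable borel \<and>
    E \<in> sets borel \<and> emeasure lborel E = 0 \<and> (\<forall>x\<in>E. \<forall>t>0. t *\<^sub>R x \<in> E) \<and>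
    (\<forall>v\<in>Omega C - E. normal_at N v (\<alpha> v) \<and> (\<forall>u. normal_at N v u \<longrightarrow> u = \<alpha> v)) \<and>
    (\<forall>\<eta>\<in>sets \<mu>. emeasure \<mu> \<eta> = (\<integral>\<^sup>+v. indicator \<eta> (\<alpha> v) * ennreal (pq_density p q N \<alpha> v) \<partial>\<sigma>))"
proof -
  let ?P = "Omega (polar_cone C)"
  interpret mu: finite_measure \<mu> by fact
  have P_borel [measurable]: "?P \<in> sets borel" unfolding Omega_def by simp
  have C_borel [measurable]: "Omega C \<in> sets borel" unfolding Omega_def by simp
  have space_mu: "space \<mu> = ?P" using sets_eq_imp_space_eq[OF sets_mu] by (simp add: space_restrict_space)
  have to_mu: "f \<in> measurable \<mu> L" if "f \<in> measurable borel L" for f :: "'a \<Rightarrow> 'b" and L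
    using measurable_restrict_space1[OF that, of ?P] measurable_cong_sets[OF sets_mu refl] by blast
  have "bounded ?P" unfolding Omega_def by (rule bounded_subset[OF bounded_cball[of 0 1]]) auto
  then have "\<forall>j. \<exists>T\<in>borel_measurable borel. finite (T ` ?P) \<and> T ` ?P \<subseteq> ?P \<and>
      (\<forall>u\<in>?P. dist u (T u) < inverse (real (Suc j)))"
    by (intro allI finite_range_approximation) auto
  then obtain T where T_borel [measurable]: "\<And>j. T j \<in> borel_measurable borel"
    and T_fin: "\<And>j. finite (T j ` ?P)" and T_sub: "\<And>j. T j ` ?P \<subseteq> ?P"
    and T_dist: "\<And>j u. u \<in> ?P \<Longrightarrow> dist u (T j u) < inverse (real (Suc j))"
    by metis
  have T_mu: "T j \<in> borel_measurable \<mu>" for j by (rule to_mu[OF T_borel])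
  have T_lim: "(\<lambda>j. T j u) \<longlonglongrightarrow> u" if u: "u \<in> ?P" for u
  proof (rule iffD2[OF tendsto_dist_iff], rule tendsto_sandwich[OF _ _ tendsto_const LIMSEQ_inverse_real_of_nat])
    show "\<forall>\<^sub>F j in sequentially. dist (T j u) u \<le> inverse (real (Suc j))"
      using T_dist[OF u] by (intro always_eventually allI) (simp add: dist_commute less_imp_le del: of_nat_Suc)
  qed simp
  define Q where "Q j H N \<alpha> \<longleftrightarrow> 0 < H \<and> gauge_fun (1 / H) (1 / H) N \<and> \<alpha> \<in> borel_measurable borel \<and>
    (\<forall>v\<in>Omega C. \<alpha> v \<in> ?P \<and> normal_at N v (\<alpha> v) \<and> - (\<alpha> v \<bullet> v) / H \<le> N v) \<and>
    (\<forall>f :: 'a \<Rightarrow> ennreal.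
       (\<integral>\<^sup>+v. f (\<alpha> v) * ennreal (pq_density p q N \<alpha> v) \<partial>\<sigma>) = (\<integral>\<^sup>+u. f (T j u) \<partial>\<mu>))"
    for j H N \<alpha>
  have "\<forall>j. \<exists>H N \<alpha>. Q j H N \<alpha>"
    unfolding Q_def using nz T_fin T_sub
    by (intro allI finite_range_solution[OF fin _ pq T_mu]) (auto simp: space_mu)
  then obtain H N \<alpha> where Q: "\<And>j. Q j (H j) (N j) (\<alpha> j)" by metis
  have H: "0 < H j" and N: "gauge_fun (1 / H j) (1 / H j) (N j)"
    and \<alpha>_borel [measurable]: "\<alpha> j \<in> borel_measurable borel"
    and \<alpha>: "\<forall>v\<in>Omega C. \<alpha> j v \<in> ?P \<and> normal_at (N j) v (\<alpha> j v) \<and> - (\<alpha> j v \<bullet> v) / H j \<le> N j v"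
    and eq: "(\<integral>\<^sup>+v. f (\<alpha> j v) * ennreal (pq_density p q (N j) (\<alpha> j) v) \<partial>\<sigma>) = (\<integral>\<^sup>+u. f (T j u) \<partial>\<mu>)"
    for j and f :: "'a \<Rightarrow> ennreal"
    using Q[of j] unfolding Q_def by blast+
  have N_borel [measurable]: "N j \<in> borel_measurable borel" for j by (rule gauge_funD(1)[OF N])
  have dens_borel [measurable]: "pq_density p q (N j) (\<alpha> j) \<in> borel_measurable borel" for j
    unfolding pq_density_def by measurable
  have \<phi>_borel: "\<phi> \<in> borel_measurable borel" if "polar_test d \<phi>" for d \<phi>
    using that by (auto simp: polar_test_def intro: borel_measurable_continuous_onI)
  \<comment> \<open>The maps \<open>T j\<close> move points by less than \<open>1 / (j + 1)\<close>,
    so the discretised measures converge to \<open>\<mu>\<close> against bounded continuous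
    tests.\<close>
  have mu_lim: "(\<lambda>j. \<integral>\<^sup>+u. ennreal (\<phi> (T j u)) \<partial>\<mu>) \<longlonglongrightarrow> (\<integral>\<^sup>+u. ennreal (\<phi> u) \<partial>\<mu>)"
    if \<phi>: "polar_test d \<phi>" for d \<phi>
  proof (rule nn_integral_dominated_convergence[where w="\<lambda>_. 1"])
    note [measurable] = \<phi>_borel[OF \<phi>]
    show "(\<lambda>u. ennreal (\<phi> (T j u))) \<in> borel_measurable \<mu>" for j by (rule to_mu) measurable
    show "(\<lambda>u. ennreal (\<phi> u)) \<in> borel_measurable \<mu>" by (rule to_mu) measurable
    show "AE u in \<mu>. ennreal (\<phi> (T j u)) \<le> 1" for j using polar_testD(4)[OF \<phi>] by (intro AE_I2) simp
    show "(\<integral>\<^sup>+u. 1 \<partial>\<mu>) < \<infinity>" by (simp add: mu.emeasure_eq_measure)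
    show "AE u in \<mu>. (\<lambda>j. ennreal (\<phi> (T j u))) \<longlonglongrightarrow> ennreal (\<phi> u)"
    proof (rule AE_I2)
      fix u assume "u \<in> space \<mu>"
      then have "(\<lambda>j. T j u) \<longlonglongrightarrow> u" using T_lim space_mu by simp
      then have "(\<lambda>j. \<phi> (T j u)) \<longlonglongrightarrow> \<phi> u" by (rule isCont_tendsto_compose[OF polar_testD(2)[OF \<phi>]])
      then show "(\<lambda>j. ennreal (\<phi> (T j u))) \<longlonglongrightarrow> ennreal (\<phi> u)" by (rule tendsto_ennrealI)
    qed
  qed simp

  \<comment> \<open>The total mass of the discretised measures is fixed, whereas on \<open>K\<close>
    the density is at least a constant times \<open>H j powr (q - p)\<close>, with positive
    exponent.\<close>
  have "\<exists>H1. \<forall>j. H j \<le> H1"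
  proof -
    obtain r K where r: "0 < r" and K: "K \<in> sets borel" "0 < measure \<sigma> K" "\<And>v. v \<in> K \<Longrightarrow> ball v r \<subseteq> C"
      using mass_on_inner_part by blast
    let ?M = "measure \<mu> (space \<mu>)"
    let ?c = "r powr \<bar>p\<bar> * measure \<sigma> K"
    have c: "0 < ?c" using r K(2) by simp
    have "H j \<le> (?M / ?c) powr (1 / (q - p))" for j
    proof -
      have "ennreal (r powr \<bar>p\<bar> * H j powr (q - p) * measure \<sigma> K)
          = (\<integral>\<^sup>+v. ennreal (r powr \<bar>p\<bar> * H j powr (q - p)) * indicator K v \<partial>\<sigma>)"
        using K(1) sets_sigma by (subst nn_integral_cmult_indicator) (auto simp: emeasure_eq_measure ennreal_mult)
      also have "\<dots> \<le> (\<integral>\<^sup>+v. 1 * ennreal (pq_density p q (N j) (\<alpha> j) v) \<partial>\<sigma>)"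
      proof (rule nn_integral_mono_AE)
        show "AE v in \<sigma>. ennreal (r powr \<bar>p\<bar> * H j powr (q - p)) * indicator K v
            \<le> 1 * ennreal (pq_density p q (N j) (\<alpha> j) v)"
          using AE_Omega
        proof eventually_elim
          case (elim v)
          show ?case
          proof (cases "v \<in> K")
            case True
            have "r powr \<bar>p\<bar> * H j powr (q - p) \<le> pq_density p q (N j) (\<alpha> j) v"
              using \<alpha> elim by (intro pq_density_lower[OF pq H N elim _ r K(3)[OF True]]) auto
            then show ?thesis using True by (simp add: ennreal_leI)
          qed simp
        qed
      qed
      also have "\<dots> = ennreal ?M" using eq[of "\<lambda>_. 1" j] by (simp add: mu.emeasure_eq_measure)
      finally have "r powr \<bar>p\<bar> * H j powr (q - p) * measure \<sigma> K \<le> ?M" by (simp add: ennreal_le_iff)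
      then have le: "H j powr (q - p) \<le> ?M / ?c" using c by (simp add: pos_le_divide_eq mult_ac)
      have "H j = (H j powr (q - p)) powr (1 / (q - p))" using H[of j] pq by (simp add: powr_powr)
      also have "\<dots> \<le> (?M / ?c) powr (1 / (q - p))" using le pq by (intro powr_mono2) auto
      finally show ?thesis .
    qed
    then show ?thesis by blast
  qed
  then obtain H1 where H1: "\<And>j. H j \<le> H1" by blast
  have H1_pos: "0 < H1" using H[of 0] H1[of 0] by linarith

  \<comment> \<open>Some test function has positive integral against \<open>\<mu>\<close>; let
    \<open>c\<close> be a positive number below it. For large \<open>j\<close> the discretised
    integral exceeds \<open>c\<close>, while the upper estimate bounds it by a constant times
    \<open>H j powr (q - p)\<close>.\<close>
  have "\<exists>H0>0. \<forall>\<^sub>F j in sequentially. H0 \<le> H j"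
  proof -
    obtain \<phi> where \<phi>: "\<And>k. polar_test (inverse (real (Suc k))) (\<phi> k)"
      and lim: "\<And>u. (\<lambda>k. \<phi> k u) \<longlonglongrightarrow> indicator (UNIV \<inter> interior (polar_cone C)) u"
      using polar_test_sequence[OF open_UNIV] by blast
    have "(\<lambda>k. \<integral>\<^sup>+u. ennreal (\<phi> k u) \<partial>\<mu>) \<longlonglongrightarrow> (\<integral>\<^sup>+u. 1 \<partial>\<mu>)"
    proof (rule nn_integral_dominated_convergence[where w="\<lambda>_. 1"])
      show "(\<lambda>u. ennreal (\<phi> k u)) \<in> borel_measurable \<mu>" for k
        using \<phi>_borel[OF \<phi>[of k]] by (intro to_mu) measurable
      show "AE u in \<mu>. ennreal (\<phi> j u) \<le> 1" for j
        using polar_testD(4)[OF \<phi>[of j]] by (intro AE_I2) simp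
      show "(\<integral>\<^sup>+u. 1 \<partial>\<mu>) < \<infinity>" by (simp add: mu.emeasure_eq_measure)
      show "AE u in \<mu>. (\<lambda>j. ennreal (\<phi> j u)) \<longlonglongrightarrow> 1"
      proof (rule AE_I2)
        fix u assume "u \<in> space \<mu>"
        then have "u \<in> interior (polar_cone C)" using OmegaD(2) space_mu by blast
        then show "(\<lambda>j. ennreal (\<phi> j u)) \<longlonglongrightarrow> 1"
          using tendsto_ennrealI[OF lim[of u]] by simp
      qed
    qed auto
    moreover have "0 < (\<integral>\<^sup>+u. 1 \<partial>\<mu>)" using nz space_mu by (simp add: zero_less_iff_neq_zero)
    ultimately have "\<forall>\<^sub>F k in sequentially. 0 < (\<integral>\<^sup>+u. ennreal (\<phi> k u) \<partial>\<mu>)" by (rule order_tendstoD)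
    then obtain k where k: "0 < (\<integral>\<^sup>+u. ennreal (\<phi> k u) \<partial>\<mu>)" by (auto simp: eventually_sequentially)
    define d where "d = inverse (real (Suc k))"
    have test: "polar_test d (\<phi> k)" unfolding d_def by (rule \<phi>)
    have d: "0 < d" by (simp add: d_def)
    obtain c where c: "0 < c" "ennreal c < (\<integral>\<^sup>+u. ennreal (\<phi> k u) \<partial>\<mu>)"
      using dense[OF k] by (metis ennreal_cases ennreal_less_zero_iff infinity_ennreal_def not_top_less top.not_eq_extremum)
    let ?D = "d powr (- \<bar>p\<bar>) * d powr (p - q) * measure \<sigma> (space \<sigma>)"
    have D: "0 < ?D" using d sigma_nonzero by (simp add: zero_less_measure_iff)
    have bound: "(c / ?D) powr (1 / (q - p)) \<le> H j" if "ennreal c < (\<integral>\<^sup>+u. ennreal (\<phi> k (T j u)) \<partial>\<mu>)" for j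
    proof -
      have "ennreal c \<le> (\<integral>\<^sup>+v. ennreal (\<phi> k (\<alpha> j v)) * ennreal (pq_density p q (N j) (\<alpha> j) v) \<partial>\<sigma>)"
        using that eq[of "\<lambda>u. ennreal (\<phi> k u)" j] by simp
      also have "\<dots> \<le> (\<integral>\<^sup>+v. ennreal (d powr (- \<bar>p\<bar>) * (d / H j) powr (p - q)) \<partial>\<sigma>)"
        by (rule nn_integral_mono_AE[OF test_integrand_upper[OF pq H test \<alpha>]])
      also have "\<dots> = ennreal (d powr (- \<bar>p\<bar>) * (d / H j) powr (p - q) * measure \<sigma> (space \<sigma>))"
        by (simp add: emeasure_eq_measure ennreal_mult)
      also have "(d / H j) powr (p - q) = d powr (p - q) * H j powr (q - p)"
        using d H[of j] by (simp add: powr_divide powr_diff field_simps)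
      finally have "c \<le> ?D * H j powr (q - p)"
        using D by (simp add: ennreal_le_iff mult_ac)
      then have "c / ?D \<le> H j powr (q - p)" using D by (simp add: pos_divide_le_eq mult_ac)
      then have "(c / ?D) powr (1 / (q - p)) \<le> (H j powr (q - p)) powr (1 / (q - p))"
        using c(1) D pq by (intro powr_mono2) auto
      also have "\<dots> = H j" using H[of j] pq by (simp add: powr_powr)
      finally show ?thesis .
    qed
    have "\<forall>\<^sub>F j in sequentially. ennreal c < (\<integral>\<^sup>+u. ennreal (\<phi> k (T j u)) \<partial>\<mu>)"
      by (rule order_tendstoD(1)[OF mu_lim[OF test] c(2)])
    then have "\<forall>\<^sub>F j in sequentially. (c / ?D) powr (1 / (q - p)) \<le> H j"
      by (rule eventually_mono) (rule bound)
    moreover have "0 < (c / ?D) powr (1 / (q - p))" using c(1) d sigma_nonzero by simp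
    ultimately show ?thesis by blast
  qed
  then obtain H0 j0 where H0: "0 < H0" "\<And>j. j0 \<le> j \<Longrightarrow> H0 \<le> H j"
    by (auto simp: eventually_sequentially)

  \<comment> \<open>The lower bound for \<open>H\<close> holds only from \<open>j0\<close> on, hence
    the shifted sequence.\<close>
  have "gauge_fun (1 / H1) (1 / H0) (N (j + j0))" for j
  proof (rule gauge_fun_weaken[OF N])
    show "1 / H1 \<le> 1 / H (j + j0)" using H H1 by (intro divide_left_mono mult_pos_pos H1_pos) auto
    show "1 / H (j + j0) \<le> 1 / H0" using H0 H by (intro divide_left_mono mult_pos_pos) auto
  qed
  from gauge_fun_subsequence[where N="\<lambda>j. N (j + j0)", OF this] H1_pos H0(1)
  obtain k M where k: "strict_mono (k :: nat \<Rightarrow> nat)" and M: "gauge_fun (1 / H1) (1 / H0) M"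
    and M_lim: "\<And>x. x \<in> interior C \<Longrightarrow> (\<lambda>j. N (k j + j0) x) \<longlonglongrightarrow> M x"
    by auto
  define s where "s j = k j + j0" for j
  have s: "strict_mono s" using k by (simp add: s_def strict_mono_def)
  have M_pos: "0 < M x" if "x \<in> interior C" for x by (rule gauge_fun_pos[OF M _ that]) (simp add: H1_pos)
  obtain E where E: "E \<in> sets borel" "emeasure lborel E = 0" "\<forall>x\<in>E. \<forall>t>0. t *\<^sub>R x \<in> E"
    and E_unique: "\<forall>x\<in>interior C - E. \<forall>u w. normal_at M x u \<longrightarrow> normal_at M x w \<longrightarrow> u = w"
    using normals_unique_AE[OF M] H1_pos by auto
  have [measurable]: "E \<in> sets borel" by (rule E(1))
  have normal_lim: "\<exists>w. normal_at M v w \<and> (\<lambda>j. \<alpha> (s j) v) \<longlonglongrightarrow> w" if v: "v \<in> Omega C - E" for v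
  proof (rule normal_at_tendsto)
    show "(\<lambda>j. N (s j) y) \<longlonglongrightarrow> M y" if "y \<in> interior C" for y unfolding s_def by (rule M_lim[OF that])
    show vi: "v \<in> interior C" using v OmegaD(2) by blast
    show "normal_at (N (s j)) v (\<alpha> (s j) v)" for j using \<alpha> v by blast
    show "u = w" if "normal_at M v u" "normal_at M v w" for u w using E_unique vi v that by blast
  qed
  \<comment> \<open>Limits are known on \<open>Omega C - E\<close> only; the default 0 elsewhere
    makes \<open>\<beta>\<close> a pointwise limit of Borel functions.\<close>
  define \<beta> where "\<beta> v = (if v \<in> Omega C - E then lim (\<lambda>j. \<alpha> (s j) v) else 0)" for v
  have \<beta>: "normal_at M v (\<beta> v)" "(\<lambda>j. \<alpha> (s j) v) \<longlonglongrightarrow> \<beta> v" if v: "v \<in> Omega C - E" for v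
  proof -
    obtain w where w: "normal_at M v w" "(\<lambda>j. \<alpha> (s j) v) \<longlonglongrightarrow> w" using normal_lim[OF v] by blast
    then have "\<beta> v = w" using v by (simp add: \<beta>_def limI)
    with w show "normal_at M v (\<beta> v)" "(\<lambda>j. \<alpha> (s j) v) \<longlonglongrightarrow> \<beta> v" by auto
  qed
  have \<beta>_borel [measurable]: "\<beta> \<in> borel_measurable borel"
  proof (rule borel_measurable_LIMSEQ_metric)
    show "(\<lambda>v. if v \<in> Omega C - E then \<alpha> (s j) v else 0) \<in> borel_measurable borel" for j by measurable
    show "(\<lambda>j. if v \<in> Omega C - E then \<alpha> (s j) v else 0) \<longlonglongrightarrow> \<beta> v" for v
    proof (cases "v \<in> Omega C - E")
      case True
      show ?thesis using \<beta>(2)[OF True] True by simp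
    next
      case False
      then have "\<beta> v = 0" unfolding \<beta>_def by (rule if_not_P)
      then show ?thesis using False by (simp only: if_False tendsto_const)
    qed
  qed
  have M_borel [measurable]: "M \<in> borel_measurable borel" by (rule gauge_funD(1)[OF M])
  define g where "g v = pq_density p q M \<beta> v" for v
  have g_borel [measurable]: "g \<in> borel_measurable borel"
    unfolding g_def pq_density_def by measurable
  have AE_E: "AE v in \<sigma>. v \<in> Omega C - E"
    using AE_Omega AE_notin_conic_null[OF E(1,2)] E(3) by auto

  have test_eq: "(\<integral>\<^sup>+v. ennreal (\<phi> (\<beta> v)) * ennreal (g v) \<partial>\<sigma>) = (\<integral>\<^sup>+u. ennreal (\<phi> u) \<partial>\<mu>)"
    if \<phi>: "polar_test d \<phi>" for d \<phi>
  proof (rule LIMSEQ_unique)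
    note [measurable] = \<phi>_borel[OF \<phi>]
    have d: "0 < d" by (rule polar_testD(1)[OF \<phi>])
    let ?u = "\<lambda>j v. ennreal (\<phi> (\<alpha> (s j) v)) * ennreal (pq_density p q (N (s j)) (\<alpha> (s j)) v)"
    show "(\<lambda>j. \<integral>\<^sup>+v. ?u j v \<partial>\<sigma>) \<longlonglongrightarrow> (\<integral>\<^sup>+v. ennreal (\<phi> (\<beta> v)) * ennreal (g v) \<partial>\<sigma>)"
    proof (rule nn_integral_dominated_convergence[where w="\<lambda>_. ennreal (d powr (- \<bar>p\<bar>) * (d / H1) powr (p - q))"])
      \<comment> \<open>The bound for test integrands grows with \<open>H\<close>, because
        \<open>p - q\<close> is negative; thus \<open>H1\<close> gives one dominating
        constant.\<close>
      show "AE v in \<sigma>. ?u j v \<le> ennreal (d powr (- \<bar>p\<bar>) * (d / H1) powr (p - q))" for j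
        using test_integrand_upper[OF pq H[of "s j"] \<phi> \<alpha>[of "s j"]]
      proof eventually_elim
        case (elim v)
        note elim
        also have "ennreal (d powr (- \<bar>p\<bar>) * (d / H (s j)) powr (p - q))
            \<le> ennreal (d powr (- \<bar>p\<bar>) * (d / H1) powr (p - q))"
          using d pq H H1 H1_pos by (intro ennreal_leI mult_left_mono powr_mono2' divide_left_mono mult_pos_pos) auto
        finally show ?case .
      qed
      show "(\<integral>\<^sup>+v. ennreal (d powr (- \<bar>p\<bar>) * (d / H1) powr (p - q)) \<partial>\<sigma>) < \<infinity>"
        by (simp add: emeasure_eq_measure ennreal_mult_less_top)
      show "AE v in \<sigma>. (\<lambda>j. ?u j v) \<longlonglongrightarrow> ennreal (\<phi> (\<beta> v)) * ennreal (g v)"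
        using AE_E
      proof eventually_elim
        case (elim v)
        have vi: "v \<in> interior C" using elim OmegaD(2) by blast
        have nz1: "- (\<beta> v \<bullet> v) \<noteq> 0"
          using inner_interior_polar_neg[OF vi, of "\<beta> v"] \<beta>(1)[OF elim] by (force simp: normal_at_def)
        have nz2: "M v \<noteq> 0" using M_pos[OF vi] by simp
        have lim1: "(\<lambda>j. \<phi> (\<alpha> (s j) v)) \<longlonglongrightarrow> \<phi> (\<beta> v)"
          by (rule isCont_tendsto_compose[OF polar_testD(2)[OF \<phi>] \<beta>(2)[OF elim]])
        have limM: "(\<lambda>j. N (s j) v) \<longlonglongrightarrow> M v" unfolding s_def by (rule M_lim[OF vi])
        have lim2: "(\<lambda>j. pq_density p q (N (s j)) (\<alpha> (s j)) v) \<longlonglongrightarrow> g v"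
          unfolding g_def pq_density_def
          by (intro tendsto_mult tendsto_powr tendsto_minus tendsto_inner \<beta>(2)[OF elim] limM tendsto_const nz1 nz2)
        have nn: "0 \<le> pq_density p q N' a' v'" for N' a' and v' :: 'a by (simp add: pq_density_def)
        have "(\<lambda>j. ennreal (\<phi> (\<alpha> (s j) v) * pq_density p q (N (s j)) (\<alpha> (s j)) v)) \<longlonglongrightarrow> ennreal (\<phi> (\<beta> v) * g v)"
          by (intro tendsto_ennrealI tendsto_mult lim1 lim2)
        then show ?case using polar_testD(3)[OF \<phi>] nn by (simp add: ennreal_mult g_def)
      qed
    qed measurable
    have "(\<lambda>j. \<integral>\<^sup>+u. ennreal (\<phi> (T (s j) u)) \<partial>\<mu>) \<longlonglongrightarrow> (\<integral>\<^sup>+u. ennreal (\<phi> u) \<partial>\<mu>)"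
      using LIMSEQ_subseq_LIMSEQ[OF mu_lim[OF \<phi>] s] by (simp add: o_def)
    then show "(\<lambda>j. \<integral>\<^sup>+v. ?u j v \<partial>\<sigma>) \<longlonglongrightarrow> (\<integral>\<^sup>+u. ennreal (\<phi> u) \<partial>\<mu>)"
      by (simp only: eq[of "\<lambda>u. ennreal (\<phi> u)"])
  qed

  \<comment> \<open>Both measures are moved to the Borel sets of the whole space, which the open
    sets generate. The factor \<open>indicator ?P\<close> removes directions whose limit normal lies
    on the boundary of the polar cone.\<close>
  define \<nu>1 where "\<nu>1 = distr \<mu> borel (\<lambda>u. u)"
  define \<nu>2 where "\<nu>2 = distr (density \<sigma> (\<lambda>v. indicator ?P (\<beta> v) * ennreal (g v))) borel \<beta>"
  have id_mu: "(\<lambda>u. u) \<in> measurable \<mu> borel" by (rule to_mu) simp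
  have \<nu>1: "emeasure \<nu>1 X = emeasure \<mu> (X \<inter> ?P)" if "X \<in> sets borel" for X
    using that by (simp add: \<nu>1_def emeasure_distr[OF id_mu] space_mu)
  have \<nu>2: "emeasure \<nu>2 X = (\<integral>\<^sup>+v. indicator (X \<inter> ?P) (\<beta> v) * ennreal (g v) \<partial>\<sigma>)"
    if X [measurable]: "X \<in> sets borel" for X
  proof -
    have "emeasure \<nu>2 X = emeasure (density \<sigma> (\<lambda>v. indicator ?P (\<beta> v) * ennreal (g v))) (\<beta> -` X \<inter> space \<sigma>)"
      unfolding \<nu>2_def by (subst emeasure_distr) auto
    also have "\<dots> = (\<integral>\<^sup>+v. indicator ?P (\<beta> v) * ennreal (g v) * indicator (\<beta> -` X \<inter> space \<sigma>) v \<partial>\<sigma>)"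
      by (rule emeasure_density) measurable
    also have "\<dots> = (\<integral>\<^sup>+v. indicator (X \<inter> ?P) (\<beta> v) * ennreal (g v) \<partial>\<sigma>)"
      by (intro nn_integral_cong) (auto simp: indicator_def)
    finally show ?thesis .
  qed
  have "\<nu>1 = \<nu>2"
  proof (rule measure_eqI_generator_eq[where \<Omega>=UNIV and E="{S. open S}" and A="\<lambda>_. UNIV"])
    show "sets \<nu>1 = sigma_sets UNIV {S. open S}" "sets \<nu>2 = sigma_sets UNIV {S. open S}"
      by (simp_all add: \<nu>1_def \<nu>2_def borel_def)
    show "emeasure \<nu>1 UNIV \<noteq> \<infinity>" by (simp add: \<nu>1 mu.emeasure_eq_measure)
    fix X :: "'a set" assume "X \<in> {S. open S}"
    then have X: "open X" "X \<in> sets borel" by auto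
    obtain \<phi> where \<phi>: "\<And>k. polar_test (inverse (real (Suc k))) (\<phi> k)" and inc: "\<And>u. incseq (\<lambda>k. \<phi> k u)"
      and lim: "\<And>u. (\<lambda>k. \<phi> k u) \<longlonglongrightarrow> indicator (X \<inter> interior (polar_cone C)) u"
      using polar_test_sequence[OF X(1)] by blast
    have [measurable]: "\<phi> k \<in> borel_measurable borel" for k by (rule \<phi>_borel[OF \<phi>])
    have incm: "\<phi> k u \<le> \<phi> l u" if "k \<le> l" for k l u using inc that by (simp add: incseq_def)
    let ?X = "X \<inter> interior (polar_cone C)"
    have ind: "indicator ?X u = (indicator (X \<inter> ?P) u :: ennreal)" if "norm u = 1" for u :: 'a
      using that by (auto simp: indicator_def Omega_def)
    have lim': "(\<lambda>k. ennreal (\<phi> k u)) \<longlonglongrightarrow> indicator ?X u" for u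
      using tendsto_ennrealI[OF lim[of u]] by (simp add: ennreal_indicator)
    have 1: "(\<lambda>k. \<integral>\<^sup>+u. ennreal (\<phi> k u) \<partial>\<mu>) \<longlonglongrightarrow> (\<integral>\<^sup>+u. indicator ?X u \<partial>\<mu>)"
    proof (rule nn_integral_LIMSEQ)
      show "incseq (\<lambda>k u. ennreal (\<phi> k u))"
        using incm by (auto simp: incseq_def le_fun_def intro!: ennreal_leI)
      show "(\<lambda>u. ennreal (\<phi> k u)) \<in> borel_measurable \<mu>" for k by (rule to_mu) measurable
    qed (rule lim')
    also have "(\<integral>\<^sup>+u. indicator ?X u \<partial>\<mu>) = (\<integral>\<^sup>+u. indicator (X \<inter> ?P) u \<partial>\<mu>)"
      by (intro nn_integral_cong ind OmegaD(1)) (simp add: space_mu)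
    finally have 1: "(\<lambda>k. \<integral>\<^sup>+u. ennreal (\<phi> k u) \<partial>\<mu>) \<longlonglongrightarrow> (\<integral>\<^sup>+u. indicator (X \<inter> ?P) u \<partial>\<mu>)" .
    have "(\<lambda>k. \<integral>\<^sup>+v. ennreal (\<phi> k (\<beta> v)) * ennreal (g v) \<partial>\<sigma>)
        \<longlonglongrightarrow> (\<integral>\<^sup>+v. indicator ?X (\<beta> v) * ennreal (g v) \<partial>\<sigma>)"
    proof (rule nn_integral_LIMSEQ)
      show "incseq (\<lambda>k v. ennreal (\<phi> k (\<beta> v)) * ennreal (g v))"
        using incm by (auto simp: incseq_def le_fun_def intro!: mult_right_mono ennreal_leI)
      fix v
      have "(\<lambda>k. ennreal (\<phi> k (\<beta> v) * g v)) \<longlonglongrightarrow> ennreal (indicator ?X (\<beta> v) * g v)"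
        by (intro tendsto_ennrealI tendsto_mult_right lim)
      moreover have "0 \<le> g v" by (simp add: g_def pq_density_def)
      moreover have "0 \<le> \<phi> k (\<beta> v)" for k by (rule polar_testD(3)[OF \<phi>])
      ultimately show "(\<lambda>k. ennreal (\<phi> k (\<beta> v)) * ennreal (g v)) \<longlonglongrightarrow> indicator ?X (\<beta> v) * ennreal (g v)"
        by (simp add: ennreal_mult ennreal_indicator)
    qed measurable
    also have "(\<integral>\<^sup>+v. indicator ?X (\<beta> v) * ennreal (g v) \<partial>\<sigma>) = (\<integral>\<^sup>+v. indicator (X \<inter> ?P) (\<beta> v) * ennreal (g v) \<partial>\<sigma>)"
    proof (rule nn_integral_cong_AE)
      show "AE v in \<sigma>. indicator ?X (\<beta> v) * ennreal (g v) = indicator (X \<inter> ?P) (\<beta> v) * ennreal (g v)"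
        using AE_E
      proof eventually_elim
        case (elim v)
        have "norm (\<beta> v) = 1" using \<beta>(1)[OF elim] by (simp add: normal_at_def)
        then show ?case by (simp only: ind)
      qed
    qed
    finally have 2: "(\<lambda>k. \<integral>\<^sup>+v. ennreal (\<phi> k (\<beta> v)) * ennreal (g v) \<partial>\<sigma>)
        \<longlonglongrightarrow> (\<integral>\<^sup>+v. indicator (X \<inter> ?P) (\<beta> v) * ennreal (g v) \<partial>\<sigma>)" .
    have "(\<integral>\<^sup>+v. indicator (X \<inter> ?P) (\<beta> v) * ennreal (g v) \<partial>\<sigma>) = (\<integral>\<^sup>+u. indicator (X \<inter> ?P) u \<partial>\<mu>)"
      using LIMSEQ_unique[OF 1 2[unfolded test_eq[OF \<phi>]]] by simp
    also have "\<dots> = emeasure \<mu> (X \<inter> ?P)"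
      using X(2) by (intro nn_integral_indicator) (auto simp: sets_mu sets_restrict_space_iff)
    finally show "emeasure \<nu>1 X = emeasure \<nu>2 X" using X(2) by (simp add: \<nu>1 \<nu>2)
  qed (auto simp: Int_stable_def)
  have final: "emeasure \<mu> \<eta> = (\<integral>\<^sup>+v. indicator \<eta> (\<beta> v) * ennreal (pq_density p q M \<beta> v) \<partial>\<sigma>)"
    if "\<eta> \<in> sets \<mu>" for \<eta>
  proof -
    have \<eta>: "\<eta> \<in> sets borel" "\<eta> \<inter> ?P = \<eta>" using that by (auto simp: sets_mu sets_restrict_space_iff)
    have "emeasure \<mu> \<eta> = emeasure \<nu>1 \<eta>" using \<eta> by (simp add: \<nu>1)
    also have "\<dots> = emeasure \<nu>2 \<eta>" by (simp only: \<open>\<nu>1 = \<nu>2\<close>)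
    also have "\<dots> = (\<integral>\<^sup>+v. indicator \<eta> (\<beta> v) * ennreal (pq_density p q M \<beta> v) \<partial>\<sigma>)"
      using \<nu>2[OF \<eta>(1)] by (simp add: \<eta>(2) g_def)
    finally show ?thesis .
  qed
  have unique: "\<forall>v\<in>Omega C - E. normal_at M v (\<beta> v) \<and> (\<forall>u. normal_at M v u \<longrightarrow> u = \<beta> v)"
  proof (intro ballI conjI allI impI)
    fix v assume v: "v \<in> Omega C - E"
    show "normal_at M v (\<beta> v)" by (rule \<beta>(1)[OF v])
    show "u = \<beta> v" if "normal_at M v u" for u
      using E_unique v OmegaD(2) \<beta>(1)[OF v] that by blast
  qed
  have "0 < 1 / H1" using H1_pos by simp
  then show ?thesis using M \<beta>_borel E unique final by blast
qed

end

section \<open>The convex set determined by a gauge\<close>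

context pointed_cone_space
begin

text \<open>\<open>N\<close> is controlled on the interior of the cone only, so the points on the
  boundary of the cone are supplied by the closure.\<close>

definition gauge_body :: "('a \<Rightarrow> real) \<Rightarrow> 'a set" where
  "gauge_body N = closure {x \<in> interior C. 1 \<le> N x}"

context
  fixes b B :: real and N :: "'a \<Rightarrow> real"
  assumes N: "gauge_fun b B N" and b: "0 < b"
begin

text \<open>As \<open>c\<close> may lie on the boundary, a small part \<open>t *\<^sub>R x\<close>
  is added to it, which makes it interior. Superadditivity then applies at the cost of
  \<open>t * N x\<close>.\<close>

lemma gauge_mono:
  assumes x: "x \<in> interior C" and c: "c \<in> C"
  shows "N x \<le> N (x + c)"
proof (rule field_le_epsilon)
  fix e :: real assume e: "0 < e"
  have pos: "0 < N x" by (rule gauge_fun_pos[OF N b x])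
  define t where "t = min (1/2) (e / N x)"
  have t: "0 < t" "t < 1" "t * N x \<le> e" using e pos by (auto simp: t_def min_def field_simps)
  have 1: "(1 - t) *\<^sub>R x \<in> interior C" "t *\<^sub>R x + c \<in> interior C"
    using t x c by (auto intro!: interior_add interior_scaleR)
  have eq: "(1 - t) *\<^sub>R x + (t *\<^sub>R x + c) = x + c" by (simp add: algebra_simps)
  have "N ((1 - t) *\<^sub>R x) + N (t *\<^sub>R x + c) \<le> N (x + c)"
    using gauge_funD(2)[OF N 1] unfolding eq .
  moreover have "N ((1 - t) *\<^sub>R x) = N x - t * N x"
    using gauge_funD(3)[OF N x, of "1 - t"] t by (simp add: algebra_simps)
  ultimately show "N x \<le> N (x + c) + e" using gauge_fun_pos[OF N b 1(2)] t(3) by linarith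
qed

lemma gauge_body_Int_interior:
  assumes x: "x \<in> interior C"
  shows "x \<in> gauge_body N \<longleftrightarrow> 1 \<le> N x"
proof
  assume "x \<in> gauge_body N"
  then obtain y where y: "\<forall>n. y n \<in> {x \<in> interior C. 1 \<le> N x}" "y \<longlonglongrightarrow> x"
    unfolding gauge_body_def closure_sequential by (elim exE conjE)
  have "isCont N x"
    using gauge_fun_continuous[OF N b] x by (simp add: continuous_on_eq_continuous_at)
  then have "(\<lambda>n. N (y n)) \<longlonglongrightarrow> N x" using y(2) by (rule isCont_tendsto_compose)
  then show "1 \<le> N x" by (rule LIMSEQ_le_const) (use y in auto)
next
  assume "1 \<le> N x"
  then have "x \<in> {x \<in> interior C. 1 \<le> N x}" using x by simp
  then show "x \<in> gauge_body N" unfolding gauge_body_def by (rule subsetD[OF closure_subset])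
qed

text \<open>Reduces a closed property of the body to interior points, where the gauge can be
  used.\<close>

lemma gauge_body_induct:
  assumes "x \<in> gauge_body N" "closed S" "\<And>y. y \<in> interior C \<Longrightarrow> 1 \<le> N y \<Longrightarrow> y \<in> S"
  shows "x \<in> S"
proof -
  have "gauge_body N \<subseteq> S" unfolding gauge_body_def using assms(2,3) by (intro closure_minimal) auto
  then show ?thesis using assms(1) by blast
qed

lemma gauge_body_subset: "gauge_body N \<subseteq> C"
  using gauge_body_induct[OF _ closed_C] interior_subset by blast

lemma gauge_body_convex: "convex (gauge_body N)"
  unfolding gauge_body_def
proof (rule convex_closure, rule convexI)
  fix x y :: 'a and s t :: real
  assume x: "x \<in> {x \<in> interior C. 1 \<le> N x}" and y: "y \<in> {x \<in> interior C. 1 \<le> N x}"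
    and st: "0 \<le> s" "0 \<le> t" "s + t = 1"
  show "s *\<^sub>R x + t *\<^sub>R y \<in> {x \<in> interior C. 1 \<le> N x}"
  proof (cases "s = 0 \<or> t = 0")
    case True
    then show ?thesis using x y st by auto
  next
    case False
    then have st': "0 < s" "0 < t" using st by auto
    have i: "s *\<^sub>R x \<in> interior C" "t *\<^sub>R y \<in> interior C" using x y st' by (auto intro: interior_scaleR)
    have "1 = s * 1 + t * 1" using st by simp
    also have "\<dots> \<le> s * N x + t * N y" using x y st' by (intro add_mono mult_left_mono) auto
    also have "\<dots> = N (s *\<^sub>R x) + N (t *\<^sub>R y)" using gauge_funD(3)[OF N] x y st' by simp
    also have "\<dots> \<le> N (s *\<^sub>R x + t *\<^sub>R y)" by (rule gauge_funD(2)[OF N i])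
    finally show ?thesis using i interior_subset by (auto intro!: interior_add)
  qed
qed

lemma gauge_body_add:
  assumes x: "x \<in> gauge_body N" and c: "c \<in> C"
  shows "x + c \<in> gauge_body N"
proof -
  have "x \<in> (\<lambda>y. y + c) -` gauge_body N"
  proof (rule gauge_body_induct[OF x])
    show "closed ((\<lambda>y. y + c) -` gauge_body N)"
      by (intro closed_vimage continuous_intros) (simp add: gauge_body_def)
    fix y assume y: "y \<in> interior C" "1 \<le> N y"
    then have "1 \<le> N (y + c)" using gauge_mono[OF y(1) c] by linarith
    then show "y \<in> (\<lambda>y. y + c) -` gauge_body N"
      using gauge_body_Int_interior[OF interior_add[OF y(1) c]] by simp
  qed
  then show ?thesis by simp
qed

lemma gauge_body_ray:
  assumes v: "v \<in> interior C" and r: "0 < r"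
  shows "r *\<^sub>R v \<in> gauge_body N \<longleftrightarrow> 1 / N v \<le> r"
  using gauge_body_Int_interior[OF interior_scaleR[OF v r]] gauge_funD(3)[OF N v r]
    gauge_fun_pos[OF N b v] by (simp add: divide_le_eq)

lemma gauge_body_unbounded: "\<not> bounded (gauge_body N)"
proof
  assume "bounded (gauge_body N)"
  then obtain R where R: "\<And>x. x \<in> gauge_body N \<Longrightarrow> norm x \<le> R" unfolding bounded_iff by blast
  obtain v where v: "v \<in> Omega C" using Omega_nonempty by blast
  define r where "r = max (1 / N v) (max 1 (R + 1))"
  have "r *\<^sub>R v \<in> gauge_body N"
    using gauge_body_ray[OF OmegaD(2)[OF v], of r] by (simp add: r_def)
  from R[OF this] show False using OmegaD(1)[OF v] by (simp add: r_def)
qed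

lemma zero_notin_gauge_body: "0 \<notin> gauge_body N"
proof
  assume zero: "0 \<in> gauge_body N"
  have "0 \<in> {x::'a. 1 \<le> B * norm x}"
  proof (rule gauge_body_induct[OF zero])
    show "closed {x::'a. 1 \<le> B * norm x}" by (intro closed_Collect_le continuous_intros)
    show "y \<in> {x. 1 \<le> B * norm x}" if "y \<in> interior C" "1 \<le> N y" for y
      using gauge_funD(4)[OF N that(1)] that(2) by simp
  qed
  then show False by simp
qed

lemma gauge_body_nonempty: "gauge_body N \<noteq> {}"
  using gauge_body_unbounded by auto

text \<open>A separating functional is nonpositive on the cone because the body is stable under
  adding cone elements. It may lie on the boundary of the polar cone; adding a small multiple of an
  interior \<open>u0\<close> repairs this, and the level \<open>- c\<close> still bounds the body
  since \<open>u0 \<bullet> y \<le> 0\<close> there.\<close>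

lemma gauge_body_separation:
  assumes P: "Omega (polar_cone C) \<noteq> {}" and x: "x \<in> C" "x \<notin> gauge_body N"
  shows "\<exists>u a. u \<in> Omega (polar_cone C) \<and> gauge_body N \<subseteq> halfspace_minus u a \<and> x \<notin> halfspace_minus u a"
proof -
  interpret P: pointed_cone_space "polar_cone C" by (rule polar_pointed_cone_space[OF P])
  have "closed (gauge_body N)" by (simp add: gauge_body_def)
  from separating_hyperplane_closed_point[OF gauge_body_convex this x(2)]
  obtain w c where w: "w \<bullet> x < c" "\<And>y. y \<in> gauge_body N \<Longrightarrow> c < w \<bullet> y" by blast
  define u where "u = - w"
  have u: "- c < u \<bullet> x" "\<And>y. y \<in> gauge_body N \<Longrightarrow> u \<bullet> y < - c" using w by (auto simp: u_def)
  obtain y0 where y0: "y0 \<in> gauge_body N" using gauge_body_nonempty by blast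
  have uP: "u \<in> polar_cone C"
    unfolding polar_cone_def
  proof (intro CollectI ballI, rule ccontr)
    fix z assume z: "z \<in> C" and "\<not> u \<bullet> z \<le> 0"
    then have pos: "0 < u \<bullet> z" by simp
    obtain n :: nat where n: "- c - u \<bullet> y0 < real n * (u \<bullet> z)" using reals_Archimedean3[OF pos] by blast
    have "y0 + real n *\<^sub>R z \<in> gauge_body N" by (intro gauge_body_add y0 C_scaleR z) simp
    from u(2)[OF this] show False using n by (simp add: inner_add_right)
  qed
  obtain u0 where u0: "u0 \<in> Omega (polar_cone C)" using P by blast
  \<comment> \<open>Keeps \<open>e * \<bar>u0 \<bullet> x\<bar>\<close> below the gap
    \<open>u \<bullet> x + c\<close>; the summand 1 excludes a zero denominator.\<close>
  define e where "e = (u \<bullet> x + c) / (\<bar>u0 \<bullet> x\<bar> + 1)"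
  have e: "0 < e" using u(1) by (simp add: e_def divide_pos_pos add_nonneg_pos)
  define u' where "u' = e *\<^sub>R u0 + u"
  have u'P: "u' \<in> interior (polar_cone C)"
    unfolding u'_def by (intro P.interior_add P.interior_scaleR OmegaD(2)[OF u0] e uP)
  have n: "0 < norm u'" using u'P P.zero_notin_interior by auto
  have le: "u' \<bullet> y \<le> - c" if y: "y \<in> gauge_body N" for y
  proof -
    have "u0 \<bullet> y \<le> 0" using OmegaD(3)[OF u0] y gauge_body_subset by (auto simp: polar_cone_def)
    then have "e * (u0 \<bullet> y) \<le> 0" using e by (simp add: mult_nonneg_nonpos)
    then show ?thesis using u(2)[OF y] by (simp add: u'_def inner_add_left)
  qed
  have "e * \<bar>u0 \<bullet> x\<bar> < e * (\<bar>u0 \<bullet> x\<bar> + 1)" using e by simp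
  also have "\<dots> = u \<bullet> x + c" by (simp add: e_def)
  finally have "- (u \<bullet> x + c) < e * (u0 \<bullet> x)"
    using e abs_ge_minus_self[of "u0 \<bullet> x"] mult_left_mono[of "- (u0 \<bullet> x)" "\<bar>u0 \<bullet> x\<bar>" e] by simp
  then have gt: "- c < u' \<bullet> x" by (simp add: u'_def inner_add_left)
  show ?thesis
  proof (intro exI conjI)
    show "u' /\<^sub>R norm u' \<in> Omega (polar_cone C)"
      using P.interior_scaleR[OF u'P, of "inverse (norm u')"] n by (simp add: Omega_def)
    show "gauge_body N \<subseteq> halfspace_minus (u' /\<^sub>R norm u') (- c / norm u')"
      using le n by (auto simp: halfspace_minus_def inner_commute divide_simps)
    show "x \<notin> halfspace_minus (u' /\<^sub>R norm u') (- c / norm u')"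
      using gt n by (auto simp: halfspace_minus_def inner_commute divide_simps)
  qed
qed

lemma gauge_body_compatible:
  assumes P: "Omega (polar_cone C) \<noteq> {}"
  shows "C_compatible C (gauge_body N)"
proof -
  let ?I = "\<Inter> {halfspace_minus u a | u a. u \<in> Omega (polar_cone C) \<and> gauge_body N \<subseteq> halfspace_minus u a}"
  have "x \<in> gauge_body N" if "x \<in> C \<inter> ?I" for x
    using gauge_body_separation[OF P, of x] that by blast
  then have "gauge_body N = C \<inter> ?I" using gauge_body_subset by blast
  moreover have "closed (gauge_body N)" by (simp add: gauge_body_def)
  ultimately show ?thesis
    unfolding C_compatible_def
    using gauge_body_unbounded gauge_body_convex gauge_body_subset zero_notin_gauge_body by blast
qed

lemma radial_gauge_body:
  assumes v: "v \<in> Omega C"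
  shows "radial_fun C (gauge_body N) v = 1 / N v"
proof -
  have vi: "v \<in> interior C" by (rule OmegaD(2)[OF v])
  have pos: "0 < N v" by (rule gauge_fun_pos[OF N b vi])
  have "{r. 0 < r \<and> r *\<^sub>R v \<in> C - gauge_body N} = {0<..<1 / N v}"
    using gauge_body_ray[OF vi] C_scaleR[OF OmegaD(3)[OF v]] by (auto simp: not_le)
  then show ?thesis using pos by (simp add: radial_fun_def)
qed

lemma gauge_body_bdd_above:
  assumes u: "u \<in> polar_cone C" shows "bdd_above ((\<lambda>x. x \<bullet> u) ` gauge_body N)"
  using u gauge_body_subset by (intro bdd_aboveI2[of _ _ 0]) (auto simp: polar_cone_def inner_commute)

text \<open>The boundary point on the ray is \<open>v / N v\<close>, and the support function is
  determined by the points \<open>y / N y\<close>. The inequality in \<open>normal_at\<close> says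
  that none of them has a larger product with \<open>u\<close> than \<open>v / N v\<close>.\<close>

lemma boundary_point_normal:
  assumes v: "v \<in> Omega C" and u: "u \<in> Omega (polar_cone C)"
  shows "radial_fun C (gauge_body N) v *\<^sub>R v \<in> hyperplane u (support_fun (gauge_body N) u) \<longleftrightarrow> normal_at N v u"
    and "normal_at N v u \<Longrightarrow> support_fun (gauge_body N) u = (u \<bullet> v) / N v"
proof -
  have vi: "v \<in> interior C" by (rule OmegaD(2)[OF v])
  have pos: "0 < N v" by (rule gauge_fun_pos[OF N b vi])
  have u': "u \<in> polar_cone C" "norm u = 1" using OmegaD[OF u] by auto
  have neg: "u \<bullet> v < 0" using u' by (intro inner_interior_polar_neg[OF vi]) auto
  show supp: "support_fun (gauge_body N) u = (u \<bullet> v) / N v" if n: "normal_at N v u"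
    unfolding support_fun_def
  proof (rule cSup_eq_maximum)
    have "(1 / N v) *\<^sub>R v \<in> gauge_body N" using gauge_body_ray[OF vi, of "1 / N v"] pos by simp
    moreover have "(u \<bullet> v) / N v = ((1 / N v) *\<^sub>R v) \<bullet> u" by (simp add: inner_commute)
    ultimately show "(u \<bullet> v) / N v \<in> (\<lambda>x. x \<bullet> u) ` gauge_body N" by blast
    fix z assume "z \<in> (\<lambda>x. x \<bullet> u) ` gauge_body N"
    then obtain x where x: "x \<in> gauge_body N" "z = x \<bullet> u" by blast
    have "x \<in> {x. x \<bullet> u \<le> (u \<bullet> v) / N v}"
    proof (rule gauge_body_induct[OF x(1)])
      show "closed {x. x \<bullet> u \<le> (u \<bullet> v) / N v}" by (intro closed_Collect_le continuous_intros)
      fix y assume y: "y \<in> interior C" "1 \<le> N y"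
      have "N v * (u \<bullet> y) \<le> N y * (u \<bullet> v)" using n y by (simp add: normal_at_def)
      also have "\<dots> \<le> 1 * (u \<bullet> v)" using y neg by (intro mult_right_mono_neg) auto
      finally show "y \<in> {x. x \<bullet> u \<le> (u \<bullet> v) / N v}" using pos by (simp add: inner_commute le_divide_eq mult.commute)
    qed
    then show "z \<le> (u \<bullet> v) / N v" using x by simp
  qed
  have "normal_at N v u" if eq: "(u \<bullet> v) / N v = support_fun (gauge_body N) u"
    unfolding normal_at_def
  proof (intro conjI ballI u')
    fix y assume y: "y \<in> interior C"
    have posy: "0 < N y" by (rule gauge_fun_pos[OF N b y])
    have "(1 / N y) *\<^sub>R y \<in> gauge_body N" using gauge_body_ray[OF y, of "1 / N y"] posy by simp
    then have "((1 / N y) *\<^sub>R y) \<bullet> u \<le> (u \<bullet> v) / N v"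
      unfolding eq support_fun_def by (intro cSUP_upper gauge_body_bdd_above u')
    then show "N v * (u \<bullet> y) \<le> N y * (u \<bullet> v)" using pos posy by (simp add: inner_commute field_simps)
  qed
  with supp show "radial_fun C (gauge_body N) v *\<^sub>R v \<in> hyperplane u (support_fun (gauge_body N) u) \<longleftrightarrow> normal_at N v u"
    unfolding radial_gauge_body[OF v] hyperplane_def by (auto simp: inner_commute)
qed

text \<open>Points slightly before \<open>v / N v\<close> on the ray lie in the cone but not in the
  body, so \<open>v / N v\<close> belongs to both frontiers.\<close>

lemma Omega_subset_Omega_e: "Omega C \<subseteq> Omega_e C (gauge_body N)"
proof
  fix v assume v: "v \<in> Omega C"
  have vi: "v \<in> interior C" by (rule OmegaD(2)[OF v])
  have pos: "0 < N v" by (rule gauge_fun_pos[OF N b vi])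
  define x where "x = (1 / N v) *\<^sub>R v"
  have xA: "x \<in> gauge_body N" using gauge_body_ray[OF vi, of "1 / N v"] pos by (simp add: x_def)
  have near: "\<exists>y\<in>C - gauge_body N. dist y x < e" if e: "0 < e" for e
  proof -
    define d where "d = min (1 / 2) (e * N v / 2)"
    have d: "0 < d" "d < 1" "d < e * N v" using e pos by (auto simp: d_def min_def)
    let ?y = "((1 - d) / N v) *\<^sub>R v"
    have r: "0 < (1 - d) / N v" using d pos by simp
    have "?y \<notin> gauge_body N" using gauge_body_ray[OF vi r] d pos by (simp add: divide_le_cancel)
    moreover have "?y \<in> C" using r by (intro C_scaleR OmegaD(3)[OF v]) simp
    moreover have "dist ?y x < e"
    proof -
      have "?y - x = (- d / N v) *\<^sub>R v" by (simp add: x_def scaleR_left_diff_distrib[symmetric] diff_divide_distrib)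
      then have "dist ?y x = d / N v" using OmegaD(1)[OF v] d pos by (simp add: dist_norm)
      then show ?thesis using d pos by (simp add: divide_less_eq)
    qed
    ultimately show ?thesis by blast
  qed
  have "x \<in> closure (C - gauge_body N)" using near by (simp add: closure_approachable)
  moreover have "x \<notin> interior (C - gauge_body N)" using xA interior_subset by blast
  moreover have "x \<in> closure (gauge_body N)" using xA closure_subset by blast
  moreover have "x \<notin> interior (gauge_body N)"
  proof
    assume "x \<in> interior (gauge_body N)"
    then obtain e where e: "0 < e" "ball x e \<subseteq> gauge_body N" using mem_interior by blast
    obtain y where "y \<in> C - gauge_body N" "dist y x < e" using near[OF e(1)] by blast
    then show False using e(2) by (auto simp: dist_commute)
  qed
  ultimately have "x \<in> effective_boundary C (gauge_body N)"
    by (simp add: effective_boundary_def frontier_def)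
  moreover have "v = x /\<^sub>R norm x" using pos OmegaD(1)[OF v] by (simp add: x_def)
  ultimately show "v \<in> Omega_e C (gauge_body N)" unfolding Omega_e_def by blast
qed

lemma Omega_e_subset: "Omega_e C (gauge_body N) \<subseteq> sphere 0 1 \<inter> C"
proof
  fix v assume "v \<in> Omega_e C (gauge_body N)"
  then obtain x where x: "x \<in> frontier (gauge_body N)" "v = x /\<^sub>R norm x"
    by (auto simp: Omega_e_def effective_boundary_def)
  have "x \<in> gauge_body N" using x(1) by (simp add: frontier_def gauge_body_def)
  then have "x \<in> C" "x \<noteq> 0" using gauge_body_subset zero_notin_gauge_body by auto
  then show "v \<in> sphere 0 1 \<inter> C" using x(2) C_scaleR[of x "inverse (norm x)"] by simp
qed

text \<open>A finite supremum of linear functions is convex, hence continuous on an open convex set.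
  Measurability of the weight in the \<open>(p, q)\<close> measure rests on this.\<close>

lemma support_gauge_body_continuous:
  "continuous_on (interior (polar_cone C)) (support_fun (gauge_body N))"
proof (rule convex_on_continuous[OF open_interior])
  show "convex_on (interior (polar_cone C)) (support_fun (gauge_body N))"
  proof (rule convex_onI)
    fix t :: real and u w :: 'a
    assume t: "0 < t" "t < 1" and uw: "u \<in> interior (polar_cone C)" "w \<in> interior (polar_cone C)"
    have P: "u \<in> polar_cone C" "w \<in> polar_cone C" using uw interior_subset by auto
    show "support_fun (gauge_body N) ((1 - t) *\<^sub>R u + t *\<^sub>R w)
        \<le> (1 - t) * support_fun (gauge_body N) u + t * support_fun (gauge_body N) w"
      unfolding support_fun_def
    proof (rule cSUP_least[OF gauge_body_nonempty])
      fix x assume x: "x \<in> gauge_body N"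
      have "x \<bullet> ((1 - t) *\<^sub>R u + t *\<^sub>R w) = (1 - t) * (x \<bullet> u) + t * (x \<bullet> w)"
        by (simp add: inner_add_right)
      also have "\<dots> \<le> (1 - t) * (SUP x\<in>gauge_body N. x \<bullet> u) + t * (SUP x\<in>gauge_body N. x \<bullet> w)"
        using t x P by (intro add_mono mult_left_mono cSUP_upper gauge_body_bdd_above) auto
      finally show "x \<bullet> ((1 - t) *\<^sub>R u + t *\<^sub>R w)
        \<le> (1 - t) * (SUP x\<in>gauge_body N. x \<bullet> u) + t * (SUP x\<in>gauge_body N. x \<bullet> w)" .
    qed
  qed (intro convex_interior convex_polar_cone)
qed

end

end

section \<open>Spherical measure\<close>

context pointed_cone_space
begin

text \<open>For \<open>\<kappa>\<close> equal to the dimension, the spherical measure of directions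
  in \<open>Omega C\<close>, realised on the Borel sets of the whole space and without
  completion.\<close>

definition cone_spherical :: "ennreal \<Rightarrow> 'a measure" where
  "cone_spherical \<kappa> = scale_measure \<kappa>
     (distr (restrict_space lborel (ball 0 1 \<inter> interior C)) borel (\<lambda>x. x /\<^sub>R norm x))"

lemma normalize_interior:
  "x \<noteq> 0 \<Longrightarrow> x /\<^sub>R norm x \<in> Omega C \<longleftrightarrow> x \<in> interior C"
  by (simp add: Omega_def interior_scaleR_iff)

lemma normalize_measurable: 
  "(\<lambda>x. x /\<^sub>R norm x) \<in> measurable (restrict_space lborel (ball 0 1 \<inter> interior C)) borel"
  by (rule measurable_restrict_space1) measurable

lemma sets_cone_spherical [measurable_cong]: "sets (cone_spherical \<kappa>) = sets borel"
  by (simp add: cone_spherical_def)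

lemma space_cone_spherical: "space (cone_spherical \<kappa>) = UNIV"
  using sets_eq_imp_space_eq[OF sets_cone_spherical] by simp

lemma nn_integral_cone_spherical:
  assumes f [measurable]: "f \<in> borel_measurable borel"
  shows "(\<integral>\<^sup>+v. f v \<partial>cone_spherical \<kappa>) =
    \<kappa> * (\<integral>\<^sup>+x. f (x /\<^sub>R norm x) * indicator (ball 0 1 \<inter> interior C) x \<partial>lborel)"
proof -
  have "(\<integral>\<^sup>+v. f v \<partial>cone_spherical \<kappa>) =
      \<kappa> * (\<integral>\<^sup>+v. f v \<partial>distr (restrict_space lborel (ball 0 1 \<inter> interior C)) borel (\<lambda>x. x /\<^sub>R norm x))"
    unfolding cone_spherical_def by (rule nn_integral_scale_measure) simp
  also have "(\<integral>\<^sup>+v. f v \<partial>distr (restrict_space lborel (ball 0 1 \<inter> interior C)) borel (\<lambda>x. x /\<^sub>R norm x))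
      = (\<integral>\<^sup>+x. f (x /\<^sub>R norm x) \<partial>restrict_space lborel (ball 0 1 \<inter> interior C))"
    by (rule nn_integral_distr[OF normalize_measurable]) simp
  also have "\<dots> = (\<integral>\<^sup>+x. f (x /\<^sub>R norm x) * indicator (ball 0 1 \<inter> interior C) x \<partial>lborel)"
    by (rule nn_integral_restrict_space) simp
  finally show ?thesis .
qed

lemma emeasure_cone_spherical:
  assumes X [measurable]: "X \<in> sets borel"
  shows "emeasure (cone_spherical \<kappa>) X =
    \<kappa> * emeasure lborel {x \<in> ball 0 1 \<inter> interior C. x /\<^sub>R norm x \<in> X}"
proof -
  have "emeasure (cone_spherical \<kappa>) X = (\<integral>\<^sup>+v. indicator X v \<partial>cone_spherical \<kappa>)"
    by (simp add: sets_cone_spherical)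
  also have "\<dots> = \<kappa> * (\<integral>\<^sup>+x. indicator X (x /\<^sub>R norm x) * indicator (ball 0 1 \<inter> interior C) x \<partial>lborel)"
    by (rule nn_integral_cone_spherical) measurable
  also have "(\<integral>\<^sup>+x. indicator X (x /\<^sub>R norm x) * indicator (ball 0 1 \<inter> interior C) x \<partial>lborel)
      = (\<integral>\<^sup>+x. indicator {x \<in> ball 0 1 \<inter> interior C. x /\<^sub>R norm x \<in> X} x \<partial>lborel)"
    by (intro nn_integral_cong) (auto simp: indicator_def)
  also have "\<dots> = emeasure lborel {x \<in> ball 0 1 \<inter> interior C. x /\<^sub>R norm x \<in> X}"
  proof (rule nn_integral_indicator)
    have "{x \<in> ball 0 1 \<inter> interior C. x /\<^sub>R norm x \<in> X} = ball 0 1 \<inter> interior C \<inter> {x. x /\<^sub>R norm x \<in> X}" by auto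
    also have "\<dots> \<in> sets lborel" by measurable
    finally show "{x \<in> ball 0 1 \<inter> interior C. x /\<^sub>R norm x \<in> X} \<in> sets lborel" .
  qed
  finally show ?thesis .
qed

lemma cone_measure_cone_spherical:
  assumes k: "0 < k"
  shows "cone_measure C (cone_spherical (ennreal k))"
proof (intro cone_measure.intro cone_measure_axioms.intro)
  show "pointed_cone_space C" by unfold_locales
  let ?B = "ball 0 1 \<inter> interior C :: 'a set"
  have total: "emeasure (cone_spherical (ennreal k)) (space (cone_spherical (ennreal k))) = ennreal k * emeasure lborel ?B"
  proof -
    have eq: "{x \<in> ?B. x /\<^sub>R norm x \<in> UNIV} = ?B" by auto
    show ?thesis
      using emeasure_cone_spherical[of UNIV "ennreal k"] unfolding eq space_cone_spherical by simp
  qed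
  have fin: "emeasure lborel ?B < \<infinity>"
    by (rule le_less_trans[OF emeasure_mono emeasure_lborel_ball_finite[of 0 1]]) auto
  have finite: "emeasure (cone_spherical (ennreal k)) (space (cone_spherical (ennreal k))) \<noteq> \<infinity>"
    unfolding total using fin by (simp add: ennreal_mult_eq_top_iff)
  then show "finite_measure (cone_spherical (ennreal k))" by (rule finite_measureI)
  show "sets (cone_spherical (ennreal k)) = sets borel" by (rule sets_cone_spherical)
  have [measurable]: "Omega C \<in> sets borel" unfolding Omega_def by simp
  have "emeasure (cone_spherical (ennreal k)) (- Omega C) = 0"
  proof -
    have "x /\<^sub>R norm x \<in> Omega C" if x: "x \<in> ?B" for x
    proof -
      have "x \<noteq> 0" using x zero_notin_interior by auto
      then show ?thesis using x normalize_interior by blast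
    qed
    then have empty: "{x \<in> ?B. x /\<^sub>R norm x \<in> - Omega C} = {}" by blast
    have "- Omega C \<in> sets borel" by measurable
    from emeasure_cone_spherical[OF this, of "ennreal k"] show ?thesis unfolding empty by simp
  qed
  then have "- Omega C \<in> null_sets (cone_spherical (ennreal k))"
    by (auto simp: null_sets_def sets_cone_spherical)
  from AE_not_in[OF this] show "AE v in cone_spherical (ennreal k). v \<in> Omega C" by simp
  have "?B \<noteq> {}"
  proof -
    obtain v where v: "v \<in> Omega C" using Omega_nonempty by blast
    have "(1/2) *\<^sub>R v \<in> ?B" using OmegaD[OF v] by (auto intro!: interior_scaleR)
    then show ?thesis by blast
  qed
  then have "emeasure lborel ?B \<noteq> 0"
    using open_not_negligible[of ?B] by (auto simp: negligible_iff_null_sets null_sets_def)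
  then have "emeasure (cone_spherical (ennreal k)) (space (cone_spherical (ennreal k))) \<noteq> 0"
    unfolding total using k by (simp add: ennreal_eq_0_iff)
  then show "measure (cone_spherical (ennreal k)) (space (cone_spherical (ennreal k))) \<noteq> 0"
    using finite by (simp add: measure_def enn2real_eq_0_iff)
  fix E :: "'a set" assume E: "E \<in> sets borel" "emeasure lborel E = 0"
    and conic: "\<And>x t. x \<in> E \<Longrightarrow> 0 < t \<Longrightarrow> t *\<^sub>R x \<in> E"
  \<comment> \<open>As \<open>E\<close> is stable under positive multiples, whatever projects into
    \<open>E\<close> already lies in \<open>E\<close>.\<close>
  have "{x \<in> ?B. x /\<^sub>R norm x \<in> E} \<subseteq> E"
  proof
    fix x assume x: "x \<in> {x \<in> ?B. x /\<^sub>R norm x \<in> E}"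
    then have "x \<noteq> 0" using zero_notin_interior by auto
    then show "x \<in> E" using x conic[of "x /\<^sub>R norm x" "norm x"] by simp
  qed
  then have "emeasure lborel {x \<in> ?B. x /\<^sub>R norm x \<in> E} \<le> emeasure lborel E"
    using E(1) by (intro emeasure_mono) auto
  then show "emeasure (cone_spherical (ennreal k)) E = 0"
    using E by (simp add: emeasure_cone_spherical)
qed

text \<open>The boundary of the cone is a null set, so integrands on the sphere need only be known on
  \<open>Omega C\<close>, up to a null cone \<open>E\<close>, and to vanish outside the cone.\<close>

lemma nn_integral_spherical_measure:
  fixes f f' :: "'a \<Rightarrow> ennreal"
  assumes f' [measurable]: "f' \<in> borel_measurable borel"
    and E [measurable]: "E \<in> sets borel" and E_null: "emeasure lborel E = 0"
    and E_conic: "\<And>x t. x \<in> E \<Longrightarrow> 0 < t \<Longrightarrow> t *\<^sub>R x \<in> E"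
    and eq: "\<And>v. v \<in> Omega C - E \<Longrightarrow> f v = f' v"
    and zero: "\<And>v. norm v = 1 \<Longrightarrow> v \<notin> C \<Longrightarrow> f v = 0"
  shows "(\<integral>\<^sup>+v. f v \<partial>spherical_measure) = (\<integral>\<^sup>+v. f' v \<partial>cone_spherical (of_nat DIM('a)))"
proof -
  let ?B = "ball 0 1 - {0} :: 'a set"
  let ?S = "sphere 0 1 :: 'a set"
  define D where "D = distr (restrict_space lborel ?B) (restrict_space borel ?S) (\<lambda>x. x /\<^sub>R norm x)"
  have B [measurable]: "?B \<in> sets lborel" by auto
  have C_borel [measurable]: "C \<in> sets borel" using closed_C by (rule borel_closed)
  have Om [measurable]: "Omega C \<in> sets borel" unfolding Omega_def by simp
  have norm_meas: "(\<lambda>x. x /\<^sub>R norm x) \<in> measurable (restrict_space lborel ?B) (restrict_space borel ?S)"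
    by (rule measurable_restrict_space2) (auto simp: space_restrict_space intro!: measurable_restrict_space1)
  \<comment> \<open>The exceptional directions: those in \<open>E\<close> and those on the boundary
    of the cone.\<close>
  define W where "W = ?S \<inter> (E \<union> (C - interior C))"
  have W: "W \<in> sets (restrict_space borel ?S)"
  proof -
    have "W \<in> sets borel" unfolding W_def by measurable
    then show ?thesis by (auto simp: sets_restrict_space_iff W_def)
  qed
  have front: "emeasure lborel (C - interior C) = 0"
  proof -
    have "C - interior C = frontier C" using closed_C by (simp add: frontier_def)
    then have "C - interior C \<in> null_sets lebesgue"
      using negligible_convex_frontier[OF convex_C] by (simp add: negligible_iff_null_sets)
    then show ?thesis using C_borel by (simp add: null_sets_def)
  qed
  have "emeasure D W = 0"
  proof -
    have "emeasure D W = emeasure (restrict_space lborel ?B) ((\<lambda>x. x /\<^sub>R norm x) -` W \<inter> space (restrict_space lborel ?B))"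
      unfolding D_def by (rule emeasure_distr[OF norm_meas W])
    also have "\<dots> = emeasure lborel ((\<lambda>x. x /\<^sub>R norm x) -` W \<inter> space (restrict_space lborel ?B))"
      by (rule emeasure_restrict_space) (auto simp: space_restrict_space)
    also have "\<dots> \<le> emeasure lborel (E \<union> (C - interior C))"
    proof (rule emeasure_mono)
      show "(\<lambda>x. x /\<^sub>R norm x) -` W \<inter> space (restrict_space lborel ?B) \<subseteq> E \<union> (C - interior C)"
      proof
        fix x assume x: "x \<in> (\<lambda>x. x /\<^sub>R norm x) -` W \<inter> space (restrict_space lborel ?B)"
        then have nz: "x \<noteq> 0" and w: "x /\<^sub>R norm x \<in> E \<union> (C - interior C)"
          by (auto simp: W_def space_restrict_space)
        have eq: "norm x *\<^sub>R (x /\<^sub>R norm x) = x" using nz by simp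
        show "x \<in> E \<union> (C - interior C)"
        proof (cases "x /\<^sub>R norm x \<in> E")
          case True
          then show ?thesis using E_conic[of "x /\<^sub>R norm x" "norm x"] nz eq by simp
        next
          case False
          then have "x /\<^sub>R norm x \<in> C" "x /\<^sub>R norm x \<notin> interior C" using w by auto
          moreover from this(1) have "norm x *\<^sub>R (x /\<^sub>R norm x) \<in> C" by (rule C_scaleR) simp
          ultimately show ?thesis using nz eq interior_scaleR_iff[of "inverse (norm x)" x] by simp
        qed
      qed
    qed measurable
    also have "\<dots> \<le> emeasure lborel E + emeasure lborel (C - interior C)"
      by (rule emeasure_subadditive) measurable
    finally show ?thesis using E_null front by simp
  qed
  then have null: "W \<in> null_sets D" using W by (simp add: null_sets_def D_def)
  let ?f = "\<lambda>v. f' v * indicator (Omega C) v"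
  have f_meas: "?f \<in> borel_measurable (restrict_space borel ?S)"
    by (rule measurable_restrict_space1) measurable
  \<comment> \<open>Here \<open>f\<close> may fail to be Borel: completion does not change the
    integral, and off the null set \<open>W\<close> the function agrees with the Borel function
    \<open>?f\<close>.\<close>
  have "(\<integral>\<^sup>+v. f v \<partial>spherical_measure) = (\<integral>\<^sup>+v. f v \<partial>scale_measure (of_nat DIM('a)) D)"
    unfolding spherical_measure_def D_def by (rule nn_integral_completion)
  also have "\<dots> = (\<integral>\<^sup>+v. ?f v \<partial>scale_measure (of_nat DIM('a)) D)"
  proof (rule nn_integral_cong_AE, rule AE_I')
    show "W \<in> null_sets (scale_measure (of_nat DIM('a)) D)" using null by (simp add: null_sets_def)
    show "{v \<in> space (scale_measure (of_nat DIM('a)) D). f v \<noteq> ?f v} \<subseteq> W"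
    proof
      fix v assume v: "v \<in> {v \<in> space (scale_measure (of_nat DIM('a)) D). f v \<noteq> ?f v}"
      then have S: "norm v = 1"
        using sets_eq_imp_space_eq[OF sets_scale_measure, of "of_nat DIM('a)" D]
        by (auto simp: D_def space_restrict_space)
      show "v \<in> W"
      proof (rule ccontr)
        assume "v \<notin> W"
        then have nW: "v \<notin> E" "v \<in> C \<Longrightarrow> v \<in> interior C" using S by (auto simp: W_def)
        show False
        proof (cases "v \<in> C")
          case True
          then have "v \<in> Omega C" using nW(2) S by (simp add: Omega_def)
          then show False using v eq[of v] nW(1) by simp
        next
          case False
          then have "v \<notin> Omega C" using OmegaD(3) by blast
          then show False using v zero[OF S False] by simp
        qed
      qed
    qed
  qed
  also have "\<dots> = of_nat DIM('a) * (\<integral>\<^sup>+v. ?f v \<partial>D)"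
    by (rule nn_integral_scale_measure) (use f_meas in \<open>simp add: D_def\<close>)
  also have "(\<integral>\<^sup>+v. ?f v \<partial>D) = (\<integral>\<^sup>+x. ?f (x /\<^sub>R norm x) \<partial>restrict_space lborel ?B)"
    unfolding D_def by (rule nn_integral_distr[OF norm_meas]) (use f_meas in simp)
  also have "\<dots> = (\<integral>\<^sup>+x. ?f (x /\<^sub>R norm x) * indicator ?B x \<partial>lborel)"
    by (rule nn_integral_restrict_space) auto
  also have "\<dots> = (\<integral>\<^sup>+x. f' (x /\<^sub>R norm x) * indicator (ball 0 1 \<inter> interior C) x \<partial>lborel)"
  proof (rule nn_integral_cong)
    fix x :: 'a
    show "?f (x /\<^sub>R norm x) * indicator ?B x = f' (x /\<^sub>R norm x) * indicator (ball 0 1 \<inter> interior C) x"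
    proof (cases "x = 0")
      case True
      then show ?thesis using zero_notin_interior by simp
    next
      case False
      then show ?thesis using normalize_interior[OF False] by (auto simp: indicator_def)
    qed
  qed
  finally show ?thesis by (simp add: nn_integral_cone_spherical)
qed

text \<open>Off \<open>E\<close> a direction belongs to the reverse radial Gauss image exactly when
  its only normal lies in \<open>\<eta>\<close>. The spherical measure contains the dimension as a
  factor, which the definition divides out for \<open>q \<noteq> 0\<close> and keeps for
  \<open>q = 0\<close>; hence the two normalisations.\<close>

lemma dual_curvature_gauge_body:
  fixes N :: "'a \<Rightarrow> real" and q :: real
  assumes N: "gauge_fun b B N" and b: "0 < b"
    and \<alpha> [measurable]: "\<alpha> \<in> borel_measurable borel"
    and E: "E \<in> sets borel" "emeasure lborel E = 0" "\<forall>x\<in>E. \<forall>t>0. t *\<^sub>R x \<in> E"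
    and normal: "\<forall>v\<in>Omega C - E. normal_at N v (\<alpha> v) \<and> (\<forall>u. normal_at N v u \<longrightarrow> u = \<alpha> v)"
    and \<eta> [measurable]: "\<eta> \<in> sets borel" and \<eta>_sub: "\<eta> \<subseteq> Omega (polar_cone C)"
  shows "dual_curvature C q (gauge_body N) \<eta> =
    (\<integral>\<^sup>+v. indicator \<eta> (\<alpha> v) * ennreal (N v powr (- q))
       \<partial>cone_spherical (ennreal (if q = 0 then real DIM('a) else 1)))"
proof -
  let ?A = "gauge_body N"
  let ?R = "reverse_radial_Gauss_image C ?A \<eta>"
  have [measurable]: "N \<in> borel_measurable borel" by (rule gauge_funD(1)[OF N])
  have R: "v \<in> ?R \<longleftrightarrow> \<alpha> v \<in> \<eta>" if v: "v \<in> Omega C - E" for v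
  proof -
    have vO: "v \<in> Omega C" using v by simp
    have "v \<in> ?R \<longleftrightarrow> (\<exists>u\<in>\<eta>. normal_at N v u)"
      using boundary_point_normal(1)[OF N b vO] \<eta>_sub Omega_subset_Omega_e[OF N b] vO
      unfolding reverse_radial_Gauss_image_def by (intro iffI) blast+
    also have "\<dots> \<longleftrightarrow> \<alpha> v \<in> \<eta>" using normal v by blast
    finally show ?thesis .
  qed
  have int: "(\<integral>\<^sup>+v. ennreal (radial_fun C ?A v powr q) * indicator ?R v \<partial>spherical_measure)
    = (\<integral>\<^sup>+v. indicator \<eta> (\<alpha> v) * ennreal (N v powr (- q)) \<partial>cone_spherical (of_nat DIM('a)))"
    if one: "\<And>v. v \<in> Omega C \<Longrightarrow> ennreal (radial_fun C ?A v powr q) = ennreal (N v powr (- q))"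
    for q
  proof (rule nn_integral_spherical_measure[OF _ E(1,2)])
    show "(\<lambda>v. indicator \<eta> (\<alpha> v) * ennreal (N v powr (- q))) \<in> borel_measurable borel" by measurable
    show "t *\<^sub>R x \<in> E" if "x \<in> E" "0 < t" for x t using E(3) that by blast
    show "ennreal (radial_fun C ?A v powr q) * indicator ?R v = indicator \<eta> (\<alpha> v) * ennreal (N v powr (- q))"
      if v: "v \<in> Omega C - E" for v
      using R[OF v] one[of v] v by (simp add: indicator_def)
    show "ennreal (radial_fun C ?A v powr q) * indicator ?R v = 0" if "v \<notin> C" for v
      using that Omega_e_subset[OF N b] by (auto simp: reverse_radial_Gauss_image_def indicator_def)
  qed
  have rad: "radial_fun C ?A v powr q = N v powr (- q)" if v: "v \<in> Omega C" for v q
    using gauge_fun_pos[OF N b OmegaD(2)[OF v]]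
    by (simp add: radial_gauge_body[OF N b v] powr_divide powr_minus field_simps)
  show ?thesis
  proof (cases "q = 0")
    case True
    have "(\<integral>\<^sup>+v. 1 * indicator ?R v \<partial>spherical_measure)
        = (\<integral>\<^sup>+v. indicator \<eta> (\<alpha> v) * ennreal (N v powr (- q)) \<partial>cone_spherical (of_nat DIM('a)))"
    proof (rule nn_integral_spherical_measure[OF _ E(1,2)])
      show "(\<lambda>v. indicator \<eta> (\<alpha> v) * ennreal (N v powr (- q))) \<in> borel_measurable borel" by measurable
      show "t *\<^sub>R x \<in> E" if "x \<in> E" "0 < t" for x t using E(3) that by blast
      \<comment> \<open>Positivity of \<open>N v\<close> matters, because \<open>0 powr 0\<close> is
        0.\<close>
      show "1 * indicator ?R v = indicator \<eta> (\<alpha> v) * ennreal (N v powr (- q))"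
        if v: "v \<in> Omega C - E" for v
        using R[OF v] gauge_fun_pos[OF N b OmegaD(2), of v] v True by (simp add: indicator_def)
      show "1 * indicator ?R v = (0 :: ennreal)" if "v \<notin> C" for v
        using that Omega_e_subset[OF N b] by (auto simp: reverse_radial_Gauss_image_def indicator_def)
    qed
    then show ?thesis using True by (simp add: dual_curvature_def ennreal_of_nat_eq_real_of_nat)
  next
    case False
    have "dual_curvature C q ?A \<eta> = ennreal (1 / real DIM('a)) *
        (\<integral>\<^sup>+v. indicator \<eta> (\<alpha> v) * ennreal (N v powr (- q)) \<partial>cone_spherical (of_nat DIM('a)))"
      using False int[of q] rad[of _ q] by (simp add: dual_curvature_def)
    also have "\<dots> = (\<integral>\<^sup>+v. indicator \<eta> (\<alpha> v) * ennreal (N v powr (- q)) \<partial>cone_spherical (ennreal 1))"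
      by (simp add: nn_integral_cone_spherical mult.assoc[symmetric] ennreal_of_nat_eq_real_of_nat
          ennreal_mult[symmetric])
    finally show ?thesis using False by simp
  qed
qed

text \<open>Countable additivity of the dual curvature is inherited: on Borel sets it agrees with a
  genuine measure, the image under \<open>\<alpha>\<close> of a measure with density, and
  \<open>measure_of\<close> then returns that measure.\<close>

lemma pq_dual_curvature_gauge_body:
  fixes N :: "'a \<Rightarrow> real" and p q :: real
  defines "\<sigma> \<equiv> cone_spherical (ennreal (if q = 0 then real DIM('a) else 1))"
  assumes N: "gauge_fun b B N" and b: "0 < b"
    and \<alpha> [measurable]: "\<alpha> \<in> borel_measurable borel"
    and E: "E \<in> sets borel" "emeasure lborel E = 0" "\<forall>x\<in>E. \<forall>t>0. t *\<^sub>R x \<in> E"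
    and normal: "\<forall>v\<in>Omega C - E. normal_at N v (\<alpha> v) \<and> (\<forall>u. normal_at N v u \<longrightarrow> u = \<alpha> v)"
    and \<eta> [measurable]: "\<eta> \<in> sets borel" and \<eta>_sub: "\<eta> \<subseteq> Omega (polar_cone C)"
  shows "emeasure (pq_dual_curvature_measure C p q (gauge_body N)) \<eta> =
    (\<integral>\<^sup>+v. indicator \<eta> (\<alpha> v) * ennreal (pq_density p q N \<alpha> v) \<partial>\<sigma>)"
proof -
  let ?A = "gauge_body N" and ?P = "Omega (polar_cone C)"
  let ?h = "\<lambda>u. ennreal ((- support_fun ?A u) powr (- p))"
  interpret cm: cone_measure C \<sigma>
    unfolding \<sigma>_def by (rule cone_measure_cone_spherical) simp
  have [measurable]: "N \<in> borel_measurable borel" by (rule gauge_funD(1)[OF N])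
  have P [measurable]: "?P \<in> sets borel" unfolding Omega_def by simp
  have AE_E: "AE v in \<sigma>. v \<in> Omega C - E"
    using cm.AE_Omega cm.AE_notin_conic_null[OF E(1,2)] E(3) by auto
  define \<nu>0 where "\<nu>0 = distr (density \<sigma> (\<lambda>v. ennreal (N v powr (- q)))) borel \<alpha>"
  define \<nu> where "\<nu> = restrict_space \<nu>0 ?P"
  have sets_\<nu>0: "sets \<nu>0 = sets borel" by (simp add: \<nu>0_def)
  have sets_\<nu>: "sets \<nu> = sets (restrict_space borel ?P)"
    unfolding \<nu>_def by (rule sets_restrict_space_cong[OF sets_\<nu>0])
  have space_\<nu>: "space \<nu> = ?P"
    using sets_eq_imp_space_eq[OF sets_\<nu>] by (simp add: space_restrict_space)
  have int_\<nu>0: "(\<integral>\<^sup>+u. f u \<partial>\<nu>0) = (\<integral>\<^sup>+v. f (\<alpha> v) * ennreal (N v powr (- q)) \<partial>\<sigma>)"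
    if f [measurable]: "f \<in> borel_measurable borel" for f
  proof -
    have "(\<integral>\<^sup>+u. f u \<partial>\<nu>0) = (\<integral>\<^sup>+v. f (\<alpha> v) \<partial>density \<sigma> (\<lambda>v. ennreal (N v powr (- q))))"
      unfolding \<nu>0_def by (rule nn_integral_distr) auto
    also have "\<dots> = (\<integral>\<^sup>+v. ennreal (N v powr (- q)) * f (\<alpha> v) \<partial>\<sigma>)"
      by (rule nn_integral_density) measurable
    finally show ?thesis by (simp add: mult.commute)
  qed
  have eq_\<nu>: "dual_curvature C q ?A X = emeasure \<nu> X" if "X \<in> sets \<nu>" for X
  proof -
    have X: "X \<in> sets borel" "X \<subseteq> ?P" using that by (auto simp: sets_\<nu> sets_restrict_space_iff)
    have "emeasure \<nu> X = emeasure \<nu>0 X"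
      unfolding \<nu>_def using X by (intro emeasure_restrict_space) (auto simp: sets_\<nu>0)
    also have "\<dots> = (\<integral>\<^sup>+u. indicator X u \<partial>\<nu>0)" using X by (simp add: sets_\<nu>0)
    also have "\<dots> = (\<integral>\<^sup>+v. indicator X (\<alpha> v) * ennreal (N v powr (- q)) \<partial>\<sigma>)"
      using X by (intro int_\<nu>0) simp
    also have "\<dots> = dual_curvature C q ?A X"
      unfolding \<sigma>_def by (rule dual_curvature_gauge_body[OF N b \<alpha> E normal X, symmetric])
    finally show ?thesis by simp
  qed
  have D: "dual_curvature_measure C q ?A = \<nu>"
  proof -
    have "dual_curvature_measure C q ?A = measure_of (space \<nu>) (sets \<nu>) (dual_curvature C q ?A)"
      unfolding dual_curvature_measure_def by (simp only: sets_\<nu> space_\<nu>)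
    also have "\<dots> = measure_of (space \<nu>) (sets \<nu>) (emeasure \<nu>)"
      by (rule measure_of_eq[OF sets.space_closed]) (simp add: sets.sigma_sets_eq eq_\<nu>)
    also have "\<dots> = \<nu>" by (rule measure_of_of_measure)
    finally show ?thesis .
  qed
  have h_restr: "?h \<in> borel_measurable (restrict_space borel ?P)"
  proof -
    have "continuous_on ?P (support_fun ?A)"
      by (rule continuous_on_subset[OF support_gauge_body_continuous[OF N b]]) (auto simp: Omega_def)
    from borel_measurable_continuous_on_restrict[OF this] show ?thesis by measurable
  qed
  have h_\<nu>: "?h \<in> borel_measurable \<nu>" using h_restr measurable_cong_sets[OF sets_\<nu> refl] by blast
  \<comment> \<open>Extension by zero turns the weight on \<open>?P\<close> into a Borel function on
    the whole space, the form \<open>int_\<nu>0\<close> expects.\<close>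
  have h_borel: "(\<lambda>u. ?h u * indicator ?P u) \<in> borel_measurable borel"
    using h_restr by (subst (asm) borel_measurable_restrict_space_iff_ennreal) auto
  have \<eta>_\<nu>: "\<eta> \<in> sets \<nu>" using \<eta> \<eta>_sub by (simp add: sets_\<nu> sets_restrict_space_iff)
  have "emeasure (pq_dual_curvature_measure C p q ?A) \<eta> = (\<integral>\<^sup>+u. ?h u * indicator \<eta> u \<partial>\<nu>)"
    unfolding pq_dual_curvature_measure_def D by (rule emeasure_density[OF h_\<nu> \<eta>_\<nu>])
  also have "\<dots> = (\<integral>\<^sup>+u. ?h u * indicator \<eta> u * indicator ?P u \<partial>\<nu>0)"
    unfolding \<nu>_def by (rule nn_integral_restrict_space) (simp add: sets_\<nu>0)
  also have "\<dots> = (\<integral>\<^sup>+u. (?h u * indicator ?P u) * indicator \<eta> u \<partial>\<nu>0)"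
    by (simp add: mult_ac)
  also have "\<dots> = (\<integral>\<^sup>+v. (?h (\<alpha> v) * indicator ?P (\<alpha> v)) * indicator \<eta> (\<alpha> v) * ennreal (N v powr (- q)) \<partial>\<sigma>)"
    by (rule int_\<nu>0, rule borel_measurable_times_ennreal[OF h_borel]) simp
  also have "\<dots> = (\<integral>\<^sup>+v. indicator \<eta> (\<alpha> v) * ennreal (pq_density p q N \<alpha> v) \<partial>\<sigma>)"
  proof (rule nn_integral_cong_AE)
    show "AE v in \<sigma>. (?h (\<alpha> v) * indicator ?P (\<alpha> v)) * indicator \<eta> (\<alpha> v) * ennreal (N v powr (- q))
        = indicator \<eta> (\<alpha> v) * ennreal (pq_density p q N \<alpha> v)"
      using AE_E
    proof eventually_elim
      case (elim v)
      show ?case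
      proof (cases "\<alpha> v \<in> \<eta>")
        case True
        then have \<alpha>P: "\<alpha> v \<in> ?P" using \<eta>_sub by blast
        have vO: "v \<in> Omega C" and n: "normal_at N v (\<alpha> v)" using elim normal by auto
        have pos: "0 < N v" by (rule gauge_fun_pos[OF N b OmegaD(2)[OF vO]])
        have neg: "\<alpha> v \<bullet> v < 0"
          using n by (intro inner_interior_polar_neg[OF OmegaD(2)[OF vO]]) (auto simp: normal_at_def)
        have quot: "(t / n) powr (- p) = t powr (- p) * n powr p" if "0 < t" "0 < n" for t n :: real
          using that by (simp add: powr_divide powr_minus field_simps)
        have "(- support_fun ?A (\<alpha> v)) powr (- p) = (- (\<alpha> v \<bullet> v) / N v) powr (- p)"
          using boundary_point_normal(2)[OF N b vO \<alpha>P n] by simp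
        also have "\<dots> = (- (\<alpha> v \<bullet> v)) powr (- p) * N v powr p"
          using neg by (intro quot pos) simp
        finally have "(- support_fun ?A (\<alpha> v)) powr (- p) * N v powr (- q) = pq_density p q N \<alpha> v"
          using pos by (simp add: pq_density_def powr_diff powr_minus field_simps)
        then show ?thesis using True \<alpha>P by (simp add: ennreal_mult''[symmetric])
      qed simp
    qed
  qed
  finally show ?thesis .
qed

end

theorem theorem1p2:
  fixes C :: "'a::euclidean_space set" and p q :: real and \<mu> :: "'a measure"
  assumes "pointed_cone C"
    and "sets \<mu> = sets (restrict_space borel (Omega (polar_cone C)))"
    and "finite_measure \<mu>"
    and "emeasure \<mu> (Omega (polar_cone C)) \<noteq> 0"
    and "p \<le> 0" and "p < q"
  shows "\<exists>A. C_p_q_close C p q A \<and> \<mu> = pq_dual_curvature_measure C p q A"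
proof -
  interpret pointed_cone_space C by unfold_locales (rule assms(1))
  define \<sigma> where "\<sigma> = cone_spherical (ennreal (if q = 0 then real DIM('a) else 1))"
  interpret cm: cone_measure C \<sigma>
    unfolding \<sigma>_def by (rule cone_measure_cone_spherical) simp
  let ?P = "Omega (polar_cone C)"
  obtain b B N \<alpha> E where b: "0 < b" and N: "gauge_fun b B N" and \<alpha>: "\<alpha> \<in> borel_measurable borel"
    and E: "E \<in> sets borel" "emeasure lborel E = 0" "\<forall>x\<in>E. \<forall>t>0. t *\<^sub>R x \<in> E"
    and normal: "\<forall>v\<in>Omega C - E. normal_at N v (\<alpha> v) \<and> (\<forall>u. normal_at N v u \<longrightarrow> u = \<alpha> v)"
    and \<mu>: "\<forall>\<eta>\<in>sets \<mu>. emeasure \<mu> \<eta> = (\<integral>\<^sup>+v. indicator \<eta> (\<alpha> v) * ennreal (pq_density p q N \<alpha> v) \<partial>\<sigma>)"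
    using cm.limit_solution[OF assms(3,2,4,6)] by auto
  let ?\<nu> = "pq_dual_curvature_measure C p q (gauge_body N)"
  have P: "?P \<in> sets borel" unfolding Omega_def by simp
  have eq: "\<mu> = ?\<nu>"
  proof (rule measure_eqI)
    have "sets ?\<nu> = sigma_sets ?P (sets (restrict_space borel ?P))"
      unfolding pq_dual_curvature_measure_def dual_curvature_measure_def
      using sets.space_closed[of "restrict_space borel ?P"] by (simp add: space_restrict_space)
    also have "\<dots> = sets (restrict_space borel ?P)"
      using sets.sigma_sets_eq[of "restrict_space borel ?P"] by (simp add: space_restrict_space)
    finally show "sets \<mu> = sets ?\<nu>" using assms(2) by simp
    fix \<eta> assume "\<eta> \<in> sets \<mu>"
    moreover from this have "\<eta> \<in> sets borel" "\<eta> \<subseteq> ?P" using P by (auto simp: assms(2) sets_restrict_space_iff)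
    ultimately show "emeasure \<mu> \<eta> = emeasure ?\<nu> \<eta>"
      using \<mu> pq_dual_curvature_gauge_body[OF N b \<alpha> E normal] by (simp add: \<sigma>_def)
  qed
  \<comment> \<open>A nonzero measure lives on \<open>?P\<close>, so the polar cone has interior
    points, as separation by normals in \<open>?P\<close> requires.\<close>
  have "?P \<noteq> {}" using assms(4) by auto
  then have "C_compatible C (gauge_body N)" by (rule gauge_body_compatible[OF N b])
  moreover have "emeasure ?\<nu> ?P < \<infinity>"
    using finite_measure.emeasure_finite[OF assms(3)] by (simp add: eq[symmetric] less_top)
  ultimately have "C_p_q_close C p q (gauge_body N)" by (simp add: C_p_q_close_def)
  with eq show ?thesis by blast
qed

end
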